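(* Let $\Omega\subset\mathbb{R}^2$ be a bounded polygonal domain. Let $\alpha_\epsilon:\Omega\to\mathbb{R}$ be measurable with $0<\alpha_0\le\alpha_\epsilon(x)\le\alpha_1$ for almost every $x\in\Omega$, where $\alpha_0,\alpha_1$ are constants. Let $b:\mathbb{R}\to\mathbb{R}$ be continuous, $b\in W^{2,\infty}(\mathbb{R})$, with $0<b_0\le b(t)$ for all $t\in\mathbb{R}$, where $b_0$ is a constant. Let $f\in L^2(\Omega)$ and let $u\in H^1_0(\Omega)\cap W^{1,\infty}(\Omega)$ satisfy $\int_\Omega\alpha_\epsilon b(u)\nabla u\cdot\nabla v\,dx=\int_\Omega fv\,dx$ for all $v\in H^1_0(\Omega)$. Assume that: (i) there is a constant $c(u)>0$ such that $$\sup_{0\ne\chi\in H^1_0(\Omega)}\frac{a'(u;v,\chi)}{\|\chi\|_{H^1(\Omega)}}\ge c(u)\|v\|_{H^1(\Omega)}\qquad\text{for all }v\in H^1_0(\Omega);$$ (ii) for the Galerkin projections $P_h:H^1_0(\Omega)\to V_r$ one has $\|\chi-P_h\chi\|_{L^2(\Omega)}\le\hat c(h)\|\chi\|_{H^1(\Omega)}$ for all $\chi\in H^1_0(\Omega)$, where $\hat c(h)\to0$ as $h\to0$. Then there exist $h_0>0$ and $\eta>0$ such that, for every $h\le h_0$, the following holds: if $u_h,\tilde u_h\in V_r$ are two solutions of the discrete problem $$\int_\Omega\alpha_\epsilon(x)\,b(w)\,\nabla w\cdot\nabla v_r\,dx=\int_\Omega f v_r\,dx\quad\text{for all }v_r\in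 V_r\qquad(w=u_h\text{ and }w=\tilde u_h)$$ such that $$\|u-u_h\|_{W^{1,\infty}(\Omega)}+\|u-\tilde u_h\|_{W^{1,\infty}(\Omega)}\le\eta,$$ then $u_h=\tilde u_h$.
   Context: $\{\mathcal{T}_h\}$ is a family of partitions of $\Omega$ into finite elements $K$, indexed by the mesh size $h$. For each $h$, $V_h\subset H^1_0(\Omega)$ is an associated finite-dimensional finite element subspace of piecewise polynomial functions, $V_b=\{v\in H^1_0(\Omega): v|_K\in H^1_0(K)\text{ for all }K\in\mathcal{T}_h\}$, and $V_r=V_h\oplus V_b$ (which depends on $h$). The linearized form is $$a'(u;v,\chi)=\int_\Omega\alpha_\epsilon\nabla[b(u)v]\cdot\nabla\chi\,dx=\int_\Omega\alpha_\epsilon\,[b(u)\nabla v\cdot\nabla\chi+b'(u)\,v\,\nabla u\cdot\nabla\chi]\,dx.$$ $P_h:H^1_0(\Omega)\to V_r$ is the Galerkin projection with respect to the bilinear form $(v,\chi)\mapsto\int_\Omega\alpha_\epsilon\,b(u)\,\nabla v\cdot\nabla\chi\,dx$, i.e. $\int_\Omega\alpha_\epsilon b(u)\nabla(\chi-P_h\chi)\cdot\nabla v_r\,dx=0$ for all $v_r\in V_r$. *)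

theory Defs
  imports "HOL-Analysis.Analysis" "HOL-Probability.Essential_Supremum"
begin

text \<open>
  Elements of Lebesgue and Sobolev spaces on an open set are represented by total functions. Only
  their values on the open set matter, and two functions represent the same element iff they agree
  almost everywhere there.
\<close>

section \<open>Polygonal domains\<close>

text \<open>The condition \<open>interior (closure S) = S\<close> excludes slits and removed points.\<close>

definition polygonal_domain :: "(real^2) set \<Rightarrow> bool" where
  "polygonal_domain S \<longleftrightarrow>
     open S \<and> connected S \<and> bounded S \<and> S \<noteq> {} \<and> interior (closure S) = S \<and>
     (\<exists>E. finite E \<and> frontier S = (\<Union>(p, q)\<in>E. closed_segment p q))"

section \<open>Lebesgue spaces\<close>

definition L2 :: "'a::euclidean_space set \<Rightarrow> ('a \<Rightarrow> 'b::euclidean_space) set" where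
  "L2 S = {v \<in> borel_measurable (lebesgue_on S). integrable (lebesgue_on S) (\<lambda>x. (norm (v x))\<^sup>2)}"

definition L2_norm :: "'a::euclidean_space set \<Rightarrow> ('a \<Rightarrow> 'b::euclidean_space) \<Rightarrow> real" where
  "L2_norm S v = sqrt (\<integral>x. (norm (v x))\<^sup>2 \<partial>lebesgue_on S)"

definition Linf_norm :: "'a::euclidean_space set \<Rightarrow> ('a \<Rightarrow> 'b::euclidean_space) \<Rightarrow> ereal" where
  "Linf_norm S v = esssup (lebesgue_on S) (\<lambda>x. ereal (norm (v x)))"

definition Linf :: "'a::euclidean_space set \<Rightarrow> ('a \<Rightarrow> 'b::euclidean_space) set" where
  "Linf S = {v \<in> borel_measurable (lebesgue_on S). Linf_norm S v < \<infinity>}"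

section \<open>Weak gradients\<close>

primrec Ck :: "nat \<Rightarrow> ('a::euclidean_space \<Rightarrow> real) \<Rightarrow> bool" where
  "Ck 0 \<phi> \<longleftrightarrow> continuous_on UNIV \<phi>"
| "Ck (Suc k) \<phi> \<longleftrightarrow> (\<forall>x. \<phi> differentiable (at x)) \<and>
     (\<forall>i\<in>Basis. Ck k (\<lambda>x. frechet_derivative \<phi> (at x) i))"

definition test_function :: "'a::euclidean_space set \<Rightarrow> ('a \<Rightarrow> real) \<Rightarrow> bool" where
  "test_function S \<phi> \<longleftrightarrow>
     (\<forall>k. Ck k \<phi>) \<and> compact (closure {x. \<phi> x \<noteq> 0}) \<and> closure {x. \<phi> x \<noteq> 0} \<subseteq> S"

definition classical_grad :: "('a::euclidean_space \<Rightarrow> real) \<Rightarrow> 'a \<Rightarrow> 'a" where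
  "classical_grad \<phi> x = (\<Sum>i\<in>Basis. frechet_derivative \<phi> (at x) i *\<^sub>R i)"

definition locally_integrable :: "'a::euclidean_space set \<Rightarrow> ('a \<Rightarrow> 'b::euclidean_space) \<Rightarrow> bool" where
  "locally_integrable S v \<longleftrightarrow> (\<forall>C. compact C \<and> C \<subseteq> S \<longrightarrow> integrable (lebesgue_on C) v)"

definition has_weak_grad ::
    "'a::euclidean_space set \<Rightarrow> ('a \<Rightarrow> real) \<Rightarrow> ('a \<Rightarrow> 'a) \<Rightarrow> bool" where
  "has_weak_grad S v g \<longleftrightarrow> locally_integrable S v \<and> locally_integrable S g \<and>
     (\<forall>\<phi>. test_function S \<phi> \<longrightarrow>
        (\<integral>x. v x *\<^sub>R classical_grad \<phi> x \<partial>lebesgue_on S) = - (\<integral>x. \<phi> x *\<^sub>R g x \<partial>lebesgue_on S))"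

text \<open>Unique almost everywhere in the open set \<open>S\<close> whenever a weak gradient exists; otherwise
  arbitrary.\<close>

definition wgrad :: "'a::euclidean_space set \<Rightarrow> ('a \<Rightarrow> real) \<Rightarrow> 'a \<Rightarrow> 'a" where
  "wgrad S v = (SOME g. has_weak_grad S v g)"

section \<open>Sobolev spaces\<close>

definition H1 :: "'a::euclidean_space set \<Rightarrow> ('a \<Rightarrow> real) set" where
  "H1 S = {v \<in> L2 S. \<exists>g \<in> L2 S. has_weak_grad S v g}"

definition H1_norm :: "'a::euclidean_space set \<Rightarrow> ('a \<Rightarrow> real) \<Rightarrow> real" where
  "H1_norm S v = sqrt ((L2_norm S v)\<^sup>2 + (L2_norm S (wgrad S v))\<^sup>2)"

definition H10 :: "'a::euclidean_space set \<Rightarrow> ('a \<Rightarrow> real) set" where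
  "H10 S = {v \<in> H1 S. \<exists>\<phi>. (\<forall>n. test_function S (\<phi> n)) \<and>
     (\<lambda>n. H1_norm S (\<lambda>x. v x - \<phi> n x)) \<longlonglongrightarrow> 0}"

definition W1inf :: "'a::euclidean_space set \<Rightarrow> ('a \<Rightarrow> real) set" where
  "W1inf S = {v \<in> Linf S. \<exists>g \<in> Linf S. has_weak_grad S v g}"

text \<open>Extended-real valued: a weakly differentiable function outside \<open>W1inf S\<close> has norm
  \<open>\<infinity>\<close>.\<close>

definition W1inf_norm :: "'a::euclidean_space set \<Rightarrow> ('a \<Rightarrow> real) \<Rightarrow> ereal" where
  "W1inf_norm S v = max (Linf_norm S v) (Linf_norm S (wgrad S v))"

definition W2inf_real :: "(real \<Rightarrow> real) set" where
  "W2inf_real = {b \<in> W1inf UNIV. \<exists>b' \<in> W1inf UNIV. has_weak_grad UNIV b b'}"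

section \<open>Partitions and finite element spaces\<close>

text \<open>The elements are given by their interiors: disjoint open polygons whose closures cover the
  closure of the domain.\<close>

definition partition_into_elements :: "(real^2) set \<Rightarrow> (real^2) set set \<Rightarrow> bool" where
  "partition_into_elements \<Omega> \<T> \<longleftrightarrow>
     finite \<T> \<and> (\<forall>K\<in>\<T>. polygonal_domain K) \<and> pairwise disjnt \<T> \<and> (\<Union>K\<in>\<T>. closure K) = closure \<Omega>"

definition mesh_size :: "(real^2) set set \<Rightarrow> real" where
  "mesh_size \<T> = Max (diameter ` \<T>)"

definition finite_element_space ::
    "(real^2) set \<Rightarrow> (real^2) set set \<Rightarrow> (real^2 \<Rightarrow> real) set \<Rightarrow> bool" where
  "finite_element_space \<Omega> \<T> V \<longleftrightarrow>
     V \<subseteq> H10 \<Omega> \<and>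
     (\<lambda>x. 0) \<in> V \<and>
     (\<forall>v\<in>V. \<forall>w\<in>V. (\<lambda>x. v x + w x) \<in> V) \<and>
     (\<forall>a. \<forall>v\<in>V. (\<lambda>x. a * v x) \<in> V) \<and>
     (\<exists>B. finite B \<and> B \<subseteq> V \<and>
        (\<forall>v\<in>V. \<exists>a. AE x in lebesgue_on \<Omega>. v x = (\<Sum>\<beta>\<in>B. a \<beta> * \<beta> x))) \<and>
     (\<forall>v\<in>V. \<forall>K\<in>\<T>. \<exists>p. real_polynomial_function p \<and> (AE x in lebesgue_on K. v x = p x))"

definition bubble_space :: "(real^2) set \<Rightarrow> (real^2) set set \<Rightarrow> (real^2 \<Rightarrow> real) set" where
  "bubble_space \<Omega> \<T> = {v \<in> H10 \<Omega>. \<forall>K\<in>\<T>. v \<in> H10 K}"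

text \<open>The sum of the two spaces; that it is direct is expressed by \<open>direct_sum_with_bubbles\<close>.\<close>

definition enriched_space ::
    "(real^2) set \<Rightarrow> (real^2) set set \<Rightarrow> (real^2 \<Rightarrow> real) set \<Rightarrow> (real^2 \<Rightarrow> real) set" where
  "enriched_space \<Omega> \<T> V = {\<lambda>x. v x + w x | v w. v \<in> V \<and> w \<in> bubble_space \<Omega> \<T>}"

definition direct_sum_with_bubbles ::
    "(real^2) set \<Rightarrow> (real^2) set set \<Rightarrow> (real^2 \<Rightarrow> real) set \<Rightarrow> bool" where
  "direct_sum_with_bubbles \<Omega> \<T> V \<longleftrightarrow>
     (\<forall>v \<in> V \<inter> bubble_space \<Omega> \<T>. AE x in lebesgue_on \<Omega>. v x = 0)"

section \<open>Forms, discrete problem and Galerkin projection\<close>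

definition diffusion_form ::
    "(real^2) set \<Rightarrow> (real^2 \<Rightarrow> real) \<Rightarrow> (real \<Rightarrow> real) \<Rightarrow> (real^2 \<Rightarrow> real) \<Rightarrow>
     (real^2 \<Rightarrow> real) \<Rightarrow> (real^2 \<Rightarrow> real) \<Rightarrow> real" where
  "diffusion_form \<Omega> \<alpha> b u v \<psi> =
     (\<integral>x. \<alpha> x * b (u x) * (wgrad \<Omega> v x \<bullet> wgrad \<Omega> \<psi> x) \<partial>lebesgue_on \<Omega>)"

text \<open>The form \<open>\<integral> \<alpha> \<nabla>[b(u) v] \<bullet> \<nabla>\<psi>\<close>, with the gradient of the product expanded.
  For a continuous \<open>b\<close> in \<open>W2inf_real\<close> the classical derivative \<open>deriv b\<close> exists everywhere and
  is the Lipschitz continuous representative of the weak derivative.\<close>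

definition linearized_form ::
    "(real^2) set \<Rightarrow> (real^2 \<Rightarrow> real) \<Rightarrow> (real \<Rightarrow> real) \<Rightarrow> (real^2 \<Rightarrow> real) \<Rightarrow>
     (real^2 \<Rightarrow> real) \<Rightarrow> (real^2 \<Rightarrow> real) \<Rightarrow> real" where
  "linearized_form \<Omega> \<alpha> b u v \<psi> =
     (\<integral>x. \<alpha> x * (b (u x) * (wgrad \<Omega> v x \<bullet> wgrad \<Omega> \<psi> x)
                + deriv b (u x) * v x * (wgrad \<Omega> u x \<bullet> wgrad \<Omega> \<psi> x)) \<partial>lebesgue_on \<Omega>)"

definition solves_in ::
    "(real^2 \<Rightarrow> real) set \<Rightarrow> (real^2) set \<Rightarrow> (real^2 \<Rightarrow> real) \<Rightarrow> (real \<Rightarrow> real) \<Rightarrow> (real^2 \<Rightarrow> real) \<Rightarrow>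
     (real^2 \<Rightarrow> real) \<Rightarrow> bool" where
  "solves_in V \<Omega> \<alpha> b f w \<longleftrightarrow>
     w \<in> V \<and> (\<forall>v\<in>V. diffusion_form \<Omega> \<alpha> b w w v = (\<integral>x. f x * v x \<partial>lebesgue_on \<Omega>))"

definition galerkin_projection ::
    "(real^2 \<Rightarrow> real) set \<Rightarrow> (real^2) set \<Rightarrow> (real^2 \<Rightarrow> real) \<Rightarrow> (real \<Rightarrow> real) \<Rightarrow> (real^2 \<Rightarrow> real) \<Rightarrow>
     ((real^2 \<Rightarrow> real) \<Rightarrow> (real^2 \<Rightarrow> real)) \<Rightarrow> bool" where
  "galerkin_projection V \<Omega> \<alpha> b u P \<longleftrightarrow>
     (\<forall>\<psi> \<in> H10 \<Omega>. P \<psi> \<in> V \<and> (\<forall>v\<in>V. diffusion_form \<Omega> \<alpha> b u (\<lambda>x. \<psi> x - P \<psi> x) v = 0))"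

end

theory Submission
  imports Defs
begin

text \<open>
  Let \<open>e = u\<^sub>h - u\<^sub>h'\<close> be the difference of two discrete solutions near \<open>u\<close>.
    For an arbitrary
  \<open>\<zeta> \<in> H\<^sub>0\<^sup>1\<close> put \<open>\<psi>
    = \<zeta> - P\<^sub>h \<zeta>\<close> and split \<open>a'(u; e, \<zeta>)
      = a'(u; e, P\<^sub>h \<zeta>) + a'(u; e, \<psi>)\<close>. Subtracting
  the two discrete equations and expanding \<open>b\<close> around \<open>u\<close>, the first term is at most a multiple of
  \<open>\<eta> \<parallel>e\<parallel> \<parallel>\<zeta>\<parallel>\<close>. In the second term the principal part
    vanishes by Galerkin orthogonality, which leaves
  \<open>\<integral> e G \<bullet> grad \<psi>\<close> with the bounded field \<open>G
    = \<alpha> b'(u) grad u\<close>. For every \<open>\<epsilon> > 0\<close> this integral is at most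
  \<open>\<parallel>e\<parallel> (\<epsilon> \<parallel>grad \<psi>\<parallel>
    + C\<^sub>\<epsilon> \<parallel>\<psi>\<parallel>)\<close> up to a factor, where the last norm is that of
      \<open>L\<^sup>2\<close>: if \<open>G\<close> is smooth, integrate
  by parts; a bounded \<open>G\<close> is smooth up to an error that is small in \<open>L\<^sup>2\<close>,
    and against that error \<open>e\<close> may be
  replaced by its averages over small balls, which are bounded functions. As
    \<open>\<parallel>\<psi>\<parallel>\<close> in \<open>L\<^sup>2\<close> is at most
  \<open>chat h \<parallel>\<zeta>\<parallel>\<close>, the whole form is at most \<open>(3/4) c
    \<parallel>e\<parallel> \<parallel>\<zeta>\<parallel>\<close> for small \<open>h\<close> and \<open>\<eta>\<close>, and the
  inf-sup condition gives \<open>e = 0\<close>.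
\<close>

section \<open>Smooth bump functions\<close>

text \<open>The obstacle is that \<open>G\<close> is merely bounded. It has no derivative to
  integrate by parts with, and a direct estimate leaves the norm of \<open>grad \<psi>\<close>,
  which is only known to stay bounded as the mesh is refined. Smoothing \<open>G\<close> with a
  small L2 error does not suffice by itself, because that error then meets two factors that are only
  square integrable. Averages over balls of radius \<delta> separate the two difficulties:
  \<open>e\<close> minus its average has size \<delta> times the gradient norm and is paired with
  the error in its sup bound, while the average itself is bounded, at a price depending on \<delta>,
  and is paired with the error in L2. So the choices come in the order \<epsilon>, \<delta>, smooth
  field, \<open>C\<close>; this is not circular because the smooth fields obey a sup bound that does
  not depend on their accuracy. A separate strand concerns \<open>b\<close>: expanding it around
  \<open>u\<close> requires a classical derivative that is Lipschitz, whereas only weak derivatives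
  are given. Mollification yields it.\<close>

lemma frechet_derivative_at_eqI:
  "(f has_derivative f') (at x) \<Longrightarrow> frechet_derivative f (at x) = f'"
  by (metis frechet_derivative_at)

lemma frechet_derivative_add:
  fixes f g :: "'a::real_normed_vector \<Rightarrow> real"
  assumes "f differentiable (at x)" "g differentiable (at x)"
  shows "frechet_derivative (\<lambda>x. f x + g x) (at x) i
      = frechet_derivative f (at x) i + frechet_derivative g (at x) i"
  using assms[unfolded frechet_derivative_works]
  by (simp add: frechet_derivative_at_eqI[OF has_derivative_add])

lemma frechet_derivative_mult:
  fixes f g :: "'a::real_normed_vector \<Rightarrow> real"
  assumes "f differentiable (at x)" "g differentiable (at x)"
  shows "frechet_derivative (\<lambda>x. f x * g x) (at x) i
      = f x * frechet_derivative g (at x) i + frechet_derivative f (at x) i * g x"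
  using assms[unfolded frechet_derivative_works]
  by (simp add: frechet_derivative_at_eqI[OF has_derivative_mult])

lemma Ck_add: "Ck k f \<Longrightarrow> Ck k g \<Longrightarrow> Ck k (\<lambda>x. f x + g x)"
proof (induction k arbitrary: f g)
  case (Suc k)
  then have "frechet_derivative (\<lambda>x. f x + g x) (at x) i
      = frechet_derivative f (at x) i + frechet_derivative g (at x) i" for x i
    by (intro frechet_derivative_add) auto
  with Suc show ?case by auto
qed (auto intro: continuous_intros)

lemma Ck_cmult: "Ck k f \<Longrightarrow> Ck k (\<lambda>x. a * f x)"
proof (induction k arbitrary: f)
  case (Suc k)
  then have "frechet_derivative (\<lambda>x. a * f x) (at x) i
      = a * frechet_derivative f (at x) i" for x i
    by (subst frechet_derivative_mult) auto
  with Suc show ?case by auto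
qed (auto intro: continuous_intros)

lemma real_polynomial_function_partial:
  assumes "real_polynomial_function p"
  shows "(\<forall>x. p differentiable (at x)) \<and>
    real_polynomial_function (\<lambda>x. frechet_derivative p (at x) i)"
  using assms
proof induction
  case (linear f)
  then have "frechet_derivative f (at x) = f" for x
    by (intro frechet_derivative_at_eqI bounded_linear_imp_has_derivative)
  with linear show ?case
    by (auto intro: bounded_linear_imp_differentiable)
next
  case (const c)
  then show ?case by auto
next
  case (add f g)
  then have "frechet_derivative (\<lambda>x. f x + g x) (at x) i
      = frechet_derivative f (at x) i + frechet_derivative g (at x) i" for x
    by (intro frechet_derivative_add) auto
  with add show ?case by auto
next
  case (mult f g)
  then have "frechet_derivative (\<lambda>x. f x * g x) (at x) i
      = f x * frechet_derivative g (at x) i + frechet_derivative f (at x) i * g x" for x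
    by (intro frechet_derivative_mult) auto
  with mult show ?case by auto
qed

lemma continuous_on_real_polynomial:
  "real_polynomial_function p \<Longrightarrow> continuous_on A p"
  by (simp add: continuous_on_polymonial_function real_polynomial_function_eq)

text \<open>The standard smooth function exp(-1/t), glued to 0, together with its quotients by
  powers of t. The powers make the family closed under differentiation up to linear combinations, so
  one induction gives smoothness of every order.\<close>

definition flat :: "nat \<Rightarrow> real \<Rightarrow> real" where
  "flat m t = (if t \<le> 0 then 0 else exp (- 1 / t) / t ^ m)"

lemma flat_nonneg: "0 \<le> flat m t"
  by (simp add: flat_def)

lemma flat_pos_iff: "0 < flat m t \<longleftrightarrow> 0 < t"
  by (auto simp: flat_def)

lemma flat_0_le_1: "flat 0 t \<le> 1"
  by (simp add: flat_def)

lemma power_div_fact_le_exp: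
  fixes y :: real assumes "0 \<le> y" shows "y ^ n / fact n \<le> exp y"
proof -
  have s: "(\<lambda>k. y ^ k / fact k) sums exp y"
    using exp_converges[of y] by (simp add: divide_inverse mult.commute)
  have "(\<Sum>k\<in>{n}. y ^ k / fact k) \<le> exp y"
    using assms s by (intro sum_le_suminf[THEN order_trans, of _ "{n}"])
      (auto simp: sums_iff)
  then show ?thesis by simp
qed

text \<open>The exponential series at 1/t dominates its term of order m + 2. The resulting quadratic
  decay is what makes the derivative at the gluing point 0 exist and vanish.\<close>

lemma flat_le: "\<bar>flat m t\<bar> \<le> fact (m + 2) * t^2"
proof (cases "t \<le> 0")
  case False
  then have t: "0 < t" by simp
  have "(1 / t) ^ (m + 2) / fact (m + 2) \<le> exp (1 / t)"
    using t by (intro power_div_fact_le_exp) simp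
  then have "exp (- 1 / t) \<le> fact (m + 2) * t ^ (m + 2)"
    using t by (simp add: exp_minus field_simps power_divide del: fact_Suc)
  then have "exp (- 1 / t) / t ^ m \<le> fact (m + 2) * t ^ (m + 2) / t ^ m"
    using t by (intro divide_right_mono) auto
  also have "\<dots> = fact (m + 2) * t^2"
    using t by (simp add: power_add field_simps power2_eq_square del: fact_Suc)
  finally show ?thesis using t by (simp add: flat_def)
qed (simp add: flat_def)

text \<open>Away from 0 this is the quotient rule; at 0 the quadratic bound forces the difference
  quotient to 0, which is also the value of the right-hand side there.\<close>

lemma has_real_derivative_flat:
  "(flat m has_real_derivative flat (m + 2) t - real m * flat (m + 1) t) (at t)"
proof -
  consider "t < 0" | "t = 0" | "t > 0" by linarith
  then show ?thesis
  proof cases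
    case 1
    have "((\<lambda>x. 0) has_real_derivative 0) (at t)" by simp
    then have "(flat m has_real_derivative 0) (at t)"
      by (rule has_field_derivative_transform_within_open[where S = "{..<0}"])
        (use 1 in \<open>auto simp: flat_def\<close>)
    then show ?thesis using 1 by (simp add: flat_def)
  next
    case 2
    have "((\<lambda>h. (flat m (0 + h) - flat m 0) / h) \<longlongrightarrow> 0) (at 0)"
    proof (rule Lim_null_comparison)
      show "\<forall>\<^sub>F h in at 0. norm ((flat m (0 + h) - flat m 0) / h) \<le> fact (m + 2) * \<bar>h\<bar>"
      proof (rule eventually_at_topological[THEN iffD2], intro exI[of _ UNIV] conjI ballI impI)
        fix h :: real assume "h \<noteq> 0"
        have "\<bar>flat m h\<bar> / \<bar>h\<bar> \<le> fact (m + 2) * h^2 / \<bar>h\<bar>"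
          by (intro divide_right_mono flat_le) simp
        also have "\<dots> = fact (m + 2) * \<bar>h\<bar>"
        proof -
          have "h^2 / \<bar>h\<bar> = \<bar>h\<bar>"
            by (cases "h \<ge> 0") (auto simp: power2_eq_square)
          then show ?thesis by (metis times_divide_eq_right)
        qed
        finally show "norm ((flat m (0 + h) - flat m 0) / h) \<le> fact (m + 2) * \<bar>h\<bar>"
          unfolding real_norm_def abs_divide by (simp only: flat_def[of _ 0]) simp
      qed auto
      show "((\<lambda>h. fact (m + 2) * \<bar>h\<bar>) \<longlongrightarrow> (0::real)) (at 0)"
        by (auto intro!: tendsto_eq_intros)
    qed
    with 2 show ?thesis by (simp add: DERIV_def flat_def[of _ 0])
  next
    case 3
    have pw: "n \<noteq> 0 \<Longrightarrow> t * t ^ (n - Suc 0) = t ^ n" for n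
      by (cases n) auto
    have "((\<lambda>t. exp (- 1 / t) / t ^ m) has_real_derivative
        exp (- 1 / t) / t ^ (m + 2) - real m * (exp (- 1 / t) / t ^ (m + 1))) (at t)"
      using 3 by (cases m; auto intro!: derivative_eq_intros simp: field_simps power2_eq_square; metis pw)
    then have "(flat m has_real_derivative
        exp (- 1 / t) / t ^ (m + 2) - real m * (exp (- 1 / t) / t ^ (m + 1))) (at t)"
      by (rule has_field_derivative_transform_within_open[where S = "{0<..}"])
        (use 3 in \<open>auto simp: flat_def\<close>)
    then show ?thesis using 3 by (simp add: flat_def)
  qed
qed

lemma continuous_on_flat [continuous_intros]:
  "continuous_on A g \<Longrightarrow> continuous_on A (\<lambda>x. flat m (g x))"
proof -
  have "continuous_on UNIV (flat m)"
    by (meson DERIV_isCont continuous_at_imp_continuous_on has_real_derivative_flat)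
  then show "continuous_on A g \<Longrightarrow> continuous_on A (\<lambda>x. flat m (g x))"
    using continuous_on_compose2 by blast
qed

text \<open>A partial derivative is a sum of three terms of the same shape, with other polynomial
  factors and with \<open>m\<close> raised by 2, 1 or 0. The induction therefore has to be general
  in \<open>q\<close> and \<open>m\<close>.\<close>

lemma Ck_polynomial_flat:
  fixes p q :: "'a::euclidean_space \<Rightarrow> real"
  assumes p: "real_polynomial_function p" and q: "real_polynomial_function q"
  shows "Ck k (\<lambda>x. q x * flat m (p x))"
  using q
proof (induction k arbitrary: q m)
  case 0
  then show ?case using p by (auto intro!: continuous_on_mult continuous_on_flat
        intro: continuous_on_real_polynomial)
next
  case (Suc k)
  note pp = real_polynomial_function_partial[OF p] and qq = real_polynomial_function_partial[OF Suc.prems]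
  have d: "((\<lambda>x. q x * flat m (p x)) has_derivative (\<lambda>i. q x * ((flat (m + 2) (p x)
      - real m * flat (m + 1) (p x)) * frechet_derivative p (at x) i)
      + frechet_derivative q (at x) i * flat m (p x))) (at x)" for x
  proof -
    have P: "(p has_derivative frechet_derivative p (at x)) (at x)"
      and Q: "(q has_derivative frechet_derivative q (at x)) (at x)"
      using pp qq by (auto simp: frechet_derivative_works[symmetric])
    have "((\<lambda>x. flat m (p x)) has_derivative (\<lambda>i. (flat (m + 2) (p x)
      - real m * flat (m + 1) (p x)) * frechet_derivative p (at x) i)) (at x)"
      using has_derivative_compose[OF P
          has_real_derivative_flat[unfolded has_field_derivative_def]] by simp
    with Q show ?thesis by (rule has_derivative_mult)
  qed
  have "Ck k (\<lambda>x. frechet_derivative (\<lambda>x. q x * flat m (p x)) (at x) i)" for i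
  proof -
    have "Ck k (\<lambda>x. ((q x * frechet_derivative p (at x) i) * flat (m + 2) (p x)
      + (- real m * (q x * frechet_derivative p (at x) i)) * flat (m + 1) (p x))
      + frechet_derivative q (at x) i * flat m (p x))"
      using pp qq Suc.prems by (intro Ck_add Suc.IH real_polynomial_function.intros(2,4)) auto
    then show ?thesis
      unfolding frechet_derivative_at_eqI[OF d] by (simp add: algebra_simps)
  qed
  then show ?case using d by (auto simp: differentiable_def)
qed

lemma test_functionI:
  assumes "\<And>k. Ck k \<phi>" "compact K" "K \<subseteq> S" "\<And>x. x \<notin> K \<Longrightarrow> \<phi> x = 0"
  shows "test_function S \<phi>"
proof -
  have "closure {x. \<phi> x \<noteq> 0} \<subseteq> K"
    using assms by (intro closure_minimal) (auto simp: compact_imp_closed)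
  then show ?thesis
    using assms unfolding test_function_def
    by (metis bounded_subset compact_closure compact_eq_bounded_closed closed_closure order_trans)
qed

text \<open>The squared norm keeps the argument of \<open>flat\<close> polynomial. The factor
  \<open>a\<close> steepens the bump: for growing \<open>a\<close> it tends to the indicator of the
  open ball.\<close>

definition ball_bump :: "real \<Rightarrow> 'a::euclidean_space \<Rightarrow> real \<Rightarrow> 'a \<Rightarrow> real" where
  "ball_bump a c r x = flat 0 (a * (r^2 - (x - c) \<bullet> (x - c)))"

lemma ball_bump_eq_0:
  assumes "0 \<le> a" "0 \<le> r" "x \<notin> ball c r"
  shows "ball_bump a c r x = 0"
proof -
  have "r \<le> norm (x - c)" using assms(3) by (simp add: dist_norm norm_minus_commute)
  then have "r^2 \<le> (x - c) \<bullet> (x - c)"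
    using assms by (simp add: power2_norm_eq_inner[symmetric] power_mono)
  then show ?thesis using assms by (simp add: ball_bump_def flat_def mult_nonneg_nonpos)
qed

lemma test_function_polynomial_bump:
  fixes c :: "'a::euclidean_space"
  assumes q: "real_polynomial_function q" and "0 \<le> a" "0 \<le> r" and c: "cball c r \<subseteq> S"
  shows "test_function S (\<lambda>x. q x * ball_bump a c r x)"
proof (rule test_functionI[OF _ compact_cball c])
  have "real_polynomial_function (\<lambda>x. (x - c) \<bullet> (x - c))"
  proof -
    have "polynomial_function (\<lambda>x. x - c)"
      by (intro polynomial_function_diff) auto
    then have "real_polynomial_function (\<lambda>x. (x - c) \<bullet> i)" for i
      using polynomial_function_inner[of "\<lambda>x. x - c" i] by (simp add: real_polynomial_function_eq)
    then show ?thesis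
      by (subst euclidean_inner) (auto intro!: real_polynomial_function_sum)
  qed
  then have "real_polynomial_function (\<lambda>x. a * (r^2 - (x - c) \<bullet> (x - c)))"
    by (intro real_polynomial_function.intros(2,4) real_polynomial_function_diff)
  from Ck_polynomial_flat[OF this q]
  show "Ck k (\<lambda>x. q x * ball_bump a c r x)" for k by (simp add: ball_bump_def)
next
  fix x assume "x \<notin> cball c r"
  then show "q x * ball_bump a c r x = 0" using ball_bump_eq_0[OF assms(2,3), where x = x and c = c] by simp
qed

lemma bump_tendsto_indicator:
  fixes c x :: "'a::euclidean_space"
  assumes "0 \<le> r"
  shows "(\<lambda>n. ball_bump (real n) c r x) \<longlonglongrightarrow> indicator (ball c r) x"
proof (cases "x \<in> ball c r")
  case True
  then have "norm (x - c) < r" by (simp add: dist_norm norm_minus_commute)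
  then have "(norm (x - c))^2 < r^2" by (simp add: power_strict_mono)
  then have pos: "0 < r^2 - (x - c) \<bullet> (x - c)" (is "0 < ?s") by (simp add: power2_norm_eq_inner)
  have "(\<lambda>n. exp (- (1 / (real n * ?s)))) \<longlonglongrightarrow> exp (- 0)"
  proof (intro tendsto_exp tendsto_minus)
    show "(\<lambda>n. 1 / (real n * ?s)) \<longlonglongrightarrow> 0"
      using tendsto_mult_right_zero[OF lim_1_over_n, of "1 / ?s"] by (simp add: field_simps)
  qed
  moreover have "\<forall>\<^sub>F n in sequentially. exp (- (1 / (real n * ?s))) = flat 0 (real n * ?s)"
    using pos by (auto simp: flat_def mult_le_0_iff intro!: eventually_sequentiallyI[of 1])
  ultimately have "(\<lambda>n. flat 0 (real n * ?s)) \<longlonglongrightarrow> 1"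
    using Lim_transform_eventually by fastforce
  with True show ?thesis by (simp add: ball_bump_def)
next
  case False
  then have "ball_bump (real n) c r x = 0" for n by (intro ball_bump_eq_0 assms) simp
  with False show ?thesis by simp
qed

section \<open>The fundamental lemma of the calculus of variations\<close>

lemma complete_measure_lebesgue_on:
  assumes "S \<in> sets lebesgue" shows "complete_measure (lebesgue_on S)"
proof
  fix A B assume "B \<subseteq> A" "A \<in> null_sets (lebesgue_on S)"
  then show "B \<in> sets (lebesgue_on S)"
    using assms null_sets_restrict_space[of S lebesgue]
    by (metis Int_absorb1 completion.complete2 dual_order.trans null_setsD2 sets.Int_space_eq2
        sets_restrict_space_iff space_completion space_lborel)
qed

text \<open>Completeness of the measure lets measurability pass to functions known only almost
  everywhere. This matters for \<open>wgrad\<close>, an arbitrary choice among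
  representatives.\<close>

lemma borel_measurable_lebesgue_on_cong_AE:
  fixes f g :: "'a::euclidean_space \<Rightarrow> 'b::topological_space"
  assumes S: "S \<in> sets lebesgue" and f: "f \<in> borel_measurable (lebesgue_on S)"
    and eq: "AE x in lebesgue_on S. f x = g x"
  shows "g \<in> borel_measurable (lebesgue_on S)"
proof (rule measurableI)
  fix A :: "'b set" assume "A \<in> sets borel"
  then have A: "f -` A \<inter> space (lebesgue_on S) \<in> sets (lebesgue_on S)"
    using f by (rule measurable_sets[rotated])
  have "AE x in lebesgue_on S. x \<in> f -` A \<inter> space (lebesgue_on S)
      \<longleftrightarrow> x \<in> g -` A \<inter> space (lebesgue_on S)"
    using eq by eventually_elim simp
  from complete_measure.in_sets_AE[OF complete_measure_lebesgue_on[OF S] this A]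
  show "g -` A \<inter> space (lebesgue_on S) \<in> sets (lebesgue_on S)" by blast
qed simp

lemma AE_lebesgue_on_iff:
  "S \<in> sets lebesgue \<Longrightarrow> (AE x in lebesgue_on S. P x) \<longleftrightarrow> (AE x in lebesgue. x
    \<in> S \<longrightarrow> P x)"
  by (simp add: AE_restrict_space_iff)

lemma integral_lebesgue_on_superset:
  fixes f :: "'a::euclidean_space \<Rightarrow> 'b::euclidean_space"
  assumes "T \<subseteq> S" "S \<in> sets lebesgue" "T \<in> sets lebesgue" "\<And>x. x \<in> S - T \<Longrightarrow> f x = 0"
  shows "(LINT x|lebesgue_on S. f x) = (LINT x|lebesgue_on T. f x)" (is ?A)
    and "integrable (lebesgue_on S) f \<longleftrightarrow> integrable (lebesgue_on T) f" (is ?B)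
proof -
  have "(\<lambda>x. indicator S x *\<^sub>R f x) = (\<lambda>x. indicator T x *\<^sub>R f x)"
    using assms by (auto simp: indicator_def fun_eq_iff)
  then show ?A
    ?B
    using assms by (simp_all add: integral_restrict_space integrable_restrict_space)
qed

lemma integrable_lebesgue_on_subset:
  fixes f :: "'a::euclidean_space \<Rightarrow> 'b::euclidean_space"
  assumes "integrable (lebesgue_on S) f" "T \<subseteq> S" "S \<in> sets lebesgue" "T \<in> sets lebesgue"
  shows "integrable (lebesgue_on T) f"
proof -
  have "integrable lebesgue (\<lambda>x. indicator T x *\<^sub>R (indicator S x *\<^sub>R f x))"
    using assms integrable_restrict_space[of S lebesgue f] by (subst integrable_mult_indicator[of T]) auto
  moreover have "(\<lambda>x. indicator T x *\<^sub>R (indicator S x *\<^sub>R f x)) = (\<lambda>x. indicator T x *\<^sub>R f x)"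
    using assms by (auto simp: indicator_def fun_eq_iff)
  ultimately show ?thesis using assms by (simp add: integrable_restrict_space)
qed

lemma open_imp_lebesgue: "open S \<Longrightarrow> S \<in> sets lebesgue"
  by auto

lemma continuous_imp_measurable_lebesgue_on:
  fixes f :: "'a::euclidean_space \<Rightarrow> 'b::euclidean_space"
  shows "continuous_on UNIV f \<Longrightarrow> f \<in> borel_measurable (lebesgue_on S)"
  by (intro measurable_restrict_space1 measurable_completion) (simp add: borel_measurable_continuous_onI)

text \<open>A measurable function is an almost everywhere limit of continuous ones. These are cut
  off at radius \<open>M\<close> and then approximated by Stone-Weierstrass on the compact closure
  of \<open>S\<close>. The error 1/(n+1) of the last step is at most 1, hence the bound
  \<open>M + 1\<close> for all \<open>n\<close>.\<close>

lemma bounded_measurable_polynomial_approximation: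
  fixes G :: "'a::euclidean_space \<Rightarrow> 'b::euclidean_space"
  assumes S: "S \<in> sets lebesgue" and bS: "bounded S" and G: "G \<in> borel_measurable (lebesgue_on S)"
    and M: "AE x in lebesgue_on S. norm (G x) \<le> M" "0 \<le> M"
  obtains q :: "nat \<Rightarrow> 'a \<Rightarrow> 'b" where "\<And>n. polynomial_function (q n)"
    "\<And>n x. x \<in> S \<Longrightarrow> norm (q n x)
      \<le> M + 1" "AE x in lebesgue_on S. (\<lambda>n. q n x) \<longlonglongrightarrow> G x"
proof -
  have "G measurable_on S" using measurable_on_iff_borel_measurable[OF S] G by blast
  then obtain N g where N: "negligible N" and g: "\<And>n. continuous_on UNIV (g n)"
    and lim: "\<And>x. x \<notin> N
      \<Longrightarrow> (\<lambda>n::nat. g n x) \<longlonglongrightarrow> (if x \<in> S then G x else 0)"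
    unfolding measurable_on_def by blast
  \<comment> \<open>Projecting onto the ball is continuous and fixes the values of \<open>G\<close>,
    so the cut-off approximants keep the limit.\<close>
  define cp where "cp = closest_point (cball (0::'b) M)"
  have ne: "cball (0::'b) M \<noteq> {}" using M by simp
  have cp: "continuous_on UNIV cp" "\<And>y. norm (cp y) \<le> M" "\<And>y. norm y \<le> M \<Longrightarrow> cp y = y"
    using continuous_on_closest_point[OF convex_cball closed_cball ne, of UNIV]
      closest_point_in_set[OF closed_cball ne] closest_point_self[of _ "cball (0::'b) M"]
    by (auto simp: cp_def dist_norm)
  have cont: "continuous_on UNIV (\<lambda>x. cp (g n x))" for n
    using cp(1) g continuous_on_compose2 by blast
  have "\<exists>q. polynomial_function q \<and> (\<forall>x\<in>closure S. norm (cp (g n x) - q x) < 1 / (real n + 1))" for n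
    by (rule Stone_Weierstrass_polynomial_function[of "closure S" "\<lambda>x. cp (g n x)" "1 / (real n + 1)"])
      (use cont[of n] bS in \<open>auto intro: continuous_on_subset\<close>)
  then obtain q where q: "\<And>n. polynomial_function (q n)"
    and qg: "\<And>n x. x \<in> S \<Longrightarrow> norm (cp (g n x) - q n x) < 1 / (real n + 1)"
    using closure_subset[of S] by (metis subsetD)
  show thesis
  proof (rule that[of q])
    fix n x assume "x \<in> S"
    have "norm (q n x) \<le> norm (cp (g n x)) + norm (cp (g n x) - q n x)"
      by norm
    also have "\<dots> \<le> M + 1 / (real n + 1)"
      using qg[OF \<open>x \<in> S\<close>, of n] cp(2) by (intro add_mono) (auto intro: less_imp_le)
    also have "\<dots> \<le> M + 1" by (simp add: field_simps)
    finally show "norm (q n x) \<le> M + 1" .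
  next
    have "AE x in lebesgue. x \<notin> N"
      using N by (intro AE_not_in) (simp add: negligible_iff_null_sets)
    then have "AE x in lebesgue_on S. x \<notin> N"
      by (auto simp: AE_lebesgue_on_iff[OF S] elim!: eventually_mono)
    moreover have "AE x in lebesgue_on S. x \<in> S"
      using AE_space[of "lebesgue_on S"] by simp
    ultimately show "AE x in lebesgue_on S. (\<lambda>n. q n x) \<longlonglongrightarrow> G x"
      using M(1)
    proof eventually_elim
      case (elim x)
      have "(\<lambda>n. g n x) \<longlonglongrightarrow> G x" using lim[of x] elim by simp
      then have "(\<lambda>n. cp (g n x)) \<longlonglongrightarrow> cp (G x)"
        using cp(1) by (auto simp: continuous_on_eq_continuous_at intro: isCont_tendsto_compose)
      then have "(\<lambda>n. cp (g n x)) \<longlonglongrightarrow> G x" using cp(3) elim by simp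
      moreover have "(\<lambda>n. cp (g n x) - q n x) \<longlonglongrightarrow> 0"
      proof (rule Lim_null_comparison)
        show "\<forall>\<^sub>F n in sequentially. norm (cp (g n x) - q n x) \<le> 1 / (real n + 1)"
          using qg[of x] elim by (intro always_eventually allI less_imp_le) auto
        show "(\<lambda>n. 1 / (real n + 1)) \<longlonglongrightarrow> 0"
          using LIMSEQ_inverse_real_of_nat by (simp add: field_simps)
      qed
      ultimately have "(\<lambda>n. cp (g n x) - (cp (g n x) - q n x)) \<longlonglongrightarrow> G x - 0"
        by (intro tendsto_diff)
      then show ?case by simp
    qed
  qed (use q in auto)
qed

lemma test_function_continuous: "test_function S \<phi> \<Longrightarrow> continuous_on A \<phi>"
  unfolding test_function_def by (metis Ck.simps(1) continuous_on_subset subset_UNIV)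

text \<open>Bumps times polynomials are test functions, and polynomials approximate \<open>sgn g\<close>.\<close>

lemma fundamental_lemma_calculus_of_variations:
  fixes g :: "'a::euclidean_space \<Rightarrow> real"
  assumes S: "open S" and g: "locally_integrable S g"
    and zero: "\<And>\<phi>. test_function S \<phi> \<Longrightarrow> (LINT x|lebesgue_on S. \<phi> x * g x) = 0"
  shows "AE x in lebesgue_on S. g x = 0"
proof -
  \<comment> \<open>Balls with closure in \<open>S\<close> are bounded and \<open>g\<close> is
    integrable on them, as polynomial approximation and dominated convergence require.\<close>
  have local: "AE x in lebesgue_on (ball c r). g x = 0" if c: "cball c r \<subseteq> S" "0 < r" for c r
  proof -
    let ?B = "ball c r"
    have gB: "integrable (lebesgue_on ?B) g"
      using g c integrable_lebesgue_on_subset[of "cball c r" g "ball c r"]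
      by (auto simp: locally_integrable_def)
    have BS: "?B \<subseteq> S" using c ball_subset_cball by blast
    have poly: "(LINT x|lebesgue_on ?B. q x * g x) = 0" if q: "real_polynomial_function q" for q
    proof -
      define \<phi> where "\<phi> n x = q x * ball_bump (real n) c r x" for n x
      have test: "test_function S (\<phi> n)" for n
        unfolding \<phi>_def using c q by (intro test_function_polynomial_bump) auto
      have out: "\<phi> n x = 0" if "x \<notin> ball c r" for n x
        using ball_bump_eq_0[OF _ _ that] c by (simp add: \<phi>_def)
      have z: "(LINT x|lebesgue_on ?B. \<phi> n x * g x) = 0" for n
        using zero[OF test] integral_lebesgue_on_superset(1)[OF BS, of "\<lambda>x. \<phi> n x * g x"] S out
        by auto
      obtain C where C: "\<And>x. x \<in> cball c r \<Longrightarrow> \<bar>q x\<bar> \<le> C"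
        using compact_continuous_image[OF continuous_on_real_polynomial[OF q] compact_cball]
        by (metis bounded_iff compact_imp_bounded imageI real_norm_def)
      have qm: "q \<in> borel_measurable (lebesgue_on ?B)" "\<phi> n \<in> borel_measurable (lebesgue_on ?B)" for n
        using q test_function_continuous[OF test]
        by (auto intro: continuous_imp_measurable_lebesgue_on continuous_on_real_polynomial)
      have "(\<lambda>n. LINT x|lebesgue_on ?B. \<phi> n x * g x) \<longlonglongrightarrow> (LINT x|lebesgue_on ?B. q x * g x)"
      proof (rule integral_dominated_convergence[where w = "\<lambda>x. C * \<bar>g x\<bar>"])
        show "integrable (lebesgue_on ?B) (\<lambda>x. C * \<bar>g x\<bar>)" using gB by simp
        show "AE x in lebesgue_on ?B. (\<lambda>n. \<phi> n x * g x) \<longlonglongrightarrow> q x * g x"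
        proof (rule AE_I2)
          fix x assume "x \<in> space (lebesgue_on ?B)"
          then have "indicator ?B x = (1::real)" by simp
          then have "(\<lambda>n. ball_bump (real n) c r x) \<longlonglongrightarrow> 1"
            using bump_tendsto_indicator[where r = r and x = x and c = c] c by simp
          from tendsto_mult_right[OF tendsto_mult_left[OF this, of "q x"], of "g x"]
          show "(\<lambda>n. \<phi> n x * g x) \<longlonglongrightarrow> q x * g x" unfolding \<phi>_def by simp
        qed
        have "norm (\<phi> n x * g x) \<le> C * \<bar>g x\<bar>" if "x \<in> ?B" for n x
        proof -
          have "\<bar>\<phi> n x\<bar> \<le> C * 1"
            unfolding \<phi>_def ball_bump_def abs_mult using C[of x] that flat_nonneg flat_0_le_1
            by (intro mult_mono) auto
          then show ?thesis by (simp add: abs_mult mult_right_mono)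
        qed
        then show "AE x in lebesgue_on ?B. norm (\<phi> n x * g x) \<le> C * \<bar>g x\<bar>" for n
          by (intro AE_I2) (simp only: space_lebesgue_on)
      qed (use qm gB in \<open>auto intro!: borel_measurable_times\<close>)
      with z show ?thesis by (simp add: LIMSEQ_const_iff)
    qed
    have sg: "(\<lambda>x. sgn (g x)) \<in> borel_measurable (lebesgue_on ?B)"
      using gB by auto
    obtain q :: "nat \<Rightarrow> 'a \<Rightarrow> real" where q: "\<And>n. polynomial_function (q n)"
      "\<And>n x. x \<in> ?B \<Longrightarrow> norm (q n x) \<le> 1 + 1"
      "AE x in lebesgue_on ?B. (\<lambda>n. q n x) \<longlonglongrightarrow> sgn (g x)"
      by (rule bounded_measurable_polynomial_approximation[OF _ _ sg, of 1])
        (auto simp: norm_sgn)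
    have "(\<lambda>n. LINT x|lebesgue_on ?B. q n x * g x) \<longlonglongrightarrow> (LINT x|lebesgue_on ?B. \<bar>g x\<bar>)"
    proof (rule integral_dominated_convergence[where w = "\<lambda>x. 2 * \<bar>g x\<bar>"])
      show "AE x in lebesgue_on ?B. (\<lambda>n. q n x * g x) \<longlonglongrightarrow> \<bar>g x\<bar>"
        using q(3)
      proof eventually_elim
        case (elim x)
        then have "(\<lambda>n. q n x * g x) \<longlonglongrightarrow> sgn (g x) * g x" by (intro tendsto_intros)
        then show ?case by (simp add: abs_sgn mult.commute)
      qed
      show "AE x in lebesgue_on ?B. norm (q n x * g x) \<le> 2 * \<bar>g x\<bar>" for n
        using q(2) by (intro AE_I2) (auto simp: abs_mult intro!: mult_right_mono)
      show "(\<lambda>x. q n x * g x) \<in> borel_measurable (lebesgue_on ?B)" for n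
        using gB continuous_imp_measurable_lebesgue_on[OF continuous_on_polymonial_function[OF q(1)[of n]]]
        by (intro borel_measurable_times) auto
    qed (use gB in auto)
    moreover have "(LINT x|lebesgue_on ?B. q n x * g x) = 0" for n
      using poly q(1)[of n] unfolding real_polynomial_function_eq[symmetric] by blast
    ultimately have "(LINT x|lebesgue_on ?B. \<bar>g x\<bar>) = 0"
      by (simp add: LIMSEQ_const_iff)
    then show ?thesis
      using integral_nonneg_eq_0_iff_AE[of "lebesgue_on ?B" "\<lambda>x. \<bar>g x\<bar>"] gB by auto
  qed
  \<comment> \<open>Only countably many exceptional null sets may be united, so the Lindelof
    property selects a countable subcover of \<open>S\<close> by such balls.\<close>
  define \<F> where "\<F> = {ball c r | c r. cball c r \<subseteq> S \<and> 0 < r}"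
  have "\<Union>\<F> = S"
  proof
    show "\<Union>\<F> \<subseteq> S"
    proof (rule Union_least)
      fix B assume "B \<in> \<F>"
      then show "B \<subseteq> S" using ball_subset_cball unfolding \<F>_def by blast
    qed
    show "S \<subseteq> \<Union>\<F>"
    proof
      fix x assume "x \<in> S"
      with S obtain r where "0 < r" "cball x r \<subseteq> S" using open_contains_cball by blast
      then show "x \<in> \<Union>\<F>" unfolding \<F>_def by (intro UnionI[of "ball x r"]) auto
    qed
  qed
  moreover obtain \<F>' where "\<F>' \<subseteq> \<F>" "countable \<F>'" "\<Union>\<F>' = \<Union>\<F>"
    by (rule Lindelof[of \<F>]) (auto simp: \<F>_def)
  ultimately have cover: "\<F>' \<subseteq> \<F>" "countable \<F>'" "\<Union>\<F>' = S" by auto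
  have "AE x in lebesgue. x \<in> B \<longrightarrow> g x = 0" if "B \<in> \<F>'" for B
  proof -
    from that cover(1) obtain c r where "B = ball c r" "cball c r \<subseteq> S" "0 < r"
      unfolding \<F>_def by blast
    with local[of c r] show ?thesis by (simp add: AE_lebesgue_on_iff)
  qed
  then have "AE x in lebesgue. \<forall>B\<in>\<F>'. x \<in> B \<longrightarrow> g x = 0"
    by (subst AE_ball_countable[OF cover(2)]) simp
  then have "AE x in lebesgue. x \<in> S \<longrightarrow> g x = 0"
  proof eventually_elim
    case (elim x)
    then show ?case using cover(3) by (metis UnionE)
  qed
  then show ?thesis using S by (simp add: AE_lebesgue_on_iff)
qed

section \<open>Square integrable functions and integration by parts\<close>

text \<open>Integrability follows from the arithmetic-geometric mean inequality; the bound is the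
  discriminant condition for the quadratic polynomial in \<open>t\<close> obtained by integrating
  the square of \<open>t * norm (f x) + norm (g x)\<close>.\<close>

lemma integrable_Cauchy_Schwarz:
  fixes f :: "'a \<Rightarrow> 'b::euclidean_space" and g :: "'a \<Rightarrow> 'c::euclidean_space"
  assumes [measurable]: "f \<in> borel_measurable M" "g \<in> borel_measurable M"
    and f: "integrable M (\<lambda>x. (norm (f x))^2)" and g: "integrable M (\<lambda>x. (norm (g x))^2)"
  shows "integrable M (\<lambda>x. norm (f x) * norm (g x))"
    and "(LINT x|M. norm (f x) * norm (g x))
      \<le> sqrt (LINT x|M. (norm (f x))^2) * sqrt (LINT x|M. (norm (g x))^2)" (is ?P)
proof -
  show fg: "integrable M (\<lambda>x. norm (f x) * norm (g x))"
  proof (rule Bochner_Integration.integrable_bound[where f = "\<lambda>x. (norm (f x))^2 + (norm (g x))^2"])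
    have "norm (norm (f x) * norm (g x)) \<le> norm ((norm (f x))^2 + (norm (g x))^2)" for x
    proof -
      have "2 * (norm (f x) * norm (g x)) \<le> (norm (f x))^2 + (norm (g x))^2"
        using sum_squares_bound[of "norm (f x)" "norm (g x)"] by simp
      moreover have "0 \<le> norm (f x) * norm (g x)" by simp
      ultimately show ?thesis unfolding real_norm_def by linarith
    qed
    then show "AE x in M. norm (norm (f x) * norm (g x)) \<le> norm ((norm (f x))^2 + (norm (g x))^2)"
      by (rule AE_I2)
  qed (use f g in simp_all)
  define A B I where "A = (LINT x|M. (norm (f x))^2)" and "B = (LINT x|M. (norm (g x))^2)"
    and "I = (LINT x|M. norm (f x) * norm (g x))"
  have nn: "0 \<le> A" "0 \<le> B" "0 \<le> I" by (auto simp: A_def B_def I_def)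
  have quad: "0 \<le> t^2 * A + 2 * t * I + B" for t
  proof -
    have "0 \<le> (LINT x|M. (t * norm (f x) + norm (g x))^2)" by simp
    also have "\<dots> = (LINT x|M. t^2 * (norm (f x))^2 + 2 * t * (norm (f x) * norm (g x)) + (norm (g x))^2)"
      by (intro Bochner_Integration.integral_cong) (auto simp: power2_eq_square algebra_simps)
    also have "\<dots> = t^2 * A + 2 * t * I + B"
      using f g fg by (simp add: A_def B_def I_def)
    finally show ?thesis .
  qed
  have "I^2 \<le> A * B"
  proof (cases "A = 0")
    case True
    have "I = 0"
    proof (rule ccontr)
      assume "I \<noteq> 0"
      \<comment> \<open>For \<open>A = 0\<close> the polynomial is affine; at this \<open>t\<close>
        it has the value -1.\<close>
      with quad[of "- (B + 1) / (2 * I)"] True show False by (simp add: field_simps)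
    qed
    with True show ?thesis by simp
  next
    case False
    with nn have "0 < A" by simp
    \<comment> \<open>The minimizer of the quadratic polynomial.\<close>
    with quad[of "- I / A"] show ?thesis by (simp add: field_simps power2_eq_square)
  qed
  then have "I \<le> sqrt (A * B)" using nn by (simp add: real_le_rsqrt)
  then show ?P
    by (simp add: A_def B_def I_def real_sqrt_mult)
qed

lemma L2_norm_nonneg: "0 \<le> L2_norm S f"
  by (simp add: L2_norm_def)

lemma L2_norm_power2: "(L2_norm S f)^2 = (LINT x|lebesgue_on S. (norm (f x))^2)"
  by (simp add: L2_norm_def)

lemma L2_measurable: "f \<in> L2 S \<Longrightarrow> f \<in> borel_measurable (lebesgue_on S)"
  by (simp add: L2_def)

text \<open>Domination almost everywhere by a product of norms is the form in which all later
  integrands are controlled, whatever their algebraic shape.\<close>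

lemma L2_product:
  fixes f :: "'a::euclidean_space \<Rightarrow> 'b::euclidean_space" and g :: "'a \<Rightarrow> 'c::euclidean_space"
    and h :: "'a \<Rightarrow> real"
  assumes f: "f \<in> L2 S" and g: "g \<in> L2 S" and h: "h \<in> borel_measurable (lebesgue_on S)"
    and le: "AE x in lebesgue_on S. \<bar>h x\<bar> \<le> K * (norm (f x) * norm (g x))"
  shows "integrable (lebesgue_on S) h"
    and "\<bar>LINT x|lebesgue_on S. h x\<bar> \<le> \<bar>K\<bar> * (L2_norm S f * L2_norm S g)"
proof -
  let ?M = "lebesgue_on S"
  note cs = integrable_Cauchy_Schwarz[of f ?M g]
  have fg: "integrable ?M (\<lambda>x. norm (f x) * norm (g x))"
    using f g by (intro cs) (auto simp: L2_def)
  have le': "AE x in ?M. \<bar>h x\<bar> \<le> \<bar>K\<bar> * (norm (f x) * norm (g x))"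
    using le by eventually_elim (meson abs_ge_self mult_nonneg_nonneg mult_right_mono norm_ge_zero order_trans)
  show hi: "integrable ?M h"
  proof (rule Bochner_Integration.integrable_bound[where f = "\<lambda>x. \<bar>K\<bar> * (norm (f x) * norm (g x))"])
    show "AE x in ?M. norm (h x) \<le> norm (\<bar>K\<bar> * (norm (f x) * norm (g x)))"
      using le' by eventually_elim (simp add: abs_mult)
  qed (use fg h in auto)
  have "\<bar>LINT x|?M. h x\<bar> \<le> (LINT x|?M. \<bar>h x\<bar>)"
    using integral_norm_bound[of ?M h] by simp
  also have "\<dots> \<le> (LINT x|?M. \<bar>K\<bar> * (norm (f x) * norm (g x)))"
    using hi fg le' by (intro integral_mono_AE) auto
  also have "\<dots> \<le> \<bar>K\<bar> * (L2_norm S f * L2_norm S g)"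
    unfolding L2_norm_def Bochner_Integration.integral_mult_right_zero
    using f g by (intro mult_left_mono cs(2)) (auto simp: L2_def)
  finally show "\<bar>LINT x|?M. h x\<bar> \<le> \<bar>K\<bar> * (L2_norm S f * L2_norm S g)" .
qed

lemma L2_product_field:
  fixes G g :: "'a::euclidean_space \<Rightarrow> 'b::euclidean_space"
  assumes G: "G \<in> borel_measurable (lebesgue_on S)" "AE x in lebesgue_on S. norm (G x) \<le> M"
    and f: "f \<in> L2 S" and g: "g \<in> L2 S"
  shows "integrable (lebesgue_on S) (\<lambda>x. f x * (G x \<bullet> g x))" (is ?A)
    and "\<bar>LINT x|lebesgue_on S. f x * (G x \<bullet> g x)\<bar> \<le> \<bar>M\<bar> * (L2_norm S f * L2_norm S g)" (is ?B)
proof -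
  have m: "(\<lambda>x. f x * (G x \<bullet> g x)) \<in> borel_measurable (lebesgue_on S)"
    by (intro borel_measurable_times borel_measurable_inner L2_measurable f g G(1))
  have le: "AE x in lebesgue_on S. \<bar>f x * (G x \<bullet> g x)\<bar> \<le> M * (norm (f x) * norm (g x))"
    using G(2)
  proof eventually_elim
    case (elim x)
    have "\<bar>G x \<bullet> g x\<bar> \<le> M * norm (g x)"
      using Cauchy_Schwarz_ineq2[of "G x" "g x"] elim by (meson mult_right_mono norm_ge_zero order_trans)
    then have "\<bar>f x\<bar> * \<bar>G x \<bullet> g x\<bar>
      \<le> \<bar>f x\<bar> * (M * norm (g x))" by (intro mult_left_mono) auto
    then show ?case by (simp add: abs_mult ac_simps)
  qed
  show ?A
    ?B
    using L2_product[OF f g m le] by auto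
qed

lemma L2_bound:
  fixes f :: "'a::euclidean_space \<Rightarrow> 'b::euclidean_space" and g :: "'a \<Rightarrow> 'c::euclidean_space"
  assumes f: "f \<in> L2 S" and g: "g \<in> borel_measurable (lebesgue_on S)"
    and le: "AE x in lebesgue_on S. norm (g x) \<le> K * norm (f x)" and K: "0 \<le> K"
  shows "g \<in> L2 S" and "L2_norm S g \<le> K * L2_norm S f"
proof -
  have fi: "integrable (lebesgue_on S) (\<lambda>x. K^2 * (norm (f x))^2)"
    using f by (simp add: L2_def)
  have le': "AE x in lebesgue_on S. (norm (g x))^2 \<le> K^2 * (norm (f x))^2"
    using le by eventually_elim (metis norm_ge_zero power_mono power_mult_distrib)
  have gi: "integrable (lebesgue_on S) (\<lambda>x. (norm (g x))^2)"
  proof (rule Bochner_Integration.integrable_bound[OF fi])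
    show "AE x in lebesgue_on S. norm ((norm (g x))^2) \<le> norm (K^2 * (norm (f x))^2)"
      using le' by eventually_elim (simp add: abs_mult)
  qed (use g in measurable)
  with g show "g \<in> L2 S" by (simp add: L2_def)
  have "(L2_norm S g)^2 \<le> (LINT x|lebesgue_on S. K^2 * (norm (f x))^2)"
    unfolding L2_norm_power2 using gi fi le' by (intro integral_mono_AE)
  also have "\<dots> = (K * L2_norm S f)^2"
    by (simp add: power_mult_distrib L2_norm_power2)
  finally show "L2_norm S g \<le> K * L2_norm S f"
    by (rule power2_le_imp_le) (simp add: K L2_norm_nonneg)
qed

lemma L2_cong_AE:
  fixes f g :: "'a::euclidean_space \<Rightarrow> 'b::euclidean_space"
  assumes S: "S \<in> sets lebesgue" and f: "f \<in> L2 S" and eq: "AE x in lebesgue_on S. f x = g x"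
  shows "g \<in> L2 S" and "L2_norm S g = L2_norm S f"
proof -
  have gm: "g \<in> borel_measurable (lebesgue_on S)"
    using borel_measurable_lebesgue_on_cong_AE[OF S L2_measurable[OF f] eq] .
  have 1: "AE x in lebesgue_on S. norm (g x) \<le> 1 * norm (f x)"
    and 2: "AE x in lebesgue_on S. norm (f x) \<le> 1 * norm (g x)"
    using eq by (eventually_elim, simp)+
  show g: "g \<in> L2 S" by (rule L2_bound(1)[OF f gm 1]) simp
  show "L2_norm S g = L2_norm S f"
    using L2_bound(2)[OF f gm 1] L2_bound(2)[OF g L2_measurable[OF f] 2] by simp
qed

lemma L2_add:
  fixes f g :: "'a::euclidean_space \<Rightarrow> 'b::euclidean_space"
  assumes f: "f \<in> L2 S" and g: "g \<in> L2 S"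
  shows "(\<lambda>x. f x + g x) \<in> L2 S" and "L2_norm S (\<lambda>x. f x + g x) \<le> L2_norm S f + L2_norm S g" (is ?P)
proof -
  let ?M = "lebesgue_on S"
  have fg: "integrable ?M (\<lambda>x. norm (f x) * norm (g x))"
    and cs: "(LINT x|?M. norm (f x) * norm (g x)) \<le> L2_norm S f * L2_norm S g"
    unfolding L2_norm_def using f g by (intro integrable_Cauchy_Schwarz; simp add: L2_def)+
  have fi: "integrable ?M (\<lambda>x. (norm (f x))^2 + 2 * (norm (f x) * norm (g x)) + (norm (g x))^2)"
    using f g fg by (simp add: L2_def)
  have le: "(norm (f x + g x))^2 \<le> (norm (f x))^2 + 2 * (norm (f x) * norm (g x)) + (norm (g x))^2" for x
  proof -
    have "(norm (f x + g x))^2 \<le> (norm (f x) + norm (g x))^2"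
      by (intro power_mono norm_triangle_ineq) simp
    then show ?thesis by (simp add: power2_sum)
  qed
  have [measurable]: "f \<in> borel_measurable ?M" "g \<in> borel_measurable ?M"
    using f g by (auto simp: L2_def)
  have fgi: "integrable ?M (\<lambda>x. (norm (f x + g x))^2)"
  proof (rule Bochner_Integration.integrable_bound[OF fi])
    show "AE x in ?M. norm ((norm (f x + g x))^2)
        \<le> norm ((norm (f x))^2 + 2 * (norm (f x) * norm (g x)) + (norm (g x))^2)"
      using le by (intro AE_I2) simp
  qed measurable
  then show "(\<lambda>x. f x + g x) \<in> L2 S" by (simp add: L2_def)
  have "(L2_norm S (\<lambda>x. f x + g x))^2
      \<le> (LINT x|?M. (norm (f x))^2 + 2 * (norm (f x) * norm (g x)) + (norm (g x))^2)"
    unfolding L2_norm_power2 using fgi fi le by (intro integral_mono)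
  also have "\<dots> = (L2_norm S f)^2 + 2 * (LINT x|?M. norm (f x) * norm (g x)) + (L2_norm S g)^2"
    unfolding L2_norm_power2 using f g fg by (simp add: L2_def)
  also have "\<dots> \<le> (L2_norm S f + L2_norm S g)^2"
    using cs by (simp add: power2_sum)
  finally show ?P
    by (rule power2_le_imp_le) (simp add: L2_norm_nonneg)
qed

lemma L2_scaleR:
  fixes f :: "'a::euclidean_space \<Rightarrow> 'b::euclidean_space"
  assumes f: "f \<in> L2 S"
  shows "(\<lambda>x. a *\<^sub>R f x) \<in> L2 S" and "L2_norm S (\<lambda>x. a *\<^sub>R f x) = \<bar>a\<bar> * L2_norm S f"
  using f by (auto simp: L2_def L2_norm_def power_mult_distrib real_sqrt_mult)

lemma L2_norm_eq_0:
  assumes f: "f \<in> L2 S" and "L2_norm S f = 0"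
  shows "AE x in lebesgue_on S. f x = 0"
proof -
  have "(LINT x|lebesgue_on S. (norm (f x))^2) = 0"
    using assms by (simp add: L2_norm_def)
  then have "AE x in lebesgue_on S. (norm (f x))^2 = 0"
    using f by (subst (asm) integral_nonneg_eq_0_iff_AE) (auto simp: L2_def)
  then show ?thesis by eventually_elim simp
qed

section \<open>Continuously differentiable functions and integration by parts\<close>

abbreviation grad :: "('a::euclidean_space \<Rightarrow> real) \<Rightarrow> 'a \<Rightarrow> 'a" where
  "grad \<equiv> classical_grad"

text \<open>One notion that covers test functions, polynomials and their products: C1 on the whole
  space, with the derivative represented by a vector field and no condition on the support.\<close>

definition has_grad :: "('a::euclidean_space \<Rightarrow> real) \<Rightarrow> ('a \<Rightarrow> 'a) \<Rightarrow> bool" where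
  "has_grad f g \<longleftrightarrow> continuous_on UNIV g \<and> (\<forall>x. (f has_derivative (\<lambda>h. g x
    \<bullet> h)) (at x))"

lemma has_grad_continuous: "has_grad f g \<Longrightarrow> continuous_on A f" "has_grad f g \<Longrightarrow> continuous_on A g"
  unfolding has_grad_def
  by (meson continuous_at_imp_continuous_on has_derivative_continuous,
      meson continuous_on_subset subset_UNIV)

lemma has_grad_mult:
  assumes "has_grad f f'" "has_grad g g'"
  shows "has_grad (\<lambda>x. f x * g x) (\<lambda>x. f x *\<^sub>R g' x + g x *\<^sub>R f' x)"
  unfolding has_grad_def
proof (intro conjI allI)
  show "continuous_on UNIV (\<lambda>x. f x *\<^sub>R g' x + g x *\<^sub>R f' x)"
    using assms by (intro continuous_intros has_grad_continuous)
  fix x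
  have "((\<lambda>x. f x * g x) has_derivative (\<lambda>h. f x * (g' x \<bullet> h) + (f' x \<bullet> h) * g x)) (at x)"
    using assms by (intro has_derivative_mult) (auto simp: has_grad_def)
  then show "((\<lambda>x. f x * g x) has_derivative (\<lambda>h. (f x *\<^sub>R g' x + g x *\<^sub>R f' x) \<bullet> h)) (at x)"
    by (simp add: inner_add_left mult.commute)
qed

lemma has_grad_eq_0:
  assumes "has_grad f g" "closed K" "\<And>x. x \<notin> K \<Longrightarrow> f x = 0" "x \<notin> K"
  shows "g x = 0"
proof -
  have "((\<lambda>x. 0) has_derivative (\<lambda>h. g x \<bullet> h)) (at x)"
    by (rule has_derivative_transform_within_open[of f _ _ UNIV "- K"])
      (use assms in \<open>auto simp: has_grad_def\<close>)
  then have "(\<lambda>h. g x \<bullet> h) = (\<lambda>h. 0)"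
    using has_derivative_unique has_derivative_const by blast
  then have "g x \<bullet> g x = 0" by metis
  then show ?thesis by simp
qed

lemma has_grad_classical_grad:
  assumes "\<And>x. \<phi> differentiable (at x)"
    and "\<And>i. i \<in> Basis \<Longrightarrow> continuous_on UNIV (\<lambda>x. frechet_derivative \<phi> (at x) i)"
  shows "has_grad \<phi> (grad \<phi>)"
  unfolding has_grad_def
proof (intro conjI allI)
  show "continuous_on UNIV (grad \<phi>)"
    unfolding classical_grad_def by (intro continuous_intros assms)
  fix x
  have d: "(\<phi> has_derivative frechet_derivative \<phi> (at x)) (at x)"
    using assms by (simp add: frechet_derivative_works[symmetric])
  then have l: "linear (frechet_derivative \<phi> (at x))"
    by (rule has_derivative_linear)
  have "frechet_derivative \<phi> (at x) h = grad \<phi> x \<bullet> h" for h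
  proof -
    have "frechet_derivative \<phi> (at x) h = frechet_derivative \<phi> (at x) (\<Sum>i\<in>Basis. (h \<bullet> i) *\<^sub>R i)"
      by (simp add: euclidean_representation)
    also have "\<dots> = (\<Sum>i\<in>Basis. (h \<bullet> i) * frechet_derivative \<phi> (at x) i)"
      using l by (simp add: linear_sum linear_scale)
    also have "\<dots> = grad \<phi> x \<bullet> h"
      unfolding classical_grad_def
      unfolding inner_sum_left
      by (intro sum.cong refl) (simp add: inner_commute[of h] mult.commute)
    finally show ?thesis .
  qed
  with d show "(\<phi> has_derivative (\<lambda>h. grad \<phi> x \<bullet> h)) (at x)"
    by (metis (no_types, lifting) ext)
qed

lemma test_function_has_grad: "test_function S \<phi> \<Longrightarrow> has_grad \<phi> (grad \<phi>)"
  unfolding test_function_def by (intro has_grad_classical_grad) (auto dest: spec[of _ "Suc 0"])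

definition supp :: "('a::euclidean_space \<Rightarrow> real) \<Rightarrow> 'a set" where
  "supp \<phi> = closure {x. \<phi> x \<noteq> 0}"

lemma test_function_supp:
  assumes "test_function S \<phi>"
  shows "compact (supp \<phi>)" "supp \<phi> \<subseteq> S" "x \<notin> supp \<phi> \<Longrightarrow> \<phi> x
    = 0" "x \<notin> supp \<phi> \<Longrightarrow> grad \<phi> x = 0"
proof -
  have z: "\<phi> x = 0" if "x \<notin> supp \<phi>" for x
    using that closure_subset[of "{x. \<phi> x \<noteq> 0}"] by (auto simp: supp_def)
  show "grad \<phi> x = 0" if "x \<notin> supp \<phi>"
    by (rule has_grad_eq_0[OF test_function_has_grad[OF assms] _ z that]) (simp add: supp_def)
  show "x \<notin> supp \<phi> \<Longrightarrow> \<phi> x = 0" by (rule z)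
qed (use assms in \<open>auto simp: test_function_def supp_def\<close>)

lemma polynomial_has_grad:
  assumes "real_polynomial_function p" shows "has_grad p (grad p)"
  using real_polynomial_function_partial[OF assms]
  by (intro has_grad_classical_grad) (auto intro: continuous_on_real_polynomial)

lemma integrable_compact_support:
  fixes f :: "'a::euclidean_space \<Rightarrow> 'b::euclidean_space"
  assumes "continuous_on UNIV f" "compact K" "\<And>x. x \<notin> K \<Longrightarrow> f x = 0"
  shows "integrable lborel f"
proof -
  have "integrable lborel (\<lambda>x. indicator K x *\<^sub>R f x)"
    using assms by (intro borel_integrable_compact) (auto intro: continuous_on_subset)
  moreover have "(\<lambda>x. indicator K x *\<^sub>R f x) = f"
    using assms by (auto simp: indicator_def fun_eq_iff)
  ultimately show ?thesis by simp
qed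

lemma has_grad_line:
  assumes "has_grad f g"
  shows "((\<lambda>t. f (x + t *\<^sub>R y)) has_real_derivative g (x + t *\<^sub>R y) \<bullet> y) (at t)"
proof -
  have "((\<lambda>t. x + t *\<^sub>R y) has_derivative (\<lambda>h. h *\<^sub>R y)) (at t)"
    by (auto intro!: derivative_eq_intros)
  moreover have "(f has_derivative (\<lambda>h. g (x + t *\<^sub>R y) \<bullet> h)) (at (x + t *\<^sub>R y))"
    using assms by (simp add: has_grad_def)
  ultimately have "((\<lambda>t. f (x + t *\<^sub>R y)) has_derivative (\<lambda>h. g (x
    + t *\<^sub>R y) \<bullet> (h *\<^sub>R y))) (at t)"
    by (rule has_derivative_compose)
  moreover have "(\<lambda>h. g (x + t *\<^sub>R y) \<bullet> (h *\<^sub>R y)) = (*) (g (x + t *\<^sub>R y) \<bullet> y)"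
    by (auto simp: mult.commute)
  ultimately show ?thesis by (simp add: has_field_derivative_def)
qed

lemma lborel_translate:
  fixes f :: "'a::euclidean_space \<Rightarrow> real"
  assumes "integrable lborel f"
  shows "integrable lborel (\<lambda>x. f (c + x))" and "(LBINT x. f (c + x)) = (LBINT x. f x)"
proof -
  have m: "f \<in> borel_measurable borel" using assms by auto
  have "integrable (distr lborel borel ((+) c)) f" using assms by (simp add: lborel_distr_plus)
  then show "integrable lborel (\<lambda>x. f (c + x))" using m by (subst (asm) integrable_distr_eq) auto
  show "(LBINT x. f (c + x)) = (LBINT x. f x)"
    using integral_distr[of "(+) c" lborel borel f] m by (simp add: lborel_distr_plus)
qed

lemma compact_continuous_bound:
  fixes f :: "'a::euclidean_space \<Rightarrow> 'b::real_normed_vector"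
  assumes "continuous_on UNIV f" "compact K"
  obtains C where "0 \<le> C" "\<And>x. x \<in> K \<Longrightarrow> norm (f x) \<le> C"
proof -
  have "compact (f ` K)"
    using assms by (meson compact_continuous_image continuous_on_subset subset_UNIV)
  then obtain C where "\<forall>y\<in>f ` K. norm y \<le> C"
    using compact_imp_bounded bounded_iff by metis
  then show thesis by (intro that[of "max C 0"]) (auto simp: le_max_iff_disj)
qed

text \<open>By translation invariance every difference quotient of \<open>f\<close> in a coordinate
  direction has integral 0; dominated convergence carries this over to the partial
  derivative.\<close>

lemma integral_has_grad_eq_0:
  fixes f :: "'a::euclidean_space \<Rightarrow> real"
  assumes fg: "has_grad f g" and K: "compact K" "\<And>x. x \<notin> K \<Longrightarrow> f x = 0"
  shows "(LBINT x. g x) = 0"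
proof -
  have g0: "g x = 0" if "x \<notin> K" for x
    using has_grad_eq_0[OF fg compact_imp_closed K(2) that] K(1) by auto
  have gi: "integrable lborel g"
    using has_grad_continuous(2)[OF fg] K g0 by (intro integrable_compact_support[of g K])
  have fi: "integrable lborel f"
    using has_grad_continuous(1)[OF fg] K by (intro integrable_compact_support[of f K])
  have [measurable]: "f \<in> borel_measurable borel" "g \<in> borel_measurable borel"
    using has_grad_continuous[OF fg] by (auto intro: borel_measurable_continuous_onI)
  obtain C where C: "0 \<le> C" "\<And>x. norm (g x) \<le> C"
  proof -
    obtain C where "0 \<le> C" "\<And>x. x \<in> K \<Longrightarrow> norm (g x) \<le> C"
      using compact_continuous_bound[OF has_grad_continuous(2)[OF fg] K(1)] by metis
    then show thesis using g0 by (intro that[of C]) (metis norm_zero)+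
  qed
  obtain R where R: "\<And>x. x \<in> K \<Longrightarrow> norm x \<le> R"
    using compact_imp_bounded[OF K(1)] bounded_iff by metis
  show ?thesis
  proof (rule euclidean_eqI)
    fix i :: 'a assume i: "i \<in> Basis"
    define s where "s n x = (f (x + inverse (real (Suc n)) *\<^sub>R i) - f x) / inverse (real (Suc n))" for n x
    have gC: "\<bar>g x \<bullet> i\<bar> \<le> C" for x
      using C(2)[of x] Basis_le_norm[OF i, of "g x"] by linarith
    have "(\<lambda>n. LBINT x. s n x) \<longlonglongrightarrow> (LBINT x. g x \<bullet> i)"
    \<comment> \<open>The increments have length at most 1, so outside radius \<open>R + 1\<close>
      both points of a quotient lie off the support.\<close>
    proof (rule integral_dominated_convergence[where w = "\<lambda>x. C * indicator (cball 0 (R + 1)) x"])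
      show "integrable lborel (\<lambda>x. C * indicator (cball (0::'a) (R + 1)) x)"
        using integrable_real_indicator[of "cball (0::'a) (R + 1)" lborel]
          emeasure_lborel_cball_finite[of 0 "R + 1"] by auto
      have "(\<lambda>n. s n x) \<longlonglongrightarrow> g x \<bullet> i" for x
      proof -
        have "((\<lambda>h. (f (x + (0 + h) *\<^sub>R i) - f (x + 0 *\<^sub>R i)) / h) \<longlongrightarrow> g (x
          + 0 *\<^sub>R i) \<bullet> i) (at 0)"
          using has_grad_line[OF fg, of x i 0] unfolding DERIV_def .
        moreover have "filterlim (\<lambda>n. inverse (real (Suc n))) (at 0) sequentially"
          using LIMSEQ_inverse_real_of_nat by (auto simp: filterlim_at)
        ultimately show ?thesis
          unfolding s_def using filterlim_compose by fastforce
      qed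
      then show "AE x in lborel. (\<lambda>n. s n x) \<longlonglongrightarrow> g x \<bullet> i" by simp
      have "\<bar>s n x\<bar> \<le> C * indicator (cball 0 (R + 1)) x" for n x
      proof (cases "x \<in> cball 0 (R + 1)")
        case True
        let ?d = "inverse (real (Suc n))"
        obtain z where "f (x + ?d *\<^sub>R i) - f (x + 0 *\<^sub>R i) = (?d - 0) * (g (x + z *\<^sub>R i) \<bullet> i)"
          using MVT2[of 0 ?d "\<lambda>t. f (x + t *\<^sub>R i)" "\<lambda>t. g (x
            + t *\<^sub>R i) \<bullet> i"] has_grad_line[OF fg] by auto
        then have "s n x = g (x + z *\<^sub>R i) \<bullet> i" by (simp add: s_def)
        with gC True show ?thesis by simp
      next
        case False
        then have "R + 1 < norm x" by simp
        moreover have "norm x \<le> norm (x + inverse (real (Suc n)) *\<^sub>R i) + norm (inverse (real (Suc n)) *\<^sub>R i)"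
          using norm_triangle_ineq4[of "x + inverse (real (Suc n)) *\<^sub>R i" "inverse (real (Suc n)) *\<^sub>R i"]
          by (simp only: add_diff_cancel_right')
        moreover have "norm (inverse (real (Suc n)) *\<^sub>R i) \<le> 1"
          using i by (simp add: inverse_eq_divide)
        ultimately have "x \<notin> K" "x + inverse (real (Suc n)) *\<^sub>R i \<notin> K"
          using R[of x] R[of "x + inverse (real (Suc n)) *\<^sub>R i"] by linarith+
        with K(2) C(1) show ?thesis by (simp add: s_def)
      qed
      then show "AE x in lborel. norm (s n x) \<le> C * indicator (cball 0 (R + 1)) x" for n by simp
    qed (auto simp: s_def)
    moreover have "(LBINT x. s n x) = 0" for n
      unfolding s_def using fi lborel_translate[OF fi, of "inverse (real (Suc n)) *\<^sub>R i"]
      by (simp add: add.commute)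
    ultimately have "(LBINT x. g x \<bullet> i) = 0" by (simp add: LIMSEQ_const_iff)
    then show "(LBINT x. g x) \<bullet> i = 0 \<bullet> i" using gi by simp
  qed
qed

text \<open>The gradient of the product integrates to 0. Compact support of one factor is enough, so
  \<open>f\<close> may be a product with a polynomial.\<close>

lemma integral_by_parts_has_grad:
  assumes f: "has_grad f f'" and g: "has_grad g g'" and K: "compact K" "\<And>x. x \<notin> K \<Longrightarrow> g x = 0"
  shows "(LBINT x. f x *\<^sub>R g' x) = - (LBINT x. g x *\<^sub>R f' x)"
proof -
  have g0: "g' x = 0" if "x \<notin> K" for x
    using has_grad_eq_0[OF g compact_imp_closed K(2) that] K(1) by auto
  have i: "integrable lborel (\<lambda>x. f x *\<^sub>R g' x)" "integrable lborel (\<lambda>x. g x *\<^sub>R f' x)"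
    using has_grad_continuous[OF f] has_grad_continuous[OF g] K g0
    by (auto intro!: integrable_compact_support[where K = K] continuous_intros)
  have "(LBINT x. f x *\<^sub>R g' x + g x *\<^sub>R f' x) = 0"
    using K by (intro integral_has_grad_eq_0[OF has_grad_mult[OF f g], of K]) auto
  then show ?thesis using i by (simp add: eq_neg_iff_add_eq_0)
qed

section \<open>Weak gradients and Sobolev spaces\<close>

text \<open>The passage to the Borel-Lebesgue measure on the whole space, where translation
  invariance and integration by parts are available.\<close>

lemma integral_lebesgue_on_compact_support:
  fixes f :: "'a::euclidean_space \<Rightarrow> 'b::euclidean_space"
  assumes S: "S \<in> sets lebesgue" and f: "continuous_on UNIV f"
    and K: "compact K" "K \<subseteq> S" "\<And>x. x \<notin> K \<Longrightarrow> f x = 0"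
  shows "(LINT x|lebesgue_on S. f x) = (LBINT x. f x)" and "integrable (lebesgue_on S) f"
proof -
  have m: "f \<in> borel_measurable lborel" using f by (simp add: borel_measurable_continuous_onI)
  have z: "\<And>x. x \<in> UNIV - S \<Longrightarrow> f x = 0" using K by auto
  note sup = integral_lebesgue_on_superset[OF subset_UNIV _ S z]
  show "(LINT x|lebesgue_on S. f x) = (LBINT x. f x)"
    using sup(1) integral_completion[OF m] by (simp add: lebesgue_on_UNIV_eq)
  have "integrable lebesgue f"
    using integrable_completion[OF m] integrable_compact_support[OF f K(1,3)] by simp
  then show "integrable (lebesgue_on S) f"
    using sup(2) by (simp add: lebesgue_on_UNIV_eq)
qed

lemma locally_integrable_measurable:
  "locally_integrable S g \<Longrightarrow> compact K \<Longrightarrow> K \<subseteq> S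
    \<Longrightarrow> g \<in> borel_measurable (lebesgue_on K)"
  unfolding locally_integrable_def by (simp add: borel_measurable_integrable)

lemma integrable_locally_integrable_bound:
  fixes g :: "'a::euclidean_space \<Rightarrow> 'b::euclidean_space" and h :: "'a \<Rightarrow> 'c::euclidean_space"
  assumes S: "S \<in> sets lebesgue" and g: "locally_integrable S g"
    and K: "compact K" "K \<subseteq> S" "\<And>x. x \<notin> K \<Longrightarrow> h x = 0"
    and h: "h \<in> borel_measurable (lebesgue_on K)" "\<And>x. x \<in> K \<Longrightarrow> norm (h x) \<le> C * norm (g x)"
  shows "integrable (lebesgue_on S) h"
proof -
  have gi: "integrable (lebesgue_on K) (\<lambda>x. C * norm (g x))"
    using g K(1,2) by (simp add: locally_integrable_def)
  have "integrable (lebesgue_on K) h"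
  proof (rule Bochner_Integration.integrable_bound[OF gi h(1)])
    show "AE x in lebesgue_on K. norm (h x) \<le> norm (C * norm (g x))"
      using h(2) by (intro AE_I2) fastforce
  qed
  moreover have "K \<in> sets lebesgue" using K(1) by (simp add: borel_compact)
  ultimately show ?thesis
    using integral_lebesgue_on_superset(2)[OF K(2) S _, of h] K(3) by blast
qed

lemma integrable_test_function_scaleR:
  fixes g :: "'a::euclidean_space \<Rightarrow> 'b::euclidean_space"
  assumes S: "S \<in> sets lebesgue" and g: "locally_integrable S g" and \<phi>: "test_function S \<phi>"
  shows "integrable (lebesgue_on S) (\<lambda>x. \<phi> x *\<^sub>R g x)"
proof -
  obtain K where K: "compact K" "K \<subseteq> S" "\<And>x. x \<notin> K \<Longrightarrow> \<phi> x = 0"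
    using test_function_supp[OF \<phi>] by metis
  have c: "continuous_on UNIV \<phi>" using test_function_continuous[OF \<phi>] .
  obtain C where "\<And>x. x \<in> K \<Longrightarrow> norm (\<phi> x) \<le> C"
    using compact_continuous_bound[OF c K(1)] by metis
  then have b: "norm (\<phi> x *\<^sub>R g x) \<le> C * norm (g x)" if "x \<in> K" for x
    using that by (simp add: mult_right_mono)
  have m: "(\<lambda>x. \<phi> x *\<^sub>R g x) \<in> borel_measurable (lebesgue_on K)"
    by (intro borel_measurable_scaleR continuous_imp_measurable_lebesgue_on[OF c]
        locally_integrable_measurable[OF g K(1,2)])
  have z: "\<phi> x *\<^sub>R g x = 0" if "x \<notin> K" for x
    using K(3)[OF that] by simp
  show ?thesis
    by (rule integrable_locally_integrable_bound[OF S g K(1,2) z m b])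
qed

lemma integrable_scaleR_classical_grad:
  fixes v :: "'a::euclidean_space \<Rightarrow> real"
  assumes S: "S \<in> sets lebesgue" and v: "locally_integrable S v" and \<phi>: "test_function S \<phi>"
  shows "integrable (lebesgue_on S) (\<lambda>x. v x *\<^sub>R grad \<phi> x)"
proof -
  obtain K where K: "compact K" "K \<subseteq> S" "\<And>x. x \<notin> K \<Longrightarrow> grad \<phi> x = 0"
    using test_function_supp[OF \<phi>] by metis
  have c: "continuous_on UNIV (grad \<phi>)"
    using has_grad_continuous(2)[OF test_function_has_grad[OF \<phi>]] .
  obtain C where "\<And>x. x \<in> K \<Longrightarrow> norm (grad \<phi> x) \<le> C"
    using compact_continuous_bound[OF c K(1)] by metis
  then have b: "norm (v x *\<^sub>R grad \<phi> x) \<le> C * norm (v x)" if "x \<in> K" for x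
    using that by (simp add: mult.commute[of C] mult_left_mono)
  have m: "(\<lambda>x. v x *\<^sub>R grad \<phi> x) \<in> borel_measurable (lebesgue_on K)"
    by (intro borel_measurable_scaleR continuous_imp_measurable_lebesgue_on[OF c]
        locally_integrable_measurable[OF v K(1,2)])
  have z: "v x *\<^sub>R grad \<phi> x = 0" if "x \<notin> K" for x
    using K(3)[OF that] by simp
  show ?thesis
    by (rule integrable_locally_integrable_bound[OF S v K(1,2) z m b])
qed

lemma locally_integrable_add:
  "locally_integrable S f \<Longrightarrow> locally_integrable S g \<Longrightarrow> locally_integrable S (\<lambda>x. f x + g x)"
  by (simp add: locally_integrable_def)

lemma locally_integrable_scaleR:
  "locally_integrable S f \<Longrightarrow> locally_integrable S (\<lambda>x. a *\<^sub>R f x)"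
  by (simp add: locally_integrable_def)

text \<open>Each component of \<open>g1 - g2\<close> integrates to 0 against every test function, so
  the scalar fundamental lemma applies to finitely many components.\<close>

lemma has_weak_grad_unique:
  assumes S: "open S" and g1: "has_weak_grad S v g1" and g2: "has_weak_grad S v g2"
  shows "AE x in lebesgue_on S. g1 x = g2 x"
proof -
  have Sl: "S \<in> sets lebesgue" using S by (rule open_imp_lebesgue)
  have l: "locally_integrable S g1" "locally_integrable S g2"
    using g1 g2 by (auto simp: has_weak_grad_def)
  have "AE x in lebesgue_on S. (g1 x - g2 x) \<bullet> i = 0" if "i \<in> Basis" for i
  proof (rule fundamental_lemma_calculus_of_variations[OF S])
    show "locally_integrable S (\<lambda>x. (g1 x - g2 x) \<bullet> i)"
      using l by (simp add: locally_integrable_def)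
    fix \<phi> :: "'a \<Rightarrow> real" assume \<phi>: "test_function S \<phi>"
    have i: "integrable (lebesgue_on S) (\<lambda>x. \<phi> x *\<^sub>R g1 x)" "integrable (lebesgue_on S)
      (\<lambda>x. \<phi> x *\<^sub>R g2 x)"
      using integrable_test_function_scaleR[OF Sl _ \<phi>] l by auto
    have "(LINT x|lebesgue_on S. v x *\<^sub>R grad \<phi> x) = - (LINT x|lebesgue_on S. \<phi> x *\<^sub>R g1 x)"
      "(LINT x|lebesgue_on S. v x *\<^sub>R grad \<phi> x) = - (LINT x|lebesgue_on S. \<phi> x *\<^sub>R g2 x)"
      using g1 g2 \<phi> by (simp_all add: has_weak_grad_def)
    then have "(LINT x|lebesgue_on S. \<phi> x *\<^sub>R g1 x) = (LINT x|lebesgue_on S. \<phi> x *\<^sub>R g2 x)"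
      by simp
    then have "(LINT x|lebesgue_on S. \<phi> x *\<^sub>R g1 x - \<phi> x *\<^sub>R g2 x) = 0"
      using i by simp
    then have "(LINT x|lebesgue_on S. (\<phi> x *\<^sub>R g1 x - \<phi> x *\<^sub>R g2 x) \<bullet> i) = 0"
      using i by (subst integral_inner_left) auto
    then show "(LINT x|lebesgue_on S. \<phi> x * ((g1 x - g2 x) \<bullet> i)) = 0"
      by (simp add: inner_diff_left right_diff_distrib)
  qed
  then have "AE x in lebesgue_on S. \<forall>i\<in>Basis. (g1 x - g2 x) \<bullet> i = 0"
    by (subst AE_ball_countable) (auto simp: countable_finite)
  then show ?thesis
  proof eventually_elim
    case (elim x)
    then have "g1 x - g2 x = 0" using euclidean_all_zero_iff by blast
    then show ?case by simp
  qed
qed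

lemma has_weak_grad_wgrad: "has_weak_grad S v g \<Longrightarrow> has_weak_grad S v (wgrad S v)"
  unfolding wgrad_def by (rule someI[of "has_weak_grad S v"])

lemma wgrad_AE_eq: "open S \<Longrightarrow> has_weak_grad S v g \<Longrightarrow> AE x in lebesgue_on S. wgrad S v x = g x"
  by (rule has_weak_grad_unique[OF _ has_weak_grad_wgrad])

lemma has_weak_grad_add:
  assumes S: "open S" and f: "has_weak_grad S v f" and g: "has_weak_grad S w g"
  shows "has_weak_grad S (\<lambda>x. v x + w x) (\<lambda>x. f x + g x)"
  unfolding has_weak_grad_def
proof (intro conjI allI impI)
  have Sl: "S \<in> sets lebesgue" using S by (rule open_imp_lebesgue)
  have l: "locally_integrable S v" "locally_integrable S w" "locally_integrable S f" "locally_integrable S g"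
    using f g by (auto simp: has_weak_grad_def)
  then show "locally_integrable S (\<lambda>x. v x + w x)" "locally_integrable S (\<lambda>x. f x + g x)"
    by (auto intro: locally_integrable_add)
  fix \<phi> assume \<phi>: "test_function S \<phi>"
  note i = integrable_test_function_scaleR[OF Sl l(3) \<phi>] integrable_test_function_scaleR[OF Sl l(4) \<phi>]
    integrable_scaleR_classical_grad[OF Sl l(1) \<phi>] integrable_scaleR_classical_grad[OF Sl l(2) \<phi>]
  show "(LINT x|lebesgue_on S. (v x + w x) *\<^sub>R grad \<phi> x) = - (LINT x|lebesgue_on S. \<phi> x *\<^sub>R (f x + g x))"
    using i f g \<phi> by (simp add: has_weak_grad_def scaleR_add_left scaleR_add_right)
qed

lemma has_weak_grad_cmult:
  assumes f: "has_weak_grad S v f"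
  shows "has_weak_grad S (\<lambda>x. a * v x) (\<lambda>x. a *\<^sub>R f x)"
  unfolding has_weak_grad_def
proof (intro conjI allI impI)
  show "locally_integrable S (\<lambda>x. a * v x)" "locally_integrable S (\<lambda>x. a *\<^sub>R f x)"
    using f locally_integrable_scaleR[of S v a] locally_integrable_scaleR[of S f a]
    by (auto simp: has_weak_grad_def)
  fix \<phi> assume \<phi>: "test_function S \<phi>"
  have "(LINT x|lebesgue_on S. (a * v x) *\<^sub>R grad \<phi> x)
      = a *\<^sub>R (LINT x|lebesgue_on S. v x *\<^sub>R grad \<phi> x)"
    by (simp only: scaleR_scaleR[symmetric] integral_scaleR_right)
  also have "\<dots> = - (a *\<^sub>R (LINT x|lebesgue_on S. \<phi> x *\<^sub>R f x))"
    using f \<phi> by (simp add: has_weak_grad_def)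
  also have "\<dots> = - (LINT x|lebesgue_on S. \<phi> x *\<^sub>R (a *\<^sub>R f x))"
    by (simp only: scaleR_left_commute[of _ a] integral_scaleR_right)
  finally show "(LINT x|lebesgue_on S. (a * v x) *\<^sub>R grad \<phi> x)
      = - (LINT x|lebesgue_on S. \<phi> x *\<^sub>R (a *\<^sub>R f x))" .
qed

lemma continuous_locally_integrable:
  fixes f :: "'a::euclidean_space \<Rightarrow> 'b::euclidean_space"
  assumes "continuous_on UNIV f" shows "locally_integrable S f"
  unfolding locally_integrable_def
proof (intro allI impI)
  fix C :: "'a set" assume C: "compact C \<and> C \<subseteq> S"
  have m: "(\<lambda>x. indicator C x *\<^sub>R f x) \<in> borel_measurable lborel"
    using assms C unfolding measurable_lborel1
    by (intro borel_measurable_scaleR borel_measurable_indicator)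
      (auto intro: borel_measurable_continuous_onI borel_compact)
  have "integrable lborel (\<lambda>x. indicator C x *\<^sub>R f x)"
    using assms C by (intro borel_integrable_compact) (auto intro: continuous_on_subset)
  then have "integrable lebesgue (\<lambda>x. indicator C x *\<^sub>R f x)"
    using integrable_completion[OF m] by simp
  then show "integrable (lebesgue_on C) f"
    using C by (simp add: integrable_restrict_space borel_compact)
qed

text \<open>Integration by parts on the whole space suffices, because the support of the test
  function stays inside \<open>S\<close>. This ties the chosen \<open>wgrad\<close> of a test
  function to its classical gradient.\<close>

lemma has_weak_grad_has_grad:
  assumes S: "open S" and f: "has_grad f f'"
  shows "has_weak_grad S f f'"
  unfolding has_weak_grad_def
proof (intro conjI allI impI)
  have Sl: "S \<in> sets lebesgue" using S by (rule open_imp_lebesgue)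
  note c = has_grad_continuous[OF f, of UNIV]
  show "locally_integrable S f" "locally_integrable S f'"
    using c by (auto intro: continuous_locally_integrable)
  fix \<phi> assume \<phi>: "test_function S \<phi>"
  note K = test_function_supp[OF \<phi>]
  note c' = has_grad_continuous[OF test_function_has_grad[OF \<phi>], of UNIV]
  have "(LINT x|lebesgue_on S. f x *\<^sub>R grad \<phi> x) = (LBINT x. f x *\<^sub>R grad \<phi> x)"
    using K c c' by (intro integral_lebesgue_on_compact_support(1)[OF Sl _ K(1,2)]) (auto intro: continuous_on_scaleR)
  also have "\<dots> = - (LBINT x. \<phi> x *\<^sub>R f' x)"
    by (rule integral_by_parts_has_grad[OF f test_function_has_grad[OF \<phi>] K(1,3)])
  also have "(LBINT x. \<phi> x *\<^sub>R f' x) = (LINT x|lebesgue_on S. \<phi> x *\<^sub>R f' x)"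
    using K c c' by (intro integral_lebesgue_on_compact_support(1)[OF Sl _ K(1,2), symmetric]) (auto intro: continuous_on_scaleR)
  finally show "(LINT x|lebesgue_on S. f x *\<^sub>R grad \<phi> x) = - (LINT x|lebesgue_on S. \<phi> x *\<^sub>R f' x)" .
qed

lemma test_function_wgrad:
  "open S \<Longrightarrow> test_function S \<phi> \<Longrightarrow> AE x in lebesgue_on S. wgrad S \<phi> x = grad \<phi> x"
  by (intro wgrad_AE_eq has_weak_grad_has_grad test_function_has_grad)

text \<open>Membership in \<open>H1\<close> only supplies some square integrable weak gradient;
  uniqueness transfers its properties to the chosen one.\<close>

lemma H1D:
  assumes S: "open S" and v: "v \<in> H1 S"
  shows "v \<in> L2 S" "wgrad S v \<in> L2 S" "has_weak_grad S v (wgrad S v)"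
proof -
  from v obtain g where g: "g \<in> L2 S" "has_weak_grad S v g" by (auto simp: H1_def)
  show "v \<in> L2 S" using v by (simp add: H1_def)
  show "has_weak_grad S v (wgrad S v)" using g(2) by (rule has_weak_grad_wgrad)
  have "AE x in lebesgue_on S. g x = wgrad S v x"
    using wgrad_AE_eq[OF S g(2)] by eventually_elim simp
  then show "wgrad S v \<in> L2 S" using L2_cong_AE(1)[OF open_imp_lebesgue[OF S] g(1)] by blast
qed

lemma H1_norm_ge: "L2_norm S v \<le> H1_norm S v" "L2_norm S (wgrad S v) \<le> H1_norm S v" "0 \<le> H1_norm S v"
  unfolding H1_norm_def by (auto intro!: real_le_rsqrt)

lemma H1_add:
  assumes S: "open S" and v: "v \<in> H1 S" and w: "w \<in> H1 S"
  shows "(\<lambda>x. v x + w x) \<in> H1 S"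
    and "AE x in lebesgue_on S. wgrad S (\<lambda>x. v x + w x) x = wgrad S v x + wgrad S w x" (is ?P)
    and "H1_norm S (\<lambda>x. v x + w x) \<le> H1_norm S v + H1_norm S w" (is ?Q)
proof -
  note V = H1D[OF S v] and W = H1D[OF S w]
  note wg = has_weak_grad_add[OF S V(3) W(3)]
  show "(\<lambda>x. v x + w x) \<in> H1 S"
    using L2_add(1)[OF V(1) W(1)] L2_add(1)[OF V(2) W(2)] wg by (auto simp: H1_def)
  show eq: ?P
    by (rule wgrad_AE_eq[OF S wg])
  then have "L2_norm S (wgrad S (\<lambda>x. v x + w x)) = L2_norm S (\<lambda>x. wgrad S v x + wgrad S w x)"
    by (intro L2_cong_AE(2)[OF open_imp_lebesgue[OF S] L2_add(1)[OF V(2) W(2)]]) (simp add: eq_commute)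
  then have "H1_norm S (\<lambda>x. v x + w x) \<le> sqrt ((L2_norm S v + L2_norm S w)^2
      + (L2_norm S (wgrad S v) + L2_norm S (wgrad S w))^2)"
    unfolding H1_norm_def using L2_add(2)[OF V(1) W(1)] L2_add(2)[OF V(2) W(2)]
    by (intro real_sqrt_le_mono add_mono power_mono) (auto simp: L2_norm_nonneg)
  also have "\<dots> \<le> H1_norm S v + H1_norm S w"
    unfolding H1_norm_def by (rule real_sqrt_sum_squares_triangle_ineq)
  finally show ?Q .
qed

lemma H1_cmult:
  assumes S: "open S" and v: "v \<in> H1 S"
  shows "(\<lambda>x. a * v x) \<in> H1 S"
    and "AE x in lebesgue_on S. wgrad S (\<lambda>x. a * v x) x = a *\<^sub>R wgrad S v x" (is ?P)
    and "H1_norm S (\<lambda>x. a * v x) = \<bar>a\<bar> * H1_norm S v" (is ?Q)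
proof -
  note V = H1D[OF S v]
  note wg = has_weak_grad_cmult[OF V(3), of a]
  have L: "(\<lambda>x. a * v x) \<in> L2 S" "L2_norm S (\<lambda>x. a * v x) = \<bar>a\<bar> * L2_norm S v"
    using L2_scaleR[OF V(1), of a] by simp_all
  show "(\<lambda>x. a * v x) \<in> H1 S"
    using L L2_scaleR(1)[OF V(2)] wg by (auto simp: H1_def)
  show eq: ?P
    by (rule wgrad_AE_eq[OF S wg])
  then have "L2_norm S (wgrad S (\<lambda>x. a * v x)) = L2_norm S (\<lambda>x. a *\<^sub>R wgrad S v x)"
    by (intro L2_cong_AE(2)[OF open_imp_lebesgue[OF S] L2_scaleR(1)[OF V(2)]]) (simp add: eq_commute)
  then show ?Q
    unfolding H1_norm_def L(2) L2_scaleR(2)[OF V(2)]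
    by (simp add: power_mult_distrib real_sqrt_mult flip: distrib_left)
qed

lemma H1_diff:
  assumes S: "open S" and v: "v \<in> H1 S" and w: "w \<in> H1 S"
  shows "(\<lambda>x. v x - w x) \<in> H1 S"
    and "AE x in lebesgue_on S. wgrad S (\<lambda>x. v x - w x) x = wgrad S v x - wgrad S w x" (is ?P)
proof -
  note m = H1_cmult[OF S w, of "-1"]
  show "(\<lambda>x. v x - w x) \<in> H1 S" using H1_add(1)[OF S v m(1)] by simp
  have "AE x in lebesgue_on S. wgrad S (\<lambda>x. v x - w x) x = wgrad S v x + wgrad S (\<lambda>x. - 1 * w x) x"
    using H1_add(2)[OF S v m(1)] by simp
  then show ?P
    using m(2) by eventually_elim simp
qed

lemma test_function_L2:
  assumes S: "open S" and \<phi>: "test_function S \<phi>"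
  shows "\<phi> \<in> L2 S" "grad \<phi> \<in> L2 S"
proof -
  note K = test_function_supp[OF \<phi>]
  note c = has_grad_continuous[OF test_function_has_grad[OF \<phi>], of UNIV]
  show "\<phi> \<in> L2 S" "grad \<phi> \<in> L2 S"
    using c K unfolding L2_def
    by (auto intro!: continuous_imp_measurable_lebesgue_on continuous_intros
        integral_lebesgue_on_compact_support(2)[OF open_imp_lebesgue[OF S] _ K(1,2)])
qed

lemma test_function_H1:
  assumes "open S" "test_function S \<phi>"
  shows "\<phi> \<in> H1 S"
  using test_function_L2[OF assms] has_weak_grad_has_grad[OF assms(1) test_function_has_grad[OF assms(2)]]
  by (auto simp: H1_def)

lemma test_function_add:
  assumes "test_function S \<phi>" "test_function S \<psi>" shows "test_function S (\<lambda>x. \<phi> x + \<psi> x)"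
proof -
  obtain K L where "compact K" "K \<subseteq> S" "\<And>x. x \<notin> K \<Longrightarrow> \<phi> x
    = 0" "compact L" "L \<subseteq> S" "\<And>x. x \<notin> L \<Longrightarrow> \<psi> x = 0"
    using assms test_function_supp by metis
  then show ?thesis
    using assms by (intro test_functionI[where K = "K \<union> L"]) (auto simp: test_function_def intro!: Ck_add)
qed

lemma test_function_cmult:
  assumes "test_function S \<phi>" shows "test_function S (\<lambda>x. a * \<phi> x)"
proof -
  obtain K where "compact K" "K \<subseteq> S" "\<And>x. x \<notin> K \<Longrightarrow> \<phi> x = 0"
    using assms test_function_supp by metis
  then show ?thesis
    using assms by (intro test_functionI[where K = K]) (auto simp: test_function_def intro!: Ck_cmult)
qed

section \<open>The space \<open>H10\<close> and its approximation by test functions\<close>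

lemma H10_H1: "v \<in> H10 S \<Longrightarrow> v \<in> H1 S"
  by (simp add: H10_def)

lemma H10_add:
  assumes S: "open S" and v: "v \<in> H10 S" and w: "w \<in> H10 S"
  shows "(\<lambda>x. v x + w x) \<in> H10 S"
proof -
  note V = H10_H1[OF v] and W = H10_H1[OF w]
  from v w obtain \<phi> \<psi> where \<phi>: "\<And>n. test_function S (\<phi> n)" "(\<lambda>n. H1_norm S
    (\<lambda>x. v x - \<phi> n x)) \<longlonglongrightarrow> 0"
    and \<psi>: "\<And>n. test_function S (\<psi> n)" "(\<lambda>n. H1_norm S (\<lambda>x. w x - \<psi> n x))
      \<longlonglongrightarrow> 0"
    unfolding H10_def by blast
  have "(\<lambda>n. H1_norm S (\<lambda>x. v x + w x - (\<phi> n x + \<psi> n x))) \<longlonglongrightarrow> 0"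
  proof (rule tendsto_sandwich[OF _ _ tendsto_const])
    show "(\<lambda>n. H1_norm S (\<lambda>x. v x - \<phi> n x)
      + H1_norm S (\<lambda>x. w x - \<psi> n x)) \<longlonglongrightarrow> 0"
      using tendsto_add[OF \<phi>(2) \<psi>(2)] by simp
    have "H1_norm S (\<lambda>x. (v x - \<phi> n x) + (w x - \<psi> n x))
        \<le> H1_norm S (\<lambda>x. v x - \<phi> n x) + H1_norm S (\<lambda>x. w x - \<psi> n x)" for n
      using \<phi>(1) \<psi>(1) by (intro H1_add(3)[OF S] H1_diff(1)[OF S] V W test_function_H1[OF S])
    then show "\<forall>\<^sub>F n in sequentially. H1_norm S (\<lambda>x. v x + w x - (\<phi> n x + \<psi> n x))
        \<le> H1_norm S (\<lambda>x. v x - \<phi> n x) + H1_norm S (\<lambda>x. w x - \<psi> n x)"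
      by (simp add: algebra_simps)
  qed (auto simp: H1_norm_ge)
  then show ?thesis
    using H1_add(1)[OF S V W] test_function_add[OF \<phi>(1) \<psi>(1)] unfolding H10_def
    by (intro CollectI conjI exI[of _ "\<lambda>n x. \<phi> n x + \<psi> n x"]) auto
qed

lemma H10_cmult:
  assumes S: "open S" and v: "v \<in> H10 S"
  shows "(\<lambda>x. a * v x) \<in> H10 S"
proof -
  note V = H10_H1[OF v]
  from v obtain \<phi> where \<phi>: "\<And>n. test_function S (\<phi> n)" "(\<lambda>n. H1_norm S (\<lambda>x. v x -
    \<phi> n x)) \<longlonglongrightarrow> 0"
    unfolding H10_def by blast
  have "H1_norm S (\<lambda>x. a * (v x - \<phi> n x)) = \<bar>a\<bar> * H1_norm S (\<lambda>x. v x - \<phi> n x)" for n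
    using \<phi>(1) by (intro H1_cmult(3)[OF S] H1_diff(1)[OF S] V test_function_H1[OF S])
  then have "(\<lambda>n. H1_norm S (\<lambda>x. a * v x - a * \<phi> n x)) \<longlonglongrightarrow> 0"
    using tendsto_mult_left[OF \<phi>(2), of "\<bar>a\<bar>"] by (simp add: right_diff_distrib)
  then show ?thesis
    using H1_cmult(1)[OF S V] test_function_cmult[OF \<phi>(1)] unfolding H10_def
    by (intro CollectI conjI exI[of _ "\<lambda>n x. a * \<phi> n x"]) auto
qed

lemma H10_diff:
  assumes "open S" "v \<in> H10 S" "w \<in> H10 S"
  shows "(\<lambda>x. v x - w x) \<in> H10 S"
  using H10_add[OF assms(1,2) H10_cmult[OF assms(1,3), of "-1"]] by simp

text \<open>Replaces the weak gradient of a difference by a difference with classical gradients, so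
  that estimates proved for test functions pass to limits in L2.\<close>

lemma H10_approx:
  assumes S: "open S" and v: "v \<in> H10 S"
  obtains \<phi> where "\<And>n. test_function S (\<phi> n)" "(\<lambda>n. L2_norm S (\<lambda>x. v x - \<phi> n x))
    \<longlonglongrightarrow> 0"
    "(\<lambda>n. L2_norm S (\<lambda>x. wgrad S v x - grad (\<phi> n) x)) \<longlonglongrightarrow> 0"
proof -
  note V = H10_H1[OF v]
  from v obtain \<phi> where \<phi>: "\<And>n. test_function S (\<phi> n)" "(\<lambda>n. H1_norm S (\<lambda>x. v x -
    \<phi> n x)) \<longlonglongrightarrow> 0"
    unfolding H10_def by blast
  have eq: "L2_norm S (\<lambda>x. wgrad S v x - grad (\<phi> n) x) = L2_norm S (wgrad S (\<lambda>x. v x - \<phi> n x))" for n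
  proof (rule L2_cong_AE(2)[OF open_imp_lebesgue[OF S]])
    have d: "(\<lambda>x. v x - \<phi> n x) \<in> H1 S"
      using \<phi>(1) by (intro H1_diff(1)[OF S] V test_function_H1[OF S])
    then show "wgrad S (\<lambda>x. v x - \<phi> n x) \<in> L2 S" by (rule H1D(2)[OF S])
    show "AE x in lebesgue_on S. wgrad S (\<lambda>x. v x - \<phi> n x) x = wgrad S v x - grad (\<phi> n) x"
      using H1_diff(2)[OF S V test_function_H1[OF S \<phi>(1)[of n]]] test_function_wgrad[OF S \<phi>(1)[of n]]
      by eventually_elim simp
  qed
  show thesis
  proof (rule that[of \<phi>])
    show "(\<lambda>n. L2_norm S (\<lambda>x. v x - \<phi> n x)) \<longlonglongrightarrow> 0"
      by (rule tendsto_sandwich[OF _ _ tendsto_const \<phi>(2)]) (auto simp: H1_norm_ge L2_norm_nonneg)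
    show "(\<lambda>n. L2_norm S (\<lambda>x. wgrad S v x - grad (\<phi> n) x)) \<longlonglongrightarrow> 0"
      unfolding eq
      by (rule tendsto_sandwich[OF _ _ tendsto_const \<phi>(2)]) (auto simp: H1_norm_ge L2_norm_nonneg)
  qed (use \<phi> in auto)
qed

section \<open>Averages of functions with square integrable gradient\<close>

text \<open>Cauchy-Schwarz against the indicator of \<open>A\<close>, in other words Jensen's
  inequality for the square of a mean.\<close>

lemma square_integral_le:
  fixes F :: "'a \<Rightarrow> real"
  assumes A: "A \<in> sets M" "emeasure M A < \<infinity>" and [measurable]: "F \<in> borel_measurable M"
    and F: "integrable M (\<lambda>x. (F x)^2 * indicator A x)"
  shows "integrable M (\<lambda>x. F x * indicator A x)"
    and "(LINT x|M. F x * indicator A x)^2 \<le> measure M A * (LINT x|M. (F x)^2 * indicator A x)" (is ?P)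
proof -
  note [measurable] = A(1)
  have sq: "(norm (F x * indicator A x))^2 = (F x)^2 * indicator A x"
    "(norm (indicator A x :: real))^2 = indicator A x" for x
    by (auto simp: indicator_def)
  have nm: "norm (F x * indicator A x) * norm (indicator A x :: real) = \<bar>F x * indicator A x\<bar>" for x
    by (auto simp: indicator_def)
  have iA: "integrable M (indicator A :: 'a \<Rightarrow> real)"
    using A by (intro integrable_real_indicator) auto
  have m: "(\<lambda>x. F x * indicator A x) \<in> borel_measurable M"
    "(indicator A :: 'a \<Rightarrow> real) \<in> borel_measurable M" by measurable
  note cs = integrable_Cauchy_Schwarz[OF m, unfolded sq nm, OF F iA]
  from cs(1) show "integrable M (\<lambda>x. F x * indicator A x)"
    by (subst (asm) integrable_abs_iff) (rule m)
  have "\<bar>LINT x|M. F x * indicator A x\<bar>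
      \<le> sqrt (LINT x|M. (F x)^2 * indicator A x) * sqrt (measure M A)"
    using cs(2) A sets.sets_into_space[OF A(1)]
    by (intro order_trans[OF integral_abs_bound]) (simp add: Int_absorb2)
  then have "\<bar>LINT x|M. F x * indicator A x\<bar>^2
      \<le> (sqrt (LINT x|M. (F x)^2 * indicator A x) * sqrt (measure M A))^2"
    by (intro power_mono) auto
  moreover have "0 \<le> (LINT x|M. (F x)^2 * indicator A x)" by (intro Bochner_Integration.integral_nonneg) auto
  ultimately show ?P
    by (simp add: power_mult_distrib mult.commute)
qed

lemma nn_integral_lborel_translate:
  fixes f :: "'a::euclidean_space \<Rightarrow> ennreal"
  assumes [measurable]: "f \<in> borel_measurable borel"
  shows "(\<integral>\<^sup>+x. f (x + c) \<partial>lborel) = (\<integral>\<^sup>+x. f x \<partial>lborel)"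
proof -
  have "(\<integral>\<^sup>+x. f x \<partial>lborel) = (\<integral>\<^sup>+x. f x \<partial>distr lborel borel ((+) c))"
    by (simp add: lborel_distr_plus)
  also have "\<dots> = (\<integral>\<^sup>+x. f (c + x) \<partial>lborel)"
    by (rule nn_integral_distr) auto
  finally show ?thesis by (simp add: add.commute)
qed

text \<open>The increment is the integral of the directional derivative along the segment from
  \<open>x\<close> to \<open>x + y\<close>. Its square is bounded by Cauchy-Schwarz on the unit
  interval; Tonelli's theorem and translation invariance then make every point of the segment
  contribute the same gradient integral.\<close>

lemma shift_estimate:
  fixes \<phi> :: "'a::euclidean_space \<Rightarrow> real"
  assumes g: "has_grad \<phi> g"
  shows "(\<integral>\<^sup>+x. ennreal ((\<phi> (x + y) - \<phi> x)^2) \<partial>lborel)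
    \<le> ennreal ((norm y)^2) * (\<integral>\<^sup>+x. ennreal ((norm (g x))^2) \<partial>lborel)"
proof -
  let ?F = "\<lambda>x t. ennreal ((norm y)^2) * (ennreal ((norm (g (x + t *\<^sub>R y)))^2) * indicator {0..1} t)"
  let ?N = "\<integral>\<^sup>+x. ennreal ((norm (g x))^2) \<partial>lborel"
  have [measurable]: "g \<in> borel_measurable borel"
    using has_grad_continuous(2)[OF g] by (rule borel_measurable_continuous_onI)
  have pt: "ennreal ((\<phi> (x + y) - \<phi> x)^2)
      \<le> (\<integral>\<^sup>+t. ?F x t \<partial>lborel)" for x
  proof -
    define F where "F t = g (x + t *\<^sub>R y) \<bullet> y" for t
    have "continuous_on UNIV (\<lambda>t. x + t *\<^sub>R y)" by (intro continuous_intros)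
    from continuous_on_compose2[OF has_grad_continuous(2)[OF g, of UNIV] this]
    have cg: "continuous_on UNIV (\<lambda>t. g (x + t *\<^sub>R y))" by simp
    then have cF: "continuous_on UNIV F" unfolding F_def by (intro continuous_intros)
    have cont: "isCont F t" "isCont (\<lambda>t. (F t)^2) t" "isCont (\<lambda>t. (norm y)^2 * (norm (g (x
      + t *\<^sub>R y)))^2) t" for t
      using cF cg by (auto simp: continuous_on_eq_continuous_at intro!: continuous_intros)
    have D: "((\<lambda>t. \<phi> (x + t *\<^sub>R y)) has_real_derivative F t) (at t)" for t
      unfolding F_def by (rule has_grad_line[OF g])
    have ftc: "(LBINT t. F t * indicator {0..1} t) = \<phi> (x + 1 *\<^sub>R y) - \<phi> (x + 0 *\<^sub>R y)"
      using integral_FTC_Icc_real[of 0 1 "\<lambda>t. \<phi> (x + t *\<^sub>R y)" F] D cont by simp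
    have iF: "integrable lborel (\<lambda>t. (F t)^2 * indicator {0..1} t)"
      and ig: "integrable lborel (\<lambda>t. (norm y)^2 * (norm (g (x + t *\<^sub>R y)))^2 * indicator {0..1} t)"
      using cont by (auto intro!: borel_integrable_atLeastAtMost)
    have "(\<phi> (x + y) - \<phi> x)^2 \<le> (LBINT t. (F t)^2 * indicator {0..1} t)"
      using square_integral_le(2)[of "{0..1}" lborel F] iF ftc cF
      by (simp add: borel_measurable_continuous_onI)
    also have "\<dots> \<le> (LBINT t. (norm y)^2 * (norm (g (x + t *\<^sub>R y)))^2 * indicator {0..1} t)"
    proof (intro integral_mono iF ig mult_right_mono)
      fix t
      have "\<bar>F t\<bar> \<le> norm (g (x + t *\<^sub>R y)) * norm y"
        unfolding F_def by (rule Cauchy_Schwarz_ineq2)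
      then have "\<bar>F t\<bar>^2 \<le> (norm (g (x + t *\<^sub>R y)) * norm y)^2" by (intro power_mono) auto
      then show "(F t)^2 \<le> (norm y)^2 * (norm (g (x + t *\<^sub>R y)))^2"
        by (simp add: power_mult_distrib mult.commute)
    qed simp
    finally have "ennreal ((\<phi> (x + y) - \<phi> x)^2)
        \<le> ennreal (LBINT t. (norm y)^2 * (norm (g (x + t *\<^sub>R y)))^2 * indicator {0..1} t)"
      by (rule ennreal_leI)
    also have "\<dots> = (\<integral>\<^sup>+t. ennreal ((norm y)^2 * (norm (g (x
      + t *\<^sub>R y)))^2 * indicator {0..1} t) \<partial>lborel)"
      using ig by (intro nn_integral_eq_integral[symmetric]) auto
    also have "\<dots> = (\<integral>\<^sup>+t. ?F x t \<partial>lborel)"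
      by (intro nn_integral_cong) (auto simp: ennreal_mult indicator_def)
    finally show ?thesis .
  qed
  have "(\<integral>\<^sup>+x. ennreal ((\<phi> (x + y) - \<phi> x)^2) \<partial>lborel)
    \<le> (\<integral>\<^sup>+x. \<integral>\<^sup>+t. ?F x t \<partial>lborel \<partial>lborel)"
    by (intro nn_integral_mono pt)
  also have "\<dots> = (\<integral>\<^sup>+t. \<integral>\<^sup>+x. ?F x t \<partial>lborel \<partial>(lborel :: real measure))"
    by (rule lborel_pair.Fubini'[symmetric]) measurable
  also have "\<dots> = (\<integral>\<^sup>+t. ennreal ((norm y)^2) * (?N * indicator {0..1} t) \<partial>(lborel ::
    real measure))"
  proof (rule nn_integral_cong)
    fix t :: real
    have "(\<integral>\<^sup>+x. ennreal ((norm (g (x + t *\<^sub>R y)))^2) \<partial>lborel) = ?N"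
      by (rule nn_integral_lborel_translate) measurable
    then show "(\<integral>\<^sup>+x. ?F x t \<partial>lborel)
      = ennreal ((norm y)^2) * (?N * indicator {0..1} t)"
      by (cases "t \<in> {0..1}") (simp_all add: nn_integral_cmult)
  qed
  also have "\<dots> = ennreal ((norm y)^2) * ?N"
    by (simp add: nn_integral_cmult)
  finally show ?thesis .
qed

text \<open>The ball may leave the domain on which \<phi> is considered; for test functions this is
  harmless, as they vanish outside their support.\<close>

definition average :: "real \<Rightarrow> ('a::euclidean_space \<Rightarrow> real) \<Rightarrow> 'a \<Rightarrow> real" where
  "average \<delta> \<phi> x = (LBINT y. \<phi> (x
    + y) * indicator (cball 0 \<delta>) y) / measure lborel (cball (0::'a) \<delta>)"

text \<open>The sup bound is Cauchy-Schwarz on the ball. For the L2 bound, \<phi> minus its average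
  is a mean of increments over shifts of length at most \<delta>; Jensen, Fubini and the shift
  estimate apply, and the volume of the ball cancels. Nonnegative integrals spare any integrability
  check before the bound is known.\<close>

lemma average_estimate:
  fixes \<phi> :: "'a::euclidean_space \<Rightarrow> real"
  assumes \<delta>: "0 < \<delta>" and g: "has_grad \<phi> g"
    and K: "compact K" "\<And>x. x \<notin> K \<Longrightarrow> \<phi> x = 0"
  shows "average \<delta> \<phi> \<in> borel_measurable borel" (is ?P)
    and "\<bar>average \<delta> \<phi> x\<bar>
      \<le> sqrt (LBINT x. (\<phi> x)^2) / sqrt (measure lborel (cball (0::'a) \<delta>))"
    and "(\<integral>\<^sup>+x. ennreal ((\<phi> x - average \<delta> \<phi> x)^2) \<partial>lborel)
      \<le> ennreal (\<delta>^2) * (\<integral>\<^sup>+x. ennreal ((norm (g x))^2) \<partial>lborel)"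
proof -
  define m where m_avg: "m = average \<delta> \<phi>"
  define B where "B = cball (0::'a) \<delta>"
  define V where "V = measure lborel B"
  have B: "B \<in> sets lborel" "emeasure lborel B < \<infinity>" "emeasure lborel B = ennreal V"
    using emeasure_lborel_cball_finite[of "0::'a" \<delta>] by (auto simp: B_def V_def emeasure_eq_ennreal_measure)
  note [measurable] = B(1)
  have V: "0 < V"
    using content_ball_pos[OF \<delta>, of "0::'a"] \<delta> content_cball_pos[of \<delta> "0::'a"] by (simp add: V_def B_def)
  let ?E = "\<lambda>x y. ennreal ((\<phi> (x + y) - \<phi> x)^2) * indicator B y"
  let ?J = "\<lambda>x. LBINT y. (\<phi> (x + y) - \<phi> x)^2 * indicator B y"
  let ?A = "\<lambda>x. LBINT y. \<phi> (x + y) * indicator B y"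
  let ?N = "\<integral>\<^sup>+x. ennreal ((norm (g x))^2) \<partial>lborel" and ?Q = "LBINT x. (\<phi> x)^2"
  let ?D = "\<integral>\<^sup>+x. ennreal ((\<phi> x - m x)^2) \<partial>lborel"
  have c: "continuous_on UNIV \<phi>" using has_grad_continuous(1)[OF g] .
  then have [measurable]: "\<phi> \<in> borel_measurable borel" by (rule borel_measurable_continuous_onI)
  have i2: "integrable lborel (\<lambda>x. (\<phi> x)^2)"
    using c K by (intro integrable_compact_support[of _ K]) (auto intro!: continuous_intros)
  have ind: "integrable lborel (\<lambda>y. F y * indicator B y)" if "continuous_on UNIV F" for F :: "'a \<Rightarrow> real"
    using borel_integrable_compact[of B F] that
    by (auto simp: B_def mult.commute intro: continuous_on_subset)
  have cs: "continuous_on UNIV (\<lambda>y. \<phi> (x + y))" for x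
  proof -
    have "continuous_on UNIV (\<lambda>y. x + y)" by (intro continuous_intros)
    from continuous_on_compose2[OF c this] show ?thesis by simp
  qed
  have m_def: "m = (\<lambda>x. ?A x / V)"
    by (simp add: m_avg average_def[abs_def] V_def B_def)
  have "?A \<in> borel_measurable borel"
    by (rule lborel.borel_measurable_lebesgue_integral) measurable
  then have mm [measurable]: "m \<in> borel_measurable borel" unfolding m_def by simp
  have mC: "\<bar>m x\<bar> \<le> sqrt ?Q / sqrt V" for x
  proof -
    have "(?A x)^2 \<le> V * (LBINT y. (\<phi> (x + y))^2 * indicator B y)"
      unfolding V_def by (rule square_integral_le(2)[OF B(1,2) _ ind[OF continuous_on_power[OF cs]]]) measurable
    also have "\<dots> \<le> V * ?Q"
    proof (intro mult_left_mono)
      note it = lborel_translate[OF i2, of x]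
      have "(LBINT y. (\<phi> (x + y))^2 * indicator B y) \<le> (LBINT y. (\<phi> (x + y))^2)"
        by (intro integral_mono it(1) ind continuous_on_power cs) (auto simp: indicator_def)
      also have "\<dots> = ?Q"
        by (rule it(2))
      finally show "(LBINT y. (\<phi> (x + y))^2 * indicator B y) \<le> ?Q" .
    qed (use V in simp)
    finally have "sqrt ((?A x)^2) \<le> sqrt (V * ?Q)"
      by (rule real_sqrt_le_mono)
    then have "\<bar>?A x\<bar> / V \<le> sqrt V * sqrt ?Q / V"
      using V by (intro divide_right_mono) (auto simp: real_sqrt_mult)
    also have "\<dots> = sqrt ?Q / sqrt V"
      using V by (simp add: field_simps flip: power2_eq_square)
    finally show ?thesis using V by (simp add: m_def)
  qed
  have pt: "ennreal ((\<phi> x - m x)^2) \<le> ennreal (1 / V) * (\<integral>\<^sup>+y. ?E x y \<partial>lborel)" for x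
  proof -
    have cd: "continuous_on UNIV (\<lambda>y. \<phi> (x + y) - \<phi> x)" by (intro continuous_intros cs)
    have "(LBINT y. (\<phi> (x + y) - \<phi> x) * indicator B y) = V * (m x - \<phi> x)"
    proof -
      have "(LBINT y. (\<phi> (x + y) - \<phi> x) * indicator B y)
        = (LBINT y. \<phi> (x + y) * indicator B y - \<phi> x * indicator B y)"
        by (simp add: left_diff_distrib)
      also have "\<dots> = ?A x - (LBINT y. \<phi> x * indicator B y)"
        using ind[OF cs] ind[OF continuous_on_const, of "\<phi> x"]
        by (intro Bochner_Integration.integral_diff) auto
      also have "(LBINT y. \<phi> x * indicator B y) = \<phi> x * V"
        by (simp add: V_def)
      also have "?A x = V * m x"
        using V by (simp add: m_def)
      also have "V * m x - \<phi> x * V = V * (m x - \<phi> x)" by (simp add: algebra_simps)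
      finally show ?thesis .
    qed
    then have "(V * (m x - \<phi> x))^2 \<le> V * ?J x"
      using square_integral_le(2)[OF B(1,2), of "\<lambda>y. \<phi> (x + y) - \<phi> x"] ind[OF continuous_on_power[OF cd, of 2]]
      by (simp add: V_def)
    then have "(\<phi> x - m x)^2 \<le> 1 / V * ?J x"
    proof -
      have "d^2 \<le> 1 / V * J" if "(V * d)^2 \<le> V * J" for d J
      proof -
        have "V * (V * d^2) \<le> V * J" using that by (simp add: power2_eq_square ac_simps)
        then show ?thesis using V by (simp add: field_simps)
      qed
      then show ?thesis
        using \<open>(V * (m x - \<phi> x))^2 \<le> _\<close> by (subst power2_commute)
    qed
    then have "ennreal ((\<phi> x - m x)^2) \<le> ennreal (1 / V * ?J x)"
      by (rule ennreal_leI)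
    also have "\<dots> = ennreal (1 / V) * ennreal (?J x)"
      using V by (intro ennreal_mult) auto
    also have "ennreal (?J x)
        = (\<integral>\<^sup>+y. ennreal ((\<phi> (x + y) - \<phi> x)^2 * indicator B y) \<partial>lborel)"
      using ind[OF continuous_on_power[OF cd, of 2]] by (intro nn_integral_eq_integral[symmetric]) auto
    also have "\<dots> = (\<integral>\<^sup>+y. ?E x y \<partial>lborel)"
      by (intro nn_integral_cong) (auto simp: indicator_def)
    finally show ?thesis .
  qed
  have "?D
    \<le> (\<integral>\<^sup>+x. ennreal (1 / V) * (\<integral>\<^sup>+y. ?E x y \<partial>lborel) \<partial>lborel)"
    by (intro nn_integral_mono pt)
  also have "\<dots> = ennreal (1 / V) * (\<integral>\<^sup>+x. (\<integral>\<^sup>+y. ?E x y \<partial>lborel) \<partial>lborel)"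
    by (rule nn_integral_cmult) measurable
  also have "(\<integral>\<^sup>+x. (\<integral>\<^sup>+y. ?E x y \<partial>lborel) \<partial>lborel)
    = (\<integral>\<^sup>+y. (\<integral>\<^sup>+x. ?E x y \<partial>lborel) \<partial>lborel)"
    by (rule lborel_pair.Fubini'[symmetric]) measurable
  also have "\<dots> \<le> (\<integral>\<^sup>+y. ennreal (\<delta>^2) * ?N * indicator B y \<partial>lborel)"
  proof (rule nn_integral_mono)
    fix y
    have "(\<integral>\<^sup>+x. ?E x y \<partial>lborel)
      = (\<integral>\<^sup>+x. ennreal ((\<phi> (x + y) - \<phi> x)^2) \<partial>lborel) * indicator B y"
      by (rule nn_integral_multc) measurable
    also have "\<dots> \<le> ennreal (\<delta>^2) * ?N * indicator B y"
    proof (cases "y \<in> B")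
      case True
      then have "ennreal ((norm y)^2) \<le> ennreal (\<delta>^2)"
        by (intro ennreal_leI power_mono) (auto simp: B_def)
      then show ?thesis
        using order_trans[OF shift_estimate[OF g, of y] mult_right_mono] True by simp
    qed simp
    finally show "(\<integral>\<^sup>+x. ?E x y \<partial>lborel)
      \<le> ennreal (\<delta>^2) * ?N * indicator B y" .
  qed
  also have "\<dots> = ennreal (\<delta>^2) * ?N * ennreal V"
    using B by (simp add: nn_integral_cmult)
  finally have "?D
    \<le> ennreal (1 / V) * (ennreal (\<delta>^2) * ?N * ennreal V)"
    by (simp add: mult_left_mono)
  also have "\<dots> = (ennreal (1 / V) * ennreal V) * (ennreal (\<delta>^2) * ?N)"
    by (simp add: ac_simps)
  also have "ennreal (1 / V) * ennreal V = 1"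
    using V by (simp flip: ennreal_mult)
  finally have "?D
    \<le> ennreal (\<delta>^2) * ?N" by simp
  with mm mC show ?P
    "\<bar>average \<delta> \<phi> x\<bar> \<le> sqrt ?Q / sqrt (measure lborel (cball (0::'a) \<delta>))"
    "(\<integral>\<^sup>+x. ennreal ((\<phi> x - average \<delta> \<phi> x)^2) \<partial>lborel) \<le> ennreal (\<delta>^2) * ?N"
    by (simp_all add: m_avg V_def B_def)
qed

section \<open>Forms with a bounded coefficient\<close>

lemma integrable_lebesgue_on_lborel:
  fixes f :: "'a::euclidean_space \<Rightarrow> real"
  assumes S: "S \<in> sets lebesgue" and f: "integrable lborel f" "\<And>x. 0 \<le> f x"
  shows "integrable (lebesgue_on S) f" and "(LINT x|lebesgue_on S. f x) \<le> (LBINT x. f x)"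
proof -
  have m: "f \<in> borel_measurable lborel" using f by auto
  have l: "integrable lebesgue f" using integrable_completion[OF m] f(1) by simp
  then have i: "integrable lebesgue (\<lambda>x. indicator S x *\<^sub>R f x)"
    using S by (intro integrable_mult_indicator)
  then show "integrable (lebesgue_on S) f" using S by (simp add: integrable_restrict_space)
  have "(LINT x|lebesgue_on S. f x) = (LINT x|lebesgue. indicator S x *\<^sub>R f x)"
    using S by (simp add: integral_restrict_space)
  also have "\<dots> \<le> (LINT x|lebesgue. f x)"
    using f(2) by (intro integral_mono i l) (auto simp: indicator_def)
  also have "\<dots> = (LBINT x. f x)" using integral_completion[OF m] .
  finally show "(LINT x|lebesgue_on S. f x) \<le> (LBINT x. f x)" .
qed

lemma L2_const:
  assumes "S \<in> sets lebesgue" "bounded S"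
  shows "(\<lambda>x. c) \<in> L2 S"
proof -
  have "finite_measure (lebesgue_on S)"
    using assms by (intro finite_measure_lebesgue_on bounded_set_imp_lmeasurable)
  then have "integrable (lebesgue_on S) (\<lambda>x. (norm c)^2)"
    by (rule finite_measure.integrable_const)
  then show ?thesis by (simp add: L2_def)
qed

lemma bounded_measurable_L2:
  fixes G :: "'a::euclidean_space \<Rightarrow> 'b::euclidean_space"
  assumes "S \<in> sets lebesgue" "bounded S" "G \<in> borel_measurable (lebesgue_on S)"
    "AE x in lebesgue_on S. norm (G x) \<le> M" "0 \<le> M"
  shows "G \<in> L2 S"
  by (rule L2_bound(1)[OF L2_const[OF assms(1,2), of "1::real"] assms(3), of M]) (use assms in auto)

lemma L2_compact_support:
  fixes f :: "'a::euclidean_space \<Rightarrow> 'b::euclidean_space"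
  assumes S: "S \<in> sets lebesgue" and f: "continuous_on UNIV f"
    and K: "compact K" "K \<subseteq> S" "\<And>x. x \<notin> K \<Longrightarrow> f x = 0"
  shows "f \<in> L2 S" and "(L2_norm S f)^2 = (LBINT x. (norm (f x))^2)"
proof -
  have c: "continuous_on UNIV (\<lambda>x. (norm (f x))^2)" using f by (intro continuous_intros)
  have z: "(norm (f x))^2 = 0" if "x \<notin> K" for x using K(3)[OF that] by simp
  note i = integral_lebesgue_on_compact_support[OF S c K(1,2) z]
  show "f \<in> L2 S" using i(2) continuous_imp_measurable_lebesgue_on[OF f] by (simp add: L2_def)
  show "(L2_norm S f)^2 = (LBINT x. (norm (f x))^2)" using i(1) by (simp add: L2_norm_power2)
qed

text \<open>The norms of \<phi> and its gradient over \<open>S\<close> agree with those over the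
  whole space, since the support lies in \<open>S\<close>. The deviation from the average need not
  be supported in \<open>S\<close>, but restricting a square only lowers its integral.\<close>

lemma average_estimate_L2:
  fixes \<phi> :: "'a::euclidean_space \<Rightarrow> real"
  assumes \<delta>: "0 < \<delta>" and S: "S \<in> sets lebesgue" and \<phi>: "test_function S \<phi>"
  shows "(\<lambda>x. \<phi> x - average \<delta> \<phi> x) \<in> L2 S" (is ?P)
    and "\<bar>average \<delta> \<phi> x\<bar> \<le> L2_norm S \<phi> / sqrt (measure lborel (cball (0::'a) \<delta>))" (is ?Q)
    and "L2_norm S (\<lambda>x. \<phi> x - average \<delta> \<phi> x) \<le> \<delta> * L2_norm S (grad \<phi>)" (is ?R)
proof -
  note K = test_function_supp[OF \<phi>]
  note g = test_function_has_grad[OF \<phi>]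
  note c = has_grad_continuous[OF g, of UNIV]
  note P = L2_compact_support[OF S c(1) K(1,2,3)] and Q = L2_compact_support[OF S c(2) K(1,2,4)]
  define m where "m = average \<delta> \<phi>"
  note m = average_estimate[OF \<delta> g K(1,3), folded m_def]
  have [measurable]: "\<phi> \<in> borel_measurable borel" "m \<in> borel_measurable borel"
    using c m by (auto intro: borel_measurable_continuous_onI)
  have nP: "L2_norm S \<phi> = sqrt (LBINT x. (\<phi> x)^2)"
    using P(2) by (intro real_sqrt_unique[symmetric]) (auto simp: L2_norm_nonneg)
  have ig: "integrable lborel (\<lambda>x. (norm (grad \<phi> x))^2)"
    using c(2) K by (intro integrable_compact_support[OF _ K(1)]) (auto intro!: continuous_intros)
  have "(\<integral>\<^sup>+x. ennreal ((norm (grad \<phi> x))^2) \<partial>lborel) = ennreal ((L2_norm S (grad \<phi>))^2)"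
    using nn_integral_eq_integral[OF ig] Q(2) by simp
  with m(3) have le: "(\<integral>\<^sup>+x. ennreal ((\<phi> x - m x)^2) \<partial>lborel)
    \<le> ennreal (\<delta>^2 * (L2_norm S (grad \<phi>))^2)"
    by (simp add: ennreal_mult)
  have id: "integrable lborel (\<lambda>x. (\<phi> x - m x)^2)"
  proof (rule integrableI_bounded)
    show "(\<lambda>x. (\<phi> x - m x)^2) \<in> borel_measurable lborel" by measurable
    show "(\<integral>\<^sup>+x. ennreal (norm ((\<phi> x - m x)^2)) \<partial>lborel) < \<infinity>"
      using le by (simp add: order_le_less_trans[OF le])
  qed
  have "(LBINT x. (\<phi> x - m x)^2) \<le> \<delta>^2 * (L2_norm S (grad \<phi>))^2"
    using nn_integral_eq_integral[OF id] le by simp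
  moreover note R = integrable_lebesgue_on_lborel[OF S id]
  ultimately have "(L2_norm S (\<lambda>x. \<phi> x - m x))^2 \<le> (\<delta> * L2_norm S (grad \<phi>))^2"
    by (simp add: L2_norm_power2 power_mult_distrib)
  then have "L2_norm S (\<lambda>x. \<phi> x - m x) \<le> \<delta> * L2_norm S (grad \<phi>)"
    by (rule power2_le_imp_le) (use \<delta> in \<open>simp add: L2_norm_nonneg\<close>)
  then show ?R
    by (simp add: m_def)
  have "(\<lambda>x. \<phi> x - m x) \<in> borel_measurable (lebesgue_on S)"
    by (intro measurable_restrict_space1 measurable_completion) measurable
  then show ?P using R(1) by (simp add: L2_def m_def)
  show ?Q
    using m(2)[of x] unfolding nP m_def .
qed

text \<open>Integration by parts moves the derivative from \<psi> onto the product of \<phi> and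
  \<open>p\<close>. That is how the bound comes to contain the norm of \<psi> instead of that of its
  gradient, at the price of a bound on the gradient of \<open>p\<close>.\<close>

lemma smooth_coefficient_estimate:
  fixes p :: "'a::euclidean_space \<Rightarrow> real"
  assumes S: "S \<in> sets lebesgue" and p: "has_grad p p'"
    and C: "\<And>x. x \<in> S \<Longrightarrow> \<bar>p x\<bar>
      \<le> C" "\<And>x. x \<in> S \<Longrightarrow> norm (p' x) \<le> C" "0 \<le> C"
    and i: "i \<in> Basis" and \<phi>: "test_function S \<phi>" and \<psi>: "test_function S \<psi>"
  shows "\<bar>LINT x|lebesgue_on S. \<phi> x * (p x * (grad \<psi> x \<bullet> i))\<bar>
    \<le> C * (L2_norm S \<phi> + L2_norm S (grad \<phi>)) * L2_norm S \<psi>"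
proof -
  note g = test_function_has_grad[OF \<phi>] and h = test_function_has_grad[OF \<psi>]
  note K = test_function_supp[OF \<phi>]
  note L = test_function_supp[OF \<psi>]
  note c = has_grad_continuous[OF g, of UNIV] has_grad_continuous[OF h, of UNIV] has_grad_continuous[OF p, of UNIV]
  note L2s = L2_compact_support(1)[OF S c(1) K(1,2,3)] L2_compact_support(1)[OF S c(2) K(1,2,4)]
    L2_compact_support(1)[OF S c(3) L(1,2,3)]
  define a where "a x = \<psi> x * (\<phi> x * (p' x \<bullet> i))" for x
  define b where "b x = \<psi> x * (p x * (grad \<phi> x \<bullet> i))" for x
  have m: "a \<in> borel_measurable (lebesgue_on S)" "b \<in> borel_measurable (lebesgue_on S)"
    unfolding a_def b_def using c
    by (auto intro!: continuous_imp_measurable_lebesgue_on continuous_intros)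
  have la: "\<bar>a x\<bar> \<le> C * (norm (\<phi> x) * norm (\<psi> x))" if "x \<in> S" for x
  proof -
    have "\<bar>p' x \<bullet> i\<bar> \<le> C" using Basis_le_norm[OF i, of "p' x"] C(2)[OF that] by linarith
    then have "(\<bar>\<psi> x\<bar> * \<bar>\<phi> x\<bar>) * \<bar>p' x \<bullet> i\<bar>
      \<le> (\<bar>\<psi> x\<bar> * \<bar>\<phi> x\<bar>) * C" by (intro mult_left_mono) auto
    then show ?thesis by (simp add: a_def abs_mult ac_simps)
  qed
  have lb: "\<bar>b x\<bar> \<le> C * (norm (grad \<phi> x) * norm (\<psi> x))" if "x \<in> S" for x
  proof -
    have "\<bar>p x\<bar> * \<bar>grad \<phi> x \<bullet> i\<bar> \<le> C * norm (grad \<phi> x)"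
      using Basis_le_norm[OF i] C(1)[OF that] C(3) by (intro mult_mono) auto
    then have "\<bar>\<psi> x\<bar> * (\<bar>p x\<bar> * \<bar>grad \<phi> x \<bullet> i\<bar>)
      \<le> \<bar>\<psi> x\<bar> * (C * norm (grad \<phi> x))"
      by (intro mult_left_mono) auto
    then show ?thesis by (simp add: b_def abs_mult ac_simps)
  qed
  have AE: "AE x in lebesgue_on S. \<bar>a x\<bar> \<le> C * (norm (\<phi> x) * norm (\<psi> x))"
    "AE x in lebesgue_on S. \<bar>b x\<bar> \<le> C * (norm (grad \<phi> x) * norm (\<psi> x))"
    using la lb by (auto intro!: AE_I2)
  note A = L2_product[OF L2s(1,3) m(1) AE(1)] and B = L2_product[OF L2s(2,3) m(2) AE(2)]
  note f = has_grad_mult[OF g p]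
  note cf = has_grad_continuous[OF f, of UNIV]
  have "(LINT x|lebesgue_on S. \<phi> x * (p x * (grad \<psi> x \<bullet> i)))
    = (LBINT x. ((\<phi> x * p x) *\<^sub>R grad \<psi> x) \<bullet> i)"
    using c K by (subst integral_lebesgue_on_compact_support(1)[OF S _ K(1,2)])
      (auto intro!: continuous_intros simp: ac_simps)
  also have "\<dots> = (LBINT x. (\<phi> x * p x) *\<^sub>R grad \<psi> x) \<bullet> i"
    using cf c L by (intro integral_inner_left integrable_compact_support[OF _ L(1)])
      (auto intro!: continuous_intros)
  also have "\<dots> = - ((LBINT x. \<psi> x *\<^sub>R (\<phi> x *\<^sub>R p' x + p x *\<^sub>R grad \<phi> x)) \<bullet> i)"
    by (subst integral_by_parts_has_grad[OF f h L(1,3)]) auto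
  also have "(LBINT x. \<psi> x *\<^sub>R (\<phi> x *\<^sub>R p' x + p x *\<^sub>R grad \<phi> x)) \<bullet> i
    = (LBINT x. (\<psi> x *\<^sub>R (\<phi> x *\<^sub>R p' x + p x *\<^sub>R grad \<phi> x)) \<bullet> i)"
    using cf c L by (intro integral_inner_left[symmetric] integrable_compact_support[OF _ L(1)])
      (auto intro!: continuous_intros)
  also have "\<dots> = (LBINT x. a x + b x)"
    by (simp add: a_def b_def inner_add_left distrib_left)
  also have "\<dots> = (LINT x|lebesgue_on S. a x + b x)"
    using c L unfolding a_def b_def
    by (intro integral_lebesgue_on_compact_support(1)[OF S _ L(1,2), symmetric])
      (auto intro!: continuous_intros)
  also have "\<dots> = (LINT x|lebesgue_on S. a x) + (LINT x|lebesgue_on S. b x)"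
    using A(1) B(1) by simp
  finally have "\<bar>LINT x|lebesgue_on S. \<phi> x * (p x * (grad \<psi> x \<bullet> i))\<bar>
    \<le> \<bar>LINT x|lebesgue_on S. a x\<bar> + \<bar>LINT x|lebesgue_on S. b x\<bar>" by linarith
  also have "\<dots> \<le> \<bar>C\<bar> * (L2_norm S \<phi> * L2_norm S \<psi>)
    + \<bar>C\<bar> * (L2_norm S (grad \<phi>) * L2_norm S \<psi>)"
    using A(2) B(2) by (intro add_mono)
  finally show ?thesis using C(3) by (simp add: algebra_simps)
qed

text \<open>With a polynomial field \<open>r\<close>, the error \<open>D = G - r\<close> and the
  average \<open>m\<close> of \<phi>, the product of \<phi> and \<open>G\<close> is
  \<open>(\<phi> - m) D + m D + \<phi> r\<close>. The first two terms are small by different means,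
  sup bound of \<open>D\<close> and L2 norm of \<open>D\<close>; only the third, the smooth one,
  contributes to \<open>C\<close>.\<close>

lemma bounded_coefficient_estimate_test:
  fixes G :: "'a::euclidean_space \<Rightarrow> 'a"
  assumes S: "S \<in> sets lebesgue" "bounded S" and G: "G \<in> borel_measurable (lebesgue_on S)"
    and M: "AE x in lebesgue_on S. norm (G x) \<le> M" "0 \<le> M" and \<epsilon>: "0 < \<epsilon>"
  shows "\<exists>C\<ge>0. \<forall>\<phi> \<psi>. test_function S \<phi>
    \<longrightarrow> test_function S \<psi> \<longrightarrow>
    \<bar>LINT x|lebesgue_on S. \<phi> x * (G x \<bullet> grad \<psi> x)\<bar>
    \<le> (L2_norm S \<phi> + L2_norm S (grad \<phi>)) * (\<epsilon> * L2_norm S (grad \<psi>) + C * L2_norm S \<psi>)"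
proof -
  \<comment> \<open>A sup bound for the error: \<open>M\<close> for \<open>G\<close> plus
    \<open>M + 1\<close> for every approximant. It does not depend on \<open>n\<close>, so \<delta>
    can be fixed before \<open>n\<close>.\<close>
  define M1 where "M1 = 2 * M + 1"
  \<comment> \<open>Makes the term with \<open>\<phi> - m\<close> at most \<epsilon>/2 times the
    product of the gradient norms.\<close>
  define \<delta> where "\<delta> = \<epsilon> / (2 * M1)"
  have M1: "0 < M1" using M(2) by (simp add: M1_def)
  then have \<delta>: "0 < \<delta>" "M1 * \<delta> = \<epsilon> / 2"
    using \<epsilon> by (simp_all add: \<delta>_def)
  \<comment> \<open>The factor in the sup bound for averages. It grows as \<delta> shrinks, which
    the later choice of \<open>n\<close> compensates.\<close>
  define C0 where "C0 = 1 / sqrt (measure lborel (cball (0::'a) \<delta>))"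
  have C0: "0 \<le> C0" by (simp add: C0_def)
  obtain q :: "nat \<Rightarrow> 'a \<Rightarrow> 'a" where q: "\<And>n. polynomial_function (q n)"
    "\<And>n x. x \<in> S \<Longrightarrow> norm (q n x)
      \<le> M + 1" "AE x in lebesgue_on S. (\<lambda>n. q n x) \<longlonglongrightarrow> G x"
    by (rule bounded_measurable_polynomial_approximation[OF S G M]) (rule that; simp)
  have qm: "q n \<in> borel_measurable (lebesgue_on S)" for n
    by (rule continuous_imp_measurable_lebesgue_on[OF continuous_on_polymonial_function[OF q(1)]])
  have Dm: "(\<lambda>x. G x - q n x) \<in> borel_measurable (lebesgue_on S)" for n
    using G qm by (rule borel_measurable_diff)
  have Db: "AE x in lebesgue_on S. norm (G x - q n x) \<le> M1" for n
    using M(1) AE_space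
  proof eventually_elim
    case (elim x)
    then have "norm (G x) \<le> M" "norm (q n x) \<le> M + 1" using q(2) by auto
    then show ?case using norm_triangle_ineq4[of "G x" "q n x"] by (simp add: M1_def)
  qed
  have DL2: "(\<lambda>x. G x - q n x) \<in> L2 S" for n
    using bounded_measurable_L2[OF S Dm Db] M1 by simp
  have "(\<lambda>n. LINT x|lebesgue_on S. (norm (G x - q n x))^2) \<longlonglongrightarrow> (LINT x|lebesgue_on S. 0)"
  proof (rule integral_dominated_convergence[where w = "\<lambda>x. (norm M1)^2"])
    show "integrable (lebesgue_on S) (\<lambda>x. (norm M1)^2)"
      using L2_const[OF S, of M1] unfolding L2_def by blast
    show "AE x in lebesgue_on S. (\<lambda>n. (norm (G x - q n x))^2) \<longlonglongrightarrow> 0"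
      using q(3)
    proof eventually_elim
      case (elim x)
      then have "(\<lambda>n. (norm (G x - q n x))^2) \<longlonglongrightarrow> (norm (G x - G x))^2" by (intro tendsto_intros)
      then show ?case by simp
    qed
    show "AE x in lebesgue_on S. norm ((norm (G x - q n x))^2) \<le> (norm M1)^2" for n
      using Db[of n] by eventually_elim (use M1 in \<open>simp add: power_mono\<close>)
    show "(\<lambda>x. (norm (G x - q n x))^2) \<in> borel_measurable (lebesgue_on S)" for n
      by (rule borel_measurable_power[OF measurable_compose[OF Dm borel_measurable_norm]])
  qed simp
  then have "(\<lambda>n. L2_norm S (\<lambda>x. G x - q n x)) \<longlonglongrightarrow> sqrt 0"
    unfolding L2_norm_def by (intro tendsto_real_sqrt) simp
  then have "(\<lambda>n. C0 * L2_norm S (\<lambda>x. G x - q n x)) \<longlonglongrightarrow> C0 * 0"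
    by (intro tendsto_mult_left) simp
  then have "\<forall>\<^sub>F n in sequentially. C0 * L2_norm S (\<lambda>x. G x - q n x) < \<epsilon> / 2"
    using \<epsilon> by (intro order_tendstoD(2)) auto
  then obtain n where n: "C0 * L2_norm S (\<lambda>x. G x - q n x) \<le> \<epsilon> / 2"
    using eventually_happens'[OF sequentially_bot] less_imp_le by blast
  define r where "r = q n"
  define D where "D x = G x - r x" for x
  have D: "D \<in> borel_measurable (lebesgue_on S)" "AE x in lebesgue_on S. norm (D x) \<le> M1" "D \<in> L2 S"
    "C0 * L2_norm S D \<le> \<epsilon> / 2"
    using Dm[of n] Db[of n] DL2[of n] n unfolding D_def r_def by auto
  have rp: "real_polynomial_function (\<lambda>x. r x \<bullet> i)" for i
    using polynomial_function_inner[OF q(1)[of n], of i]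
    by (simp add: r_def real_polynomial_function_eq)
  note rg = polynomial_has_grad[OF rp]
  have "\<exists>C\<ge>0. \<forall>x\<in>S. \<bar>r x \<bullet> i\<bar>
    \<le> C \<and> norm (grad (\<lambda>x. r x \<bullet> i) x) \<le> C" for i
  proof -
    have cl: "compact (closure S)" using S(2) by simp
    obtain A where "0 \<le> A" "\<And>x. x \<in> closure S \<Longrightarrow> norm (r x \<bullet> i) \<le> A"
      using compact_continuous_bound[OF has_grad_continuous(1)[OF rg[of i]] cl] by metis
    moreover obtain B where "0 \<le> B" "\<And>x. x \<in> closure S
      \<Longrightarrow> norm (grad (\<lambda>x. r x \<bullet> i) x) \<le> B"
      using compact_continuous_bound[OF has_grad_continuous(2)[OF rg[of i]] cl] by metis
    ultimately show ?thesis
      using closure_subset[of S] by (intro exI[of _ "max A B"]) (auto simp: le_max_iff_disj)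
  qed
  then obtain Ci where Ci: "\<And>i. 0 \<le> Ci i" "\<And>i x. x \<in> S \<Longrightarrow> \<bar>r x \<bullet> i\<bar> \<le> Ci i"
    "\<And>i x. x \<in> S \<Longrightarrow> norm (grad (\<lambda>x. r x \<bullet> i) x) \<le> Ci i" by metis
  \<comment> \<open>Depends on the chosen polynomial field, hence on \<epsilon>, but on neither
    \<phi> nor \<psi>.\<close>
  define C where "C = (\<Sum>i\<in>Basis. Ci i)"
  show ?thesis
  proof (intro exI[of _ C] conjI allI impI)
    show "0 \<le> C" unfolding C_def using Ci(1) by (intro sum_nonneg)
    fix \<phi> \<psi> :: "'a \<Rightarrow> real" assume \<phi>: "test_function S \<phi>" and \<psi>: "test_function S \<psi>"
    let ?g = "grad \<phi>" and ?h = "grad \<psi>"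
    note g = test_function_has_grad[OF \<phi>] and h = test_function_has_grad[OF \<psi>]
    note K = test_function_supp[OF \<phi>]
    note L = test_function_supp[OF \<psi>]
    note c = has_grad_continuous[OF g, of UNIV] has_grad_continuous[OF h, of UNIV]
    have hL2: "?h \<in> L2 S" using L2_compact_support(1)[OF S(1) c(4) L(1,2,4)] .
    define m where "m = average \<delta> \<phi>"
    have m: "(\<lambda>x. \<phi> x - m x) \<in> L2 S" "\<And>x. \<bar>m x\<bar> \<le> C0 * L2_norm S \<phi>"
      "L2_norm S (\<lambda>x. \<phi> x - m x) \<le> \<delta> * L2_norm S ?g"
      using average_estimate_L2[OF \<delta>(1) S(1) \<phi>] by (simp_all add: m_def C0_def)
    have \<phi>m: "\<phi> \<in> borel_measurable (lebesgue_on S)" "?h \<in> borel_measurable (lebesgue_on S)"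
      using c by (auto intro: continuous_imp_measurable_lebesgue_on)
    have mm: "m \<in> borel_measurable (lebesgue_on S)"
      using borel_measurable_diff[OF \<phi>m(1) L2_measurable[OF m(1)]] by simp
    have Dh: "\<bar>D x \<bullet> ?h x\<bar> \<le> norm (D x) * norm (?h x)" for x
      by (rule Cauchy_Schwarz_ineq2)
    note 1 = L2_product_field[OF D(1,2) m(1) hL2]
    have 2: "AE x in lebesgue_on S. \<bar>m x * (D x \<bullet> ?h x)\<bar>
      \<le> C0 * L2_norm S \<phi> * (norm (D x) * norm (?h x))"
    proof (rule AE_I2)
      show "\<bar>m x * (D x \<bullet> ?h x)\<bar> \<le> C0 * L2_norm S \<phi> * (norm (D x) * norm (?h x))" for x
        unfolding abs_mult by (rule mult_mono[OF m(2) Dh]) (auto simp: C0 L2_norm_nonneg)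
    qed
    have "(\<lambda>x. m x * (D x \<bullet> ?h x)) \<in> borel_measurable (lebesgue_on S)"
      by (intro borel_measurable_times borel_measurable_inner \<phi>m mm D(1))
    note 2 = L2_product[OF D(3) hL2 this 2]
    have 3: "\<bar>LINT x|lebesgue_on S. \<phi> x * ((r x \<bullet> i) * (?h x \<bullet> i))\<bar>
      \<le> Ci i * (L2_norm S \<phi> + L2_norm S ?g) * L2_norm S \<psi>" if "i \<in> Basis" for i
      by (rule smooth_coefficient_estimate[OF S(1) rg Ci(2,3,1) that \<phi> \<psi>])
    have i3: "integrable (lebesgue_on S) (\<lambda>x. \<phi> x * ((r x \<bullet> i) * (?h x \<bullet> i)))" for i
    proof (rule integral_lebesgue_on_compact_support(2)[OF S(1) _ K(1,2)])
      show "continuous_on UNIV (\<lambda>x. \<phi> x * ((r x \<bullet> i) * (?h x \<bullet> i)))"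
        by (rule continuous_on_mult[OF c(1) continuous_on_mult[OF has_grad_continuous(1)[OF rg]
              continuous_on_inner[OF c(4) continuous_on_const]]])
      show "\<phi> x * ((r x \<bullet> i) * (?h x \<bullet> i)) = 0" if "x \<notin> supp \<phi>" for x
        using K(3)[OF that] by simp
    qed
    let ?I = "LINT x|lebesgue_on S. \<phi> x * (G x \<bullet> ?h x)"
    let ?I1 = "LINT x|lebesgue_on S. (\<phi> x - m x) * (D x \<bullet> ?h x)"
    let ?I2 = "LINT x|lebesgue_on S. m x * (D x \<bullet> ?h x)"
    let ?I3 = "\<Sum>i\<in>Basis. LINT x|lebesgue_on S. \<phi> x * ((r x \<bullet> i) * (?h x \<bullet> i))"
    let ?a = "L2_norm S \<phi>" and ?b = "L2_norm S ?g" and ?c = "L2_norm S ?h" and ?d = "L2_norm S \<psi>"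
    \<comment> \<open>The three-term splitting, with the smooth term written in components so that
      integration by parts applies to each.\<close>
    have "?I
      = (LINT x|lebesgue_on S. (\<phi> x - m x) * (D x \<bullet> ?h x) + m x * (D x \<bullet> ?h x)
          + (\<Sum>i\<in>Basis. \<phi> x * ((r x \<bullet> i) * (?h x \<bullet> i))))"
    proof (intro Bochner_Integration.integral_cong refl)
      fix x
      have "(\<Sum>i\<in>Basis. \<phi> x * ((r x \<bullet> i) * (?h x \<bullet> i))) = \<phi> x * (r x \<bullet> ?h x)"
        by (subst euclidean_inner) (simp only: sum_distrib_left)
      then show "\<phi> x * (G x \<bullet> ?h x) = (\<phi> x - m x) * (D x \<bullet> ?h x) + m x * (D x \<bullet> ?h x)
          + (\<Sum>i\<in>Basis. \<phi> x * ((r x \<bullet> i) * (?h x \<bullet> i)))"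
        by (simp only: D_def inner_diff_left) (simp add: algebra_simps)
    qed
    also have "\<dots> = ?I1
        + ?I2
        + ?I3"
      using 1(1) 2(1) i3 by (simp del: Bochner_Integration.integral_mult_right_zero)
    finally have "\<bar>?I\<bar>
      \<le> \<bar>?I1\<bar>
        + \<bar>?I2\<bar>
        + \<bar>?I3\<bar>" by linarith
    also have "\<dots> \<le> \<epsilon> / 2 * (?b * ?c) + \<epsilon> / 2 * (?a * ?c)
        + (\<Sum>i\<in>Basis. Ci i * (?a + ?b) * ?d)"
    proof (intro add_mono)
      have "M1 * (L2_norm S (\<lambda>x. \<phi> x - m x) * ?c) \<le> M1 * ((\<delta> * ?b) * ?c)"
        using m(3) M1 by (intro mult_left_mono mult_right_mono) (auto simp: L2_norm_nonneg)
      also have "\<dots> = \<epsilon> / 2 * (?b * ?c)" using \<delta>(2) by simp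
      finally show "\<bar>?I1\<bar> \<le> \<epsilon> / 2 * (?b * ?c)"
        using 1(2) M1 by simp
      have "C0 * ?a * (L2_norm S D * ?c) = (C0 * L2_norm S D) * (?a * ?c)"
        by simp
      also have "\<dots> \<le> \<epsilon> / 2 * (?a * ?c)"
        using D(4) by (intro mult_right_mono) (auto simp: L2_norm_nonneg)
      finally show "\<bar>?I2\<bar> \<le> \<epsilon> / 2 * (?a * ?c)"
        using 2(2) C0 by (simp add: L2_norm_nonneg)
      show "\<bar>?I3\<bar>
        \<le> (\<Sum>i\<in>Basis. Ci i * (?a + ?b) * ?d)"
        using 3 by (intro order_trans[OF sum_abs] sum_mono)
    qed
    also have "\<dots> = \<epsilon> / 2 * ((?a + ?b) * ?c)
        + C * (?a + ?b) * ?d"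
    proof -
      have "(\<Sum>i\<in>Basis. Ci i * (?a + ?b) * ?d)
        = C * (?a + ?b) * ?d"
        by (simp only: C_def sum_distrib_right)
      then show ?thesis by (simp only: distrib_right distrib_left)
    qed
    also have "\<dots> \<le> \<epsilon> * ((?a + ?b) * ?c)
        + C * (?a + ?b) * ?d"
      using \<epsilon> by (intro add_right_mono mult_right_mono) (auto simp: L2_norm_nonneg)
    also have "\<dots> = (?a + ?b) * (\<epsilon> * ?c + C * ?d)"
      by (simp add: algebra_simps)
    finally show "\<bar>?I\<bar>
      \<le> (?a + ?b) * (\<epsilon> * ?c + C * ?d)" .
  qed
qed

lemma L2_norm_minus_commute:
  fixes f g :: "'a::euclidean_space \<Rightarrow> 'b::euclidean_space"
  shows "L2_norm S (\<lambda>x. f x - g x) = L2_norm S (\<lambda>x. g x - f x)"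
  by (simp add: L2_norm_def norm_minus_commute)

lemma L2_diff:
  fixes f g :: "'a::euclidean_space \<Rightarrow> 'b::euclidean_space"
  assumes "f \<in> L2 S" "g \<in> L2 S"
  shows "(\<lambda>x. f x - g x) \<in> L2 S"
  using L2_add(1)[OF assms(1) L2_scaleR(1)[OF assms(2), of "-1"]] by simp

lemma L2_norm_tendsto:
  fixes f :: "'a::euclidean_space \<Rightarrow> 'b::euclidean_space"
  assumes f: "f \<in> L2 S" and g: "\<And>n. g n \<in> L2 S"
    and lim: "(\<lambda>n. L2_norm S (\<lambda>x. f x - g n x)) \<longlonglongrightarrow> 0"
  shows "(\<lambda>n. L2_norm S (g n)) \<longlonglongrightarrow> L2_norm S f"
proof -
  have tri: "L2_norm S p \<le> L2_norm S q + L2_norm S (\<lambda>x. p x - q x)"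
    if "p \<in> L2 S" "q \<in> L2 S" for p q :: "'a \<Rightarrow> 'b"
    using L2_add(2)[OF that(2) L2_diff[OF that]] by simp
  have "(\<lambda>n. L2_norm S (g n) - L2_norm S f) \<longlonglongrightarrow> 0"
  proof (rule Lim_null_comparison[OF always_eventually lim], rule allI)
    fix n
    show "norm (L2_norm S (g n) - L2_norm S f) \<le> L2_norm S (\<lambda>x. f x - g n x)"
      using tri[OF f g[of n]] tri[OF g[of n] f] by (simp add: L2_norm_minus_commute[of S "g n" f] abs_le_iff)
  qed
  then show ?thesis by (rule Lim_null[THEN iffD2])
qed

text \<open>Both sides are continuous in the H1 norm and \<open>C\<close> does not depend on the
  functions, so the bound extends from test functions to their closure.\<close>

lemma bounded_coefficient_estimate:
  fixes G :: "'a::euclidean_space \<Rightarrow> 'a"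
  assumes S: "open S" "bounded S" and G: "G \<in> borel_measurable (lebesgue_on S)"
    and M: "AE x in lebesgue_on S. norm (G x) \<le> M" "0 \<le> M" and \<epsilon>: "0 < \<epsilon>"
  shows "\<exists>C\<ge>0. \<forall>v\<in>H10 S. \<forall>\<psi>\<in>H10 S.
    \<bar>LINT x|lebesgue_on S. v x * (G x \<bullet> wgrad S \<psi> x)\<bar>
    \<le> (L2_norm S v + L2_norm S (wgrad S v)) * (\<epsilon> * L2_norm S (wgrad S \<psi>) + C * L2_norm S \<psi>)"
proof -
  have Sl: "S \<in> sets lebesgue" using S(1) by (rule open_imp_lebesgue)
  obtain C where C: "0 \<le> C" "\<forall>\<phi> \<psi>. test_function S \<phi>
    \<longrightarrow> test_function S \<psi> \<longrightarrow>
    \<bar>LINT x|lebesgue_on S. \<phi> x * (G x \<bullet> grad \<psi> x)\<bar>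
    \<le> (L2_norm S \<phi> + L2_norm S (grad \<phi>)) * (\<epsilon> * L2_norm S (grad \<psi>) + C * L2_norm S \<psi>)"
    using bounded_coefficient_estimate_test[OF Sl S(2) G M \<epsilon>] by (elim exE conjE)
  show ?thesis
  proof (intro exI[of _ C] conjI ballI C(1))
    fix v \<psi> assume v: "v \<in> H10 S" and \<psi>: "\<psi> \<in> H10 S"
    obtain p where p: "\<And>n. test_function S (p n)" "(\<lambda>n. L2_norm S (\<lambda>x. v x - p n x))
      \<longlonglongrightarrow> 0"
      "(\<lambda>n. L2_norm S (\<lambda>x. wgrad S v x - grad (p n) x)) \<longlonglongrightarrow> 0"
      using H10_approx[OF S(1) v] by metis
    obtain q where q: "\<And>n. test_function S (q n)" "(\<lambda>n. L2_norm S (\<lambda>x. \<psi> x - q n x))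
      \<longlonglongrightarrow> 0"
      "(\<lambda>n. L2_norm S (\<lambda>x. wgrad S \<psi> x - grad (q n) x)) \<longlonglongrightarrow> 0"
      using H10_approx[OF S(1) \<psi>] by metis
    note V = H1D[OF S(1) H10_H1[OF v]] and W = H1D[OF S(1) H10_H1[OF \<psi>]]
    note P = test_function_L2[OF S(1) p(1)] and Q = test_function_L2[OF S(1) q(1)]
    note prod = L2_product_field[OF G M(1)]
    note lims = L2_norm_tendsto[OF V(1) P(1) p(2)] L2_norm_tendsto[OF V(2) P(2) p(3)]
      L2_norm_tendsto[OF W(1) Q(1) q(2)] L2_norm_tendsto[OF W(2) Q(2) q(3)]
    define I where "I = (LINT x|lebesgue_on S. v x * (G x \<bullet> wgrad S \<psi> x))"
    define J where "J n = (LINT x|lebesgue_on S. p n x * (G x \<bullet> grad (q n) x))" for n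
    \<comment> \<open>The cost of replacing first \<open>v\<close> and then \<psi> by test
      functions; each summand has one factor tending to 0 and one that converges.\<close>
    define e where "e n = \<bar>M\<bar> * (L2_norm S (\<lambda>x. v x - p n x) * L2_norm S (grad (q n)))
      + \<bar>M\<bar> * (L2_norm S v * L2_norm S (\<lambda>x. wgrad S \<psi> x - grad (q n) x))" for n
    have e: "e \<longlonglongrightarrow> \<bar>M\<bar> * (0 * L2_norm S (wgrad S \<psi>)) + \<bar>M\<bar> * (L2_norm S v * 0)"
      unfolding e_def by (intro tendsto_intros p q lims)
    have d: "\<bar>I\<bar> \<le> e n + (L2_norm S (p n) + L2_norm S (grad (p n)))
        * (\<epsilon> * L2_norm S (grad (q n)) + C * L2_norm S (q n))" for n
    proof -
      note a = prod[OF L2_diff[OF V(1) P(1)[of n]] Q(2)[of n]]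
      note b = prod[OF V(1) L2_diff[OF W(2) Q(2)[of n]]]
      note c = prod(1)[OF P(1)[of n] Q(2)[of n]]
      have "I = (LINT x|lebesgue_on S. (v x - p n x) * (G x \<bullet> grad (q n) x)
          + v x * (G x \<bullet> (wgrad S \<psi> x - grad (q n) x))
          + p n x * (G x \<bullet> grad (q n) x))"
        unfolding I_def by (intro Bochner_Integration.integral_cong refl)
          (simp add: inner_diff_right algebra_simps)
      also have "\<dots> = (LINT x|lebesgue_on S. (v x - p n x) * (G x \<bullet> grad (q n) x))
          + (LINT x|lebesgue_on S. v x * (G x \<bullet> (wgrad S \<psi> x - grad (q n) x))) + J n"
        unfolding J_def using a(1) b(1) c by simp
      finally have "\<bar>I\<bar> \<le> e n + \<bar>J n\<bar>"
        unfolding e_def using a(2) b(2) by linarith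
      also have "\<bar>J n\<bar> \<le> (L2_norm S (p n) + L2_norm S (grad (p n)))
        * (\<epsilon> * L2_norm S (grad (q n)) + C * L2_norm S (q n))"
        unfolding J_def using C(2) p(1) q(1) by blast
      finally show ?thesis by simp
    qed
    have "(\<lambda>n. e n + (L2_norm S (p n) + L2_norm S (grad (p n)))
        * (\<epsilon> * L2_norm S (grad (q n)) + C * L2_norm S (q n)))
      \<longlonglongrightarrow> (\<bar>M\<bar> * (0 * L2_norm S (wgrad S \<psi>)) + \<bar>M\<bar> * (L2_norm S v * 0))
        + (L2_norm S v + L2_norm S (wgrad S v)) * (\<epsilon> * L2_norm S (wgrad S \<psi>) + C * L2_norm S \<psi>)"
      by (intro tendsto_intros e lims)
    from LIMSEQ_le_const[OF this] d
    show "\<bar>LINT x|lebesgue_on S. v x * (G x \<bullet> wgrad S \<psi> x)\<bar>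
      \<le> (L2_norm S v + L2_norm S (wgrad S v)) * (\<epsilon> * L2_norm S (wgrad S \<psi>) + C * L2_norm S \<psi>)"
      unfolding I_def by simp
  qed
qed

section \<open>Functions with bounded second weak derivative\<close>

lemma has_real_derivative_classical_grad:
  fixes F :: "real \<Rightarrow> real"
  assumes "(F has_real_derivative f) (at x)"
  shows "frechet_derivative F (at x) = (*) f" "grad F x = f"
  using frechet_derivative_at_eqI[of F _ x] assms
  by (auto simp: has_field_derivative_def classical_grad_def)

text \<open>A mollifier of mass one with radius \<open>r\<close> and centre \<open>t\<close>. It
  depends only on \<open>x - t\<close>, so differentiating in the centre is minus differentiating in
  \<open>x\<close>.\<close>

definition bump :: "real \<Rightarrow> real \<Rightarrow> real \<Rightarrow> real" where
  "bump r t x = ball_bump 1 t r x / (LBINT y. ball_bump 1 (0::real) r y)"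

lemma integrable_test_function:
  assumes "test_function S \<phi>" "continuous_on UNIV f"
  shows "integrable lborel (\<lambda>x. f x * \<phi> x :: real)"
proof -
  obtain K where "compact K" "\<And>x. x \<notin> K \<Longrightarrow> \<phi> x = 0"
    using test_function_supp[OF assms(1)] by metis
  then show ?thesis
    using assms(2) test_function_continuous[OF assms(1)]
    by (intro integrable_compact_support[of _ K]) (auto intro: continuous_on_mult)
qed

lemma bump_props:
  assumes r: "0 < r"
  shows "test_function UNIV (bump r t)" "0 \<le> bump r t x" "x \<notin> {t - r..t + r} \<Longrightarrow> bump r t x = 0"
    "(LBINT x. bump r t x) = 1"
proof -
  define I where "I = (LBINT y. ball_bump 1 (0::real) r y)"
  have test: "test_function UNIV (\<lambda>x. a * ball_bump 1 t r x)" for a and t :: real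
    using r by (intro test_function_polynomial_bump real_polynomial_function.intros(2)) auto
  have nn: "0 \<le> ball_bump 1 t r y" for t y :: real by (simp add: ball_bump_def flat_nonneg)
  show "test_function UNIV (bump r t)"
    using test[of "1 / I" t] by (simp add: bump_def[abs_def] I_def)
  have I0: "0 \<le> I" unfolding I_def by (intro Bochner_Integration.integral_nonneg nn)
  have ii: "integrable lborel (ball_bump 1 t r)" for t :: real
    using integrable_test_function[OF test[of 1 t] continuous_on_const, of 1] by simp
  have "I \<noteq> 0"
  proof
    assume "I = 0"
    then have "AE y in lborel. ball_bump 1 (0::real) r y = 0"
      unfolding I_def using integral_nonneg_eq_0_iff_AE[OF ii] nn by simp
    then have "AE y in lborel. y \<notin> {-r<..<r}"
    proof eventually_elim
      case (elim y)
      then have "\<not> 0 < r^2 - y^2"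
        using flat_pos_iff[of 0 "r^2 - y^2"] by (simp add: ball_bump_def power2_eq_square)
      then have "\<not> \<bar>y\<bar> < r" using power_strict_mono[of "\<bar>y\<bar>" r 2] by auto
      then show ?case by auto
    qed
    then have "{-r<..<r} \<in> null_sets lborel" by (subst AE_iff_null_sets) auto
    then have "emeasure lborel {-r<..<r} = 0" by blast
    then show False using r by simp
  qed
  then have I: "0 < I" using I0 by simp
  show "0 \<le> bump r t x" using I0 nn[of t x] by (simp add: bump_def I_def)
  show "bump r t x = 0" if "x \<notin> {t - r..t + r}"
    using ball_bump_eq_0[of 1 r x t] that r by (auto simp: bump_def dist_real_def)
  have "(LBINT x. bump r t x) = (LBINT x. ball_bump 1 t r x) / I"
    by (simp add: bump_def I_def)
  also have "(LBINT x. ball_bump 1 t r x) = I"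
  proof -
    have "ball_bump 1 t r (t + x) = ball_bump 1 0 r x" for x by (simp add: ball_bump_def)
    then show ?thesis unfolding I_def using lborel_translate(2)[OF ii, of t t] by simp
  qed
  finally show "(LBINT x. bump r t x) = 1" using I by simp
qed

lemma mean_value_between:
  fixes b :: "real \<Rightarrow> real"
  assumes "\<And>t. (b has_real_derivative b' t) (at t)"
  shows "\<exists>\<xi>. min x y \<le> \<xi> \<and> \<xi> \<le> max x y \<and> b x - b y = b' \<xi> * (x - y)"
proof -
  consider "x = y" | "x < y" | "y < x" by linarith
  then show ?thesis
  proof cases
    case 2
    obtain z where "x < z" "z < y" "b y - b x = (y - x) * b' z"
      using MVT2[OF 2, of b b'] assms by auto
    then show ?thesis by (intro exI[of _ z]) (auto simp: algebra_simps)
  next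
    case 3
    obtain z where "y < z" "z < x" "b x - b y = (x - y) * b' z"
      using MVT2[OF 3, of b b'] assms by auto
    then show ?thesis by (intro exI[of _ z]) (auto simp: algebra_simps)
  qed auto
qed

text \<open>Differentiation under the integral puts minus the x-derivative of the kernel next to
  \<open>v\<close>. Since \<open>bump r t\<close> is itself a test function, the definition of the
  weak gradient turns this into the mean of \<open>k\<close>.\<close>

lemma weak_gradient_convolution:
  fixes v k :: "real \<Rightarrow> real"
  assumes vk: "has_weak_grad UNIV v k" and r: "0 < r"
  shows "((\<lambda>t. LINT x|lebesgue. bump r t x * v x) has_real_derivative (LINT x|lebesgue. bump r t x * k x)) (at t)"
proof -
  define \<beta> where "\<beta> = grad (bump r 0)"
  note test = bump_props(1)[OF r]
  have shift: "bump r s x = bump r 0 (x - s)" for s x by (simp add: bump_def ball_bump_def)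
  have D0: "(bump r 0 has_real_derivative \<beta> y) (at y)" for y
    using test_function_has_grad[OF test[of 0]]
    by (simp add: has_grad_def \<beta>_def has_field_derivative_def inner_real_def)
  have grad: "grad (bump r t) x = \<beta> (x - t)" for x
  proof (rule has_real_derivative_classical_grad(2))
    have "((\<lambda>x. x - t) has_real_derivative 1) (at x)" by (auto intro!: derivative_eq_intros)
    from DERIV_chain2[where f = "bump r 0", OF D0 this]
    show "(bump r t has_real_derivative \<beta> (x - t)) (at x)" by (simp flip: shift)
  qed
  have Ds: "((\<lambda>s. bump r s x) has_real_derivative - \<beta> (x - s)) (at s)" for s x
  proof -
    have "((\<lambda>s. x - s) has_real_derivative - 1) (at s)" by (auto intro!: derivative_eq_intros)
    from DERIV_chain2[where f = "bump r 0", OF D0 this] show ?thesis by (simp flip: shift)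
  qed
  obtain C where C: "0 \<le> C" "\<And>y. \<bar>\<beta> y\<bar> \<le> C"
  proof -
    obtain K where K: "compact K" "\<And>x. x \<notin> K \<Longrightarrow> \<beta> x = 0"
      using test_function_supp[OF test[of 0]] unfolding \<beta>_def by metis
    obtain C where "0 \<le> C" "\<And>x. x \<in> K \<Longrightarrow> norm (\<beta> x) \<le> C"
      using compact_continuous_bound[OF has_grad_continuous(2)[OF test_function_has_grad[OF test[of 0]]] K(1)]
      unfolding \<beta>_def by metis
    then show thesis using K(2) by (intro that[of C]) (metis norm_zero real_norm_def)+
  qed
  have l: "locally_integrable UNIV v" using vk by (simp add: has_weak_grad_def)
  have vi: "integrable lebesgue (\<lambda>x. bump r s x * v x)" for s
    using integrable_test_function_scaleR[OF _ l test] by (simp add: lebesgue_on_UNIV_eq)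
  have "(LINT x|lebesgue_on UNIV. v x *\<^sub>R grad (bump r t) x) = - (LINT x|lebesgue_on UNIV. bump r t x *\<^sub>R k x)"
    using vk test unfolding has_weak_grad_def by blast
  then have eq: "(LINT x|lebesgue. - \<beta> (x - t) * v x) = (LINT x|lebesgue. bump r t x * k x)"
    by (simp add: lebesgue_on_UNIV_eq grad mult.commute)
  show ?thesis
    unfolding DERIV_def tendsto_at_iff_sequentially eq[symmetric]
  proof (intro allI impI)
    fix X :: "nat \<Rightarrow> real" assume X: "\<forall>n. X n \<in> UNIV - {0}" "X \<longlonglongrightarrow> 0"
    obtain Q where Q: "\<And>n. \<bar>X n\<bar> \<le> Q"
      using convergent_imp_Bseq[OF convergentI[OF X(2)]] unfolding Bseq_def real_norm_def by blast
    define d where "d n x = (bump r (t + X n) x - bump r t x) / X n" for n x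
    \<comment> \<open>Contains the supports of all shifted kernels at once, so local integrability
      of \<open>v\<close> provides a dominating function.\<close>
    let ?K = "{t - Q - r..t + Q + r}"
    have dC: "\<bar>d n x\<bar> \<le> C * indicator ?K x" for n x
    proof (cases "x \<in> ?K")
      case True
      obtain z where "bump r (t + X n) x - bump r t x = - \<beta> (x - z) * (t + X n - t)"
        using mean_value_between[of "\<lambda>s. bump r s x" "\<lambda>s. - \<beta> (x - s)" "t + X n" t] Ds by blast
      then have "d n x = - \<beta> (x - z)" using X(1) by (simp add: d_def)
      then show ?thesis using C(2) True by simp
    next
      case False
      then have "x \<notin> {t - r..t + r}" "x \<notin> {t + X n - r..t + X n + r}"
        using Q[of n] by auto
      then show ?thesis using False bump_props(3)[OF r] by (simp add: d_def)
    qed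
    have "(\<lambda>n. LINT x|lebesgue. d n x * v x) \<longlonglongrightarrow> (LINT x|lebesgue. - \<beta> (x - t) * v x)"
    proof (rule integral_dominated_convergence[where w = "\<lambda>x. C * (indicator ?K x * \<bar>v x\<bar>)"])
      have vK: "integrable (lebesgue_on ?K) v"
        using l unfolding locally_integrable_def by (meson compact_Icc subset_UNIV)
      have "integrable lebesgue (\<lambda>x. indicator ?K x *\<^sub>R \<bar>v x\<bar>)"
        using integrable_abs[OF vK] by (subst (asm) integrable_restrict_space) auto
      from integrable_mult_right[OF this[simplified]]
      show "integrable lebesgue (\<lambda>x. C * (indicator ?K x * \<bar>v x\<bar>))" .
      have "(\<lambda>n. d n x) \<longlonglongrightarrow> - \<beta> (x - t)" for x
        using Ds[of x t] X unfolding DERIV_def tendsto_at_iff_sequentially by (simp add: d_def o_def)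
      then show "AE x in lebesgue. (\<lambda>n. d n x * v x) \<longlonglongrightarrow> - \<beta> (x - t) * v x"
        by (intro AE_I2 tendsto_mult_right)
      show "AE x in lebesgue. norm (d n x * v x) \<le> C * (indicator ?K x * \<bar>v x\<bar>)" for n
        using mult_right_mono[OF dC abs_ge_zero] by (intro AE_I2) (simp add: abs_mult mult.assoc)
      show dm: "(\<lambda>x. d n x * v x) \<in> borel_measurable lebesgue" for n
        using vi[of "t + X n"] vi[of t] by (simp add: d_def left_diff_distrib borel_measurable_diff)
      have "(\<lambda>x. v x *\<^sub>R grad (bump r t) x) \<in> borel_measurable lebesgue"
        using integrable_scaleR_classical_grad[OF _ l test[of t]]
        by (simp add: lebesgue_on_UNIV_eq borel_measurable_integrable)
      then show "(\<lambda>x. - \<beta> (x - t) * v x) \<in> borel_measurable lebesgue"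
        by (simp add: grad mult.commute)
    qed
    moreover have "(LINT x|lebesgue. d n x * v x)
        = ((LINT x|lebesgue. bump r (t + X n) x * v x) - (LINT x|lebesgue. bump r t x * v x)) / X n" for n
      using vi by (simp add: d_def left_diff_distrib flip: Bochner_Integration.integral_diff)
    ultimately show "((\<lambda>h. ((LINT x|lebesgue. bump r (t
      + h) x * v x) - (LINT x|lebesgue. bump r t x * v x)) / h) \<circ> X)
        \<longlonglongrightarrow> (LINT x|lebesgue. - \<beta> (x - t) * v x)"
      by (simp add: o_def)
  qed
qed

text \<open>The kernel is nonnegative with mass one, so the mean differs from \<open>b t\<close> by
  at most the oscillation of \<open>b\<close> within the shrinking radius.\<close>

lemma bump_mean_tendsto:
  fixes b :: "real \<Rightarrow> real"
  assumes b: "continuous_on UNIV b"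
  shows "(\<lambda>n. LBINT x. b x * bump (inverse (real (Suc n))) t x) \<longlonglongrightarrow> b t"
proof (rule LIMSEQ_I)
  fix e :: real assume e: "0 < e"
  then obtain d where d: "0 < d" "\<And>x. \<bar>x - t\<bar> < d \<Longrightarrow> \<bar>b x - b t\<bar> < e / 2"
    using b[unfolded continuous_on_iff, rule_format, of t "e / 2"] by (auto simp: dist_real_def)
  obtain N where N: "inverse (real (Suc N)) < d" using reals_Archimedean[OF d(1)] by blast
  show "\<exists>N. \<forall>n\<ge>N. norm ((LBINT x. b x * bump (inverse (real (Suc n))) t x) - b t) < e"
  proof (intro exI[of _ N] allI impI)
    fix n assume "N \<le> n"
    define r where "r = inverse (real (Suc n))"
    have "inverse (real (Suc n)) \<le> inverse (real (Suc N))"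
      using \<open>N \<le> n\<close> by (intro le_imp_inverse_le) auto
    also note N
    finally have r: "0 < r" "r < d" unfolding r_def by simp_all
    note P = bump_props[OF r(1)]
    have i: "integrable lborel (\<lambda>x. f x * bump r t x)" if "continuous_on UNIV f" for f
      using integrable_test_function[OF P(1) that] .
    have i1: "integrable lborel (bump r t)" using i[of "\<lambda>x. 1"] by simp
    have cd: "continuous_on UNIV (\<lambda>x. b x - b t)" using b by (intro continuous_intros)
    have "(LBINT x. b x * bump r t x) - b t = (LBINT x. b x * bump r t x) - (LBINT x. b t * bump r t x)"
      using P(4)[of t] by simp
    also have "\<dots> = (LBINT x. b x * bump r t x - b t * bump r t x)"
      using i[OF b] i1 by simp
    also have "\<dots> = (LBINT x. (b x - b t) * bump r t x)" by (simp add: left_diff_distrib)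
    finally have "\<bar>(LBINT x. b x * bump r t x) - b t\<bar> \<le> (LBINT x. \<bar>(b x - b t) * bump r t x\<bar>)"
      using integral_abs_bound[of lborel "\<lambda>x. (b x - b t) * bump r t x"] by simp
    also have "\<dots> \<le> (LBINT x. e / 2 * bump r t x)"
    proof (rule integral_mono)
      show "integrable lborel (\<lambda>x. \<bar>(b x - b t) * bump r t x\<bar>)" using i[OF cd] by simp
      show "integrable lborel (\<lambda>x. e / 2 * bump r t x)" using i1 by simp
      fix x
      show "\<bar>(b x - b t) * bump r t x\<bar> \<le> e / 2 * bump r t x"
      proof (cases "x \<in> {t - r..t + r}")
        case True
        then have "\<bar>x - t\<bar> < d" using r by auto
        then have "\<bar>b x - b t\<bar> \<le> e / 2" using d(2) less_imp_le by blast
        then have "\<bar>b x - b t\<bar> * bump r t x \<le> e / 2 * bump r t x"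
          using P(2) by (intro mult_right_mono)
        then show ?thesis using P(2)[of t x] by (simp add: abs_mult)
      qed (simp add: P(3))
    qed
    also have "\<dots> = e / 2" using P(4)[of t] by simp
    finally show "norm ((LBINT x. b x * bump (inverse (real (Suc n))) t x) - b t) < e"
      using e by (simp add: r_def)
  qed
qed

text \<open>The means of \<open>b\<close> against bumps are twice differentiable, with second derivative at most
  \<open>M\<close>; the
  bound is uniform in the radius.\<close>

lemma difference_quotient_bound:
  fixes b g k :: "real \<Rightarrow> real"
  assumes b: "continuous_on UNIV b" and bg: "has_weak_grad UNIV b g" and gk: "has_weak_grad UNIV g k"
    and k: "AE x in lebesgue. \<bar>k x\<bar> \<le> M" and M: "0 \<le> M"
    and st: "s < t" "s' < t'" "A \<le> s" "A \<le> s'" "t \<le> B" "t' \<le> B"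
  shows "\<bar>(b t - b s) / (t - s) - (b t' - b s') / (t' - s')\<bar> \<le> M * (B - A)"
proof -
  define c where "c r f t = (LINT x|lebesgue. bump r t x * f x)" for r f and t :: real
  have step: "\<bar>(c r b t - c r b s) / (t - s) - (c r b t' - c r b s') / (t' - s')\<bar> \<le> M * (B - A)"
    if r: "0 < r" for r
  proof -
    note D = weak_gradient_convolution[OF bg r, folded c_def] weak_gradient_convolution[OF gk r, folded c_def]
    \<comment> \<open>Both quotients of the mollified \<open>b\<close> are values of the mollified
      \<open>g\<close> in the same interval; a second use of the mean value theorem compares these
      through the mollified \<open>k\<close>, bounded by \<open>M\<close>.\<close>
    have "\<exists>z. A \<le> z \<and> z \<le> B \<and> (c r b t - c r b s) / (t - s)
      = c r g z" if le: "s < t" "A \<le> s" "t \<le> B" for s t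
    proof -
      obtain z where "s < z" "z < t" "c r b t - c r b s = (t - s) * c r g z"
        using MVT2[OF le(1) D(1)] by blast
      then show ?thesis using le by (intro exI[of _ z]) simp
    qed
    then obtain y z where yz: "A \<le> y" "y \<le> B" "(c r b t - c r b s) / (t - s) = c r g y"
      "A \<le> z" "z \<le> B" "(c r b t' - c r b s') / (t' - s') = c r g z" using st by meson
    obtain q where q: "c r g y - c r g z = c r k q * (y - z)"
      using mean_value_between[of "c r g" "c r k" y z] D(2) by blast
    have "locally_integrable UNIV k" using gk by (simp add: has_weak_grad_def)
    from integrable_test_function_scaleR[OF _ this bump_props(1)[OF r, of q]]
    have ki: "integrable lebesgue (\<lambda>x. bump r q x * k x)" by (simp add: lebesgue_on_UNIV_eq)
    have m: "bump r q \<in> borel_measurable lborel"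
      using test_function_continuous[OF bump_props(1)[OF r]] by (simp add: borel_measurable_continuous_onI)
    have "integrable lborel (\<lambda>x. 1 * bump r q x)"
      by (rule integrable_test_function[OF bump_props(1)[OF r] continuous_on_const])
    then have bi: "integrable lebesgue (bump r q)" using integrable_completion[OF m] by simp
    have "\<bar>c r k q\<bar> \<le> (LINT x|lebesgue. \<bar>bump r q x * k x\<bar>)"
      unfolding c_def by (rule integral_abs_bound)
    also have "\<dots> \<le> (LINT x|lebesgue. bump r q x * M)"
    proof (rule integral_mono_AE)
      show "AE x in lebesgue. \<bar>bump r q x * k x\<bar> \<le> bump r q x * M"
        using k by eventually_elim (simp add: abs_mult bump_props(2)[OF r] mult_left_mono)
    qed (use ki bi in auto)
    also have "\<dots> = M" using integral_completion[OF m] bump_props(4)[OF r] by simp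
    finally have "\<bar>c r k q\<bar> \<le> M" .
    moreover have "\<bar>y - z\<bar> \<le> B - A" using yz by linarith
    ultimately show ?thesis unfolding yz q abs_mult using M by (intro mult_mono) auto
  qed
  have lim: "(\<lambda>n. c (inverse (real (Suc n))) b q) \<longlonglongrightarrow> b q" for q
  proof -
    have "c (inverse (real (Suc n))) b q = (LBINT x. b x * bump (inverse (real (Suc n))) q x)" for n
      unfolding c_def using b test_function_continuous[OF bump_props(1)[of "inverse (real (Suc n))" q]]
      by (subst integral_completion) (auto simp: mult.commute intro!: borel_measurable_continuous_onI continuous_on_mult)
    then show ?thesis using bump_mean_tendsto[OF b] by simp
  qed
  \<comment> \<open>As the radius tends to 0 only the means of \<open>b\<close> have to converge
    pointwise, which continuity of \<open>b\<close> guarantees; nothing is claimed about pointwise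
    limits for \<open>g\<close> and \<open>k\<close>.\<close>
  show ?thesis
    using st step by (intro LIMSEQ_le_const2[OF tendsto_rabs[OF tendsto_diff[OF
          tendsto_divide[OF tendsto_diff[OF lim lim] tendsto_const] tendsto_divide[OF tendsto_diff[OF lim lim]
            tendsto_const]]]]) auto
qed

text \<open>Difference quotients with steps of size at most d differ by at most
  \<open>2 * M * d\<close>, so they are Cauchy at every point and \<open>b\<close> is
  differentiable. Quotients with the same step at two points show that the derivative is Lipschitz.
  This gives the expansion of \<open>b\<close> a classical footing and \<open>deriv b\<close> its
  meaning.\<close>

lemma W2inf_real_regular:
  assumes b: "continuous_on UNIV b" "b \<in> W2inf_real"
  obtains M where "0 \<le> M" "\<And>t. (b has_real_derivative deriv b t) (at t)"
    "\<And>s t. \<bar>deriv b s - deriv b t\<bar> \<le> M * \<bar>s - t\<bar>"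
proof -
  from b(2) obtain g k where bg: "has_weak_grad UNIV b g" and gk: "has_weak_grad UNIV g k" and kL: "k \<in> Linf UNIV"
    unfolding W2inf_real_def W1inf_def by blast
  have AEk: "AE x in lebesgue. ereal (norm (k x)) \<le> Linf_norm UNIV k"
    unfolding Linf_norm_def using esssup_AE[of "\<lambda>x. ereal (norm (k x))" "lebesgue_on UNIV"]
    by (simp add: AE_lebesgue_on_iff lebesgue_on_UNIV_eq)
  obtain M where M: "0 \<le> M" "AE x in lebesgue. \<bar>k x\<bar> \<le> M"
  proof -
    from kL have "Linf_norm UNIV k < \<infinity>" by (simp add: Linf_def)
    then obtain m where "Linf_norm UNIV k \<le> ereal m" by (cases "Linf_norm UNIV k") auto
    with AEk have "AE x in lebesgue. \<bar>k x\<bar> \<le> max 0 m"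
      by (auto elim!: eventually_mono dest: order_trans)
    then show thesis by (intro that[of "max 0 m"]) auto
  qed
  note Q = difference_quotient_bound[OF b(1) bg gk M(2,1)]
  define q where "q t h = (b (t + h) - b t) / h" for t h
  have qq: "\<bar>q t h - q t h'\<bar> \<le> M * (2 * d)" if "h \<noteq> 0" "h' \<noteq> 0" "\<bar>h\<bar>
    \<le> d" "\<bar>h'\<bar> \<le> d" for t h h' d
  proof -
    \<comment> \<open>Ordering the endpoints makes the bound for quotients available for negative
      steps too.\<close>
    have as_quot: "q t h = (b (max t (t + h)) - b (min t (t + h))) / (max t (t + h) - min t (t + h))"
      if "h \<noteq> 0" for h
      using that by (cases "h > 0") (auto simp: q_def max_def min_def divide_simps)
    have "\<bar>q t h - q t h'\<bar> \<le> M * ((t + d) - (t - d))"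
      unfolding as_quot[OF that(1)] as_quot[OF that(2)] using that by (intro Q) auto
    then show ?thesis by (simp add: algebra_simps)
  qed
  define r where "r n = inverse (real (Suc n))" for n
  have r: "r \<longlonglongrightarrow> 0" "0 < r n" for n
    unfolding r_def[abs_def] using LIMSEQ_inverse_real_of_nat by auto
  have "Cauchy (\<lambda>n. q t (r n))" for t
  proof (rule metric_CauchyI)
    fix e :: real assume "0 < e"
    have "(\<lambda>n. M * (2 * r n)) \<longlonglongrightarrow> M * (2 * 0)" by (intro tendsto_intros r)
    then have "\<forall>\<^sub>F n in sequentially. M * (2 * r n) < e" using \<open>0 < e\<close>
      by (intro order_tendstoD(2)) auto
    then obtain N where N: "M * (2 * r N) < e" using eventually_happens'[OF sequentially_bot] by blast
    show "\<exists>N. \<forall>m\<ge>N. \<forall>n\<ge>N. dist (q t (r m)) (q t (r n)) < e"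
    proof (intro exI[of _ N] allI impI)
      fix m n assume mn: "N \<le> m" "N \<le> n"
      have "r m \<le> r N" "r n \<le> r N" using mn unfolding r_def by (auto intro: le_imp_inverse_le)
      then have "\<bar>q t (r m) - q t (r n)\<bar> \<le> M * (2 * r N)"
        using r(2)[of m] r(2)[of n] by (intro qq) auto
      with N show "dist (q t (r m)) (q t (r n)) < e" by (simp add: dist_real_def)
    qed
  qed
  then have "\<exists>L. (\<lambda>n. q t (r n)) \<longlonglongrightarrow> L" for t
    using Cauchy_convergent unfolding convergent_def by blast
  then obtain L where L: "\<And>t. (\<lambda>n. q t (r n)) \<longlonglongrightarrow> L t" by metis
  have D: "(b has_real_derivative L t) (at t)" for t
    unfolding DERIV_def
  proof (rule Lim_transform_eventually[rotated])
    show "\<forall>\<^sub>F h in at 0. q t h = (b (t + h) - b t) / h" by (simp add: q_def)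
    have "((\<lambda>h. q t h - L t) \<longlongrightarrow> 0) (at 0)"
    proof (rule Lim_null_comparison)
      \<comment> \<open>\<open>L t\<close> is only a limit along the steps \<open>r n\<close>;
        comparing an arbitrary \<open>h\<close> with eventually smaller steps upgrades it to the
        two-sided limit.\<close>
      have "\<bar>q t h - L t\<bar> \<le> M * (2 * \<bar>h\<bar>)" if h: "h \<noteq> 0" for h
      proof (rule LIMSEQ_le_const2)
        show "(\<lambda>n. \<bar>q t h - q t (r n)\<bar>) \<longlonglongrightarrow> \<bar>q t h - L t\<bar>"
          by (intro tendsto_intros L)
        have "\<forall>\<^sub>F n in sequentially. r n < \<bar>h\<bar>" using r(1) h by (intro order_tendstoD(2)) auto
        then obtain N where "\<And>n. N \<le> n \<Longrightarrow> r n < \<bar>h\<bar>" unfolding eventually_sequentially by blast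
        then show "\<exists>N. \<forall>n\<ge>N. \<bar>q t h - q t (r n)\<bar> \<le> M * (2 * \<bar>h\<bar>)"
          using r(2) h by (intro exI[of _ N] allI impI qq) (auto simp: less_imp_le less_imp_neq[symmetric])
      qed
      then show "\<forall>\<^sub>F h in at 0. norm (q t h - L t) \<le> M * (2 * \<bar>h\<bar>)"
        by (auto simp: eventually_at_filter)
      show "((\<lambda>h. M * (2 * \<bar>h\<bar>)) \<longlongrightarrow> 0) (at 0)" by (auto intro!: tendsto_eq_intros)
    qed
    then show "(q t \<longlongrightarrow> L t) (at 0)" by (rule Lim_null[THEN iffD2])
  qed
  have dL: "deriv b t = L t" for t using DERIV_imp_deriv[OF D] .
  have "\<bar>L s - L t\<bar> \<le> M * \<bar>s - t\<bar>" for s t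
  proof (rule LIMSEQ_le)
    show "(\<lambda>n. \<bar>q s (r n) - q t (r n)\<bar>) \<longlonglongrightarrow> \<bar>L s - L t\<bar>"
      by (intro tendsto_intros L)
    have "(\<lambda>n. M * (\<bar>s - t\<bar> + r n)) \<longlonglongrightarrow> M * (\<bar>s - t\<bar> + 0)"
      by (intro tendsto_intros r)
    then show "(\<lambda>n. M * (\<bar>s - t\<bar> + r n)) \<longlonglongrightarrow> M * \<bar>s - t\<bar>" by simp
    have "\<bar>q s (r n) - q t (r n)\<bar> \<le> M * (\<bar>s - t\<bar> + r n)" for n
    proof -
      \<comment> \<open>Both intervals lie between \<open>min s t\<close> and
        \<open>max s t + r n\<close>, whose distance exceeds that of \<open>s\<close> and
        \<open>t\<close> only by \<open>r n\<close>.\<close>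
      have "\<bar>(b (s + r n) - b s) / ((s + r n) - s) - (b (t + r n) - b t) / ((t + r n) - t)\<bar>
        \<le> M * ((max s t + r n) - min s t)"
        using r(2)[of n] by (intro Q) auto
      moreover have "(max s t + r n) - min s t = \<bar>s - t\<bar> + r n" by (simp add: max_def min_def)
      ultimately show ?thesis by (simp add: q_def)
    qed
    then show "\<exists>N. \<forall>n\<ge>N. \<bar>q s (r n) - q t (r n)\<bar> \<le> M * (\<bar>s - t\<bar> + r n)" by blast
  qed
  then show thesis using that[of M] M(1) D by (simp add: dL)
qed

section \<open>Coefficients of the linearized problem\<close>

lemma Linf_norm_AE: "AE x in lebesgue_on S. ereal (norm (v x)) \<le> Linf_norm S v"
  unfolding Linf_norm_def by (rule esssup_AE)

lemma Linf_AE_bound: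
  assumes "v \<in> Linf S"
  obtains R where "0 \<le> R" "AE x in lebesgue_on S. norm (v x) \<le> R"
proof -
  from assms have "Linf_norm S v < \<infinity>" by (simp add: Linf_def)
  then obtain m where m: "Linf_norm S v \<le> ereal m" by (cases "Linf_norm S v") auto
  have "AE x in lebesgue_on S. norm (v x) \<le> max 0 m"
    using Linf_norm_AE[of v S]
  proof eventually_elim
    case (elim x)
    then have "ereal (norm (v x)) \<le> ereal m" using m by (rule order_trans)
    then show ?case by simp
  qed
  then show thesis by (intro that[of "max 0 m"]) auto
qed

text \<open>The essential supremum is extended-real valued and a negative one would force the set to
  be null, which a nonempty open set is not. Nonnegativity lets a bound on a sum of norms pass to
  the summands.\<close>

lemma Linf_norm_nonneg:
  assumes "open S" "S \<noteq> {}"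
  shows "0 \<le> Linf_norm S v"
proof (rule ccontr)
  assume "\<not> 0 \<le> Linf_norm S v"
  then have "Linf_norm S v < 0" by simp
  have "AE x in lebesgue_on S. False"
    using Linf_norm_AE[of v S]
  proof eventually_elim
    case (elim x)
    then have "ereal (norm (v x)) < 0" using \<open>Linf_norm S v < 0\<close> by (rule order_le_less_trans)
    then show ?case by simp
  qed
  then have "AE x in lebesgue. x \<notin> S"
    using assms(1) by (simp add: AE_lebesgue_on_iff open_imp_lebesgue)
  then have "S \<in> null_sets lebesgue"
    using assms(1) by (subst AE_iff_null_sets) (auto simp: open_imp_lebesgue)
  then have "negligible S" by (simp add: negligible_iff_null_sets)
  then show False using open_not_negligible assms by blast
qed

lemma W1inf_norm_sum_le:
  assumes S: "open S" "S \<noteq> {}" and le: "W1inf_norm S v + W1inf_norm S w \<le> ereal \<eta>"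
  shows "AE x in lebesgue_on S. norm (v x) \<le> \<eta>" "AE x in lebesgue_on S. norm (wgrad S v x) \<le> \<eta>" (is ?P)
proof -
  have "0 \<le> W1inf_norm S w" for w
    unfolding W1inf_norm_def by (rule order_trans[OF Linf_norm_nonneg[OF S] max.cobounded1])
  then have "W1inf_norm S v \<le> W1inf_norm S v + W1inf_norm S w"
    by (simp add: ereal_le_add_self)
  then have "W1inf_norm S v \<le> ereal \<eta>" using le by (rule order_trans)
  then have "Linf_norm S v \<le> ereal \<eta>" "Linf_norm S (wgrad S v) \<le> ereal \<eta>"
    by (simp_all add: W1inf_norm_def)
  note le = order_trans[OF _ this(1)] order_trans[OF _ this(2)]
  show "AE x in lebesgue_on S. norm (v x) \<le> \<eta>"
    using Linf_norm_AE[of v S] by eventually_elim (drule le(1), simp)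
  show ?P
    using Linf_norm_AE[of "wgrad S v" S] by eventually_elim (drule le(2), simp)
qed

lemma L2_norm_fun:
  assumes "f \<in> L2 S" shows "(\<lambda>x. norm (f x)) \<in> L2 S" "L2_norm S (\<lambda>x. norm (f x)) = L2_norm S f"
  using assms by (auto simp: L2_def L2_norm_def)

lemma weighted_product:
  fixes f g :: "'a::euclidean_space \<Rightarrow> 'b::euclidean_space"
  assumes p: "p \<in> borel_measurable (lebesgue_on S)" "AE x in lebesgue_on S. \<bar>p x\<bar> \<le> C"
    and f: "f \<in> L2 S" and g: "g \<in> L2 S"
  shows "integrable (lebesgue_on S) (\<lambda>x. p x * (f x \<bullet> g x))" (is ?A)
    "\<bar>LINT x|lebesgue_on S. p x * (f x \<bullet> g x)\<bar> \<le> \<bar>C\<bar> * (L2_norm S f * L2_norm S g)" (is ?B)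
proof -
  have m: "(\<lambda>x. p x * (f x \<bullet> g x)) \<in> borel_measurable (lebesgue_on S)"
    by (intro borel_measurable_times borel_measurable_inner L2_measurable f g p)
  have le: "AE x in lebesgue_on S. \<bar>p x * (f x \<bullet> g x)\<bar> \<le> C * (norm (f x) * norm (g x))"
    using p(2)
  proof eventually_elim
    case (elim x)
    then show ?case
      unfolding abs_mult by (intro mult_mono Cauchy_Schwarz_ineq2) auto
  qed
  show ?A
    ?B
    using L2_product[OF f g m le] by auto
qed

text \<open>Here \<open>R\<close> and \<open>U\<close> bound \<open>u\<close> and its gradient. The
  bounds \<open>b1\<close> and \<open>L\<close> are imposed on the interval of radius
  \<open>R + 1\<close> because discrete solutions within distance 1 of \<open>u\<close> take their
  values there almost everywhere. Ellipticity and the Lipschitz constant \<open>M\<close> of the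
  derivative are global.\<close>

locale coefficients =
  fixes \<Omega> :: "(real^2) set" and \<alpha> u :: "real^2 \<Rightarrow> real" and b :: "real \<Rightarrow> real"
    and \<alpha>0 \<alpha>1 b0 b1 L M R U :: real
  assumes \<Omega>: "open \<Omega>" "bounded \<Omega>" "\<Omega> \<noteq> {}"
    and \<alpha>: "\<alpha> \<in> borel_measurable (lebesgue_on \<Omega>)"
      "AE x in lebesgue_on \<Omega>. \<alpha>0 \<le> \<alpha> x \<and> \<alpha> x
        \<le> \<alpha>1" "0 < \<alpha>0" "0 \<le> \<alpha>1"
    and b0: "0 < b0" "\<And>t. b0 \<le> b t"
    and b': "\<And>t. (b has_real_derivative deriv b t) (at t)"
      "\<And>s t. \<bar>deriv b s - deriv b t\<bar> \<le> M * \<bar>s - t\<bar>" "0 \<le> M"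
    and b1: "\<And>t. \<bar>t\<bar> \<le> R + 1 \<Longrightarrow> \<bar>b t\<bar> \<le> b1" "0 \<le> b1"
    and L: "\<And>t. \<bar>t\<bar> \<le> R + 1 \<Longrightarrow> \<bar>deriv b t\<bar> \<le> L" "0 \<le> L"
    and u: "u \<in> H10 \<Omega>" "AE x in lebesgue_on \<Omega>. \<bar>u x\<bar> \<le> R"
      "AE x in lebesgue_on \<Omega>. norm (wgrad \<Omega> u x) \<le> U" "0 \<le> U"
begin

abbreviation "\<M> \<equiv> lebesgue_on \<Omega>"
abbreviation "\<D> \<equiv> wgrad \<Omega>"
abbreviation nrm :: "(real^2 \<Rightarrow> 'b::euclidean_space) \<Rightarrow> real" where "nrm \<equiv> L2_norm \<Omega>"
abbreviation "\<B> \<equiv> diffusion_form \<Omega> \<alpha> b u"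
abbreviation "\<A> \<equiv> linearized_form \<Omega> \<alpha> b u"

lemma \<Omega>_lebesgue: "\<Omega> \<in> sets lebesgue"
  using \<Omega>(1) by (rule open_imp_lebesgue)

lemma H10_L2:
  assumes "v \<in> H10 \<Omega>"
  shows "v \<in> L2 \<Omega>" "\<D> v \<in> L2 \<Omega>"
  using H1D[OF \<Omega>(1) H10_H1[OF assms]] by auto

lemma wgrad_diff:
  assumes "v \<in> H10 \<Omega>" "w \<in> H10 \<Omega>"
  shows "AE x in \<M>. \<D> (\<lambda>x. v x - w x) x = \<D> v x - \<D> w x"
  by (rule H1_diff(2)[OF \<Omega>(1) H10_H1[OF assms(1)] H10_H1[OF assms(2)]])

lemma b_continuous: "continuous_on UNIV b" "continuous_on UNIV (deriv b)"
proof -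
  show "continuous_on UNIV b"
    using b'(1) by (meson DERIV_isCont continuous_at_imp_continuous_on)
  show "continuous_on UNIV (deriv b)"
    unfolding continuous_on_iff
  proof (intro ballI allI impI)
    fix t e :: real assume "0 < e"
    show "\<exists>d>0. \<forall>s\<in>UNIV. dist s t < d \<longrightarrow> dist (deriv b s) (deriv b t) < e"
    proof (intro exI[of _ "e / (M + 1)"] conjI ballI impI)
      show "0 < e / (M + 1)" using \<open>0 < e\<close> b'(3) by simp
      fix s assume "dist s t < e / (M + 1)"
      then have "(M + 1) * \<bar>s - t\<bar> < e" using b'(3) by (simp add: dist_real_def field_simps)
      moreover have "M * \<bar>s - t\<bar> \<le> (M + 1) * \<bar>s - t\<bar>" by (intro mult_right_mono) auto
      ultimately show "dist (deriv b s) (deriv b t) < e"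
        using b'(2)[of s t] by (simp add: dist_real_def)
    qed
  qed
qed

lemma measurable_compose_b:
  assumes "v \<in> borel_measurable \<M>"
  shows "(\<lambda>x. b (v x)) \<in> borel_measurable \<M>"
    "(\<lambda>x. deriv b (v x)) \<in> borel_measurable \<M>"
  using measurable_compose[OF assms borel_measurable_continuous_onI[OF b_continuous(1)]]
    measurable_compose[OF assms borel_measurable_continuous_onI[OF b_continuous(2)]] by auto

lemma b_lipschitz:
  assumes "\<bar>x\<bar> \<le> R + 1" "\<bar>y\<bar> \<le> R + 1"
  shows "\<bar>b x - b y\<bar> \<le> L * \<bar>x - y\<bar>"
proof -
  obtain \<xi> where \<xi>: "min x y \<le> \<xi>" "\<xi> \<le> max x y" "b x - b y = deriv b \<xi> * (x - y)"
    using mean_value_between[of b "deriv b" x y] b'(1) by blast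
  then have "\<bar>deriv b \<xi>\<bar> \<le> L" using assms by (intro L(1)) (auto simp: min_def max_def split: if_splits)
  then show ?thesis unfolding \<xi>(3) abs_mult by (intro mult_right_mono) auto
qed

text \<open>The intermediate point of the mean value theorem lies between \<open>x\<close> and
  \<open>y\<close>, hence within \<eta> of \<open>z\<close>. Expanding at the third point
  \<open>z\<close> makes the remainder linear in \<open>x - y\<close> with a small factor, as needed
  for a difference of two discrete solutions.\<close>

lemma b_taylor:
  assumes "\<bar>z - x\<bar> \<le> \<eta>" "\<bar>z - y\<bar> \<le> \<eta>"
  shows "\<bar>deriv b z * (x - y) - (b x - b y)\<bar> \<le> M * \<eta> * \<bar>x - y\<bar>"
proof -
  obtain \<xi> where \<xi>: "min x y \<le> \<xi>" "\<xi> \<le> max x y" "b x - b y = deriv b \<xi> * (x - y)"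
    using mean_value_between[of b "deriv b" x y] b'(1) by blast
  then have "\<bar>z - \<xi>\<bar> \<le> \<eta>" using assms by (auto simp: min_def max_def split: if_splits)
  then have "M * \<bar>z - \<xi>\<bar> \<le> M * \<eta>" using b'(3) by (intro mult_left_mono)
  with b'(2)[of z \<xi>] have "\<bar>deriv b z - deriv b \<xi>\<bar> \<le> M * \<eta>" by linarith
  then have "\<bar>deriv b z - deriv b \<xi>\<bar> * \<bar>x - y\<bar>
    \<le> M * \<eta> * \<bar>x - y\<bar>" by (intro mult_right_mono) auto
  then show ?thesis unfolding \<xi>(3) by (simp add: left_diff_distrib flip: abs_mult)
qed

lemma coefficient_bound:
  assumes v: "v \<in> borel_measurable \<M>" "AE x in \<M>. \<bar>v x\<bar> \<le> R + 1"
  shows "(\<lambda>x. \<alpha> x * b (v x)) \<in> borel_measurable \<M>" (is ?P)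
    "AE x in \<M>. \<bar>\<alpha> x * b (v x)\<bar> \<le> \<alpha>1 * b1" (is ?Q)
proof -
  show ?P
    by (intro borel_measurable_times \<alpha> measurable_compose_b v)
  show ?Q
    using \<alpha>(2) v(2)
  proof eventually_elim
    case (elim x)
    then have "\<bar>\<alpha> x\<bar> \<le> \<alpha>1" using \<alpha>(3) by auto
    then show ?case unfolding abs_mult using b1(1)[OF elim(2)] \<alpha>(4) by (intro mult_mono) auto
  qed
qed

lemma u_bound: "u \<in> borel_measurable \<M>" "AE x in \<M>. \<bar>u x\<bar> \<le> R + 1"
  using L2_measurable[OF H10_L2(1)[OF u(1)]] u(2) by (auto elim!: eventually_mono)

lemmas u_coefficient = coefficient_bound[OF u_bound]

definition G :: "real^2 \<Rightarrow> real^2" where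
  "G x = (\<alpha> x * deriv b (u x)) *\<^sub>R \<D> u x"

lemma G_bound: "G \<in> borel_measurable \<M>" "AE x in \<M>. norm (G x) \<le> \<alpha>1 * L * U"
proof -
  show "G \<in> borel_measurable \<M>"
    unfolding G_def[abs_def]
    by (intro borel_measurable_scaleR borel_measurable_times \<alpha> measurable_compose_b u_bound
        L2_measurable H10_L2 u)
  show "AE x in \<M>. norm (G x) \<le> \<alpha>1 * L * U"
    using \<alpha>(2) u_bound(2) u(3)
  proof eventually_elim
    case (elim x)
    then have "\<bar>\<alpha> x\<bar> \<le> \<alpha>1" using \<alpha>(3) by auto
    then show ?case
      unfolding G_def norm_scaleR abs_mult using L(1)[OF elim(2)] elim(3) \<alpha>(4) L(2)
      by (intro mult_mono) auto
  qed
qed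

section \<open>Boundedness, coercivity and splitting of the forms\<close>

lemma diffusion_form_estimates:
  assumes v: "v \<in> H10 \<Omega>" and \<psi>: "\<psi> \<in> H10 \<Omega>"
  shows "integrable \<M> (\<lambda>x. \<alpha> x * b (u x) * (\<D> v x \<bullet> \<D> \<psi> x))"
    and "\<bar>\<B> v \<psi>\<bar> \<le> \<alpha>1 * b1 * (nrm (\<D> v) * nrm (\<D> \<psi>))"
  using weighted_product[OF u_coefficient H10_L2(2)[OF v] H10_L2(2)[OF \<psi>]] \<alpha>(4) b1(2)
  by (auto simp: diffusion_form_def)

lemma diffusion_form_commute: "\<B> v \<psi> = \<B> \<psi> v"
  by (simp add: diffusion_form_def inner_commute)

lemma diffusion_form_diff_right:
  assumes v: "v \<in> H10 \<Omega>" and \<psi>: "\<psi> \<in> H10 \<Omega>" and \<zeta>: "\<zeta> \<in> H10 \<Omega>"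
  shows "\<B> v (\<lambda>x. \<psi> x - \<zeta> x) = \<B> v \<psi> - \<B> v \<zeta>"
proof -
  have "\<B> v (\<lambda>x. \<psi> x - \<zeta> x) = (LINT x|\<M>. \<alpha> x * b (u x) * (\<D> v x \<bullet> \<D> \<psi> x)
      - \<alpha> x * b (u x) * (\<D> v x \<bullet> \<D> \<zeta> x))"
    unfolding diffusion_form_def
  proof (rule integral_cong_AE)
    show "AE x in \<M>. \<alpha> x * b (u x) * (\<D> v x \<bullet> \<D> (\<lambda>x. \<psi> x - \<zeta> x) x)
      = \<alpha> x * b (u x) * (\<D> v x \<bullet> \<D> \<psi> x) - \<alpha> x * b (u x) * (\<D> v x \<bullet> \<D> \<zeta> x)"
      using wgrad_diff[OF \<psi> \<zeta>] by eventually_elim (simp add: inner_diff_right right_diff_distrib)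
  qed (use diffusion_form_estimates(1)[OF v \<psi>] diffusion_form_estimates(1)[OF v \<zeta>]
      diffusion_form_estimates(1)[OF v H10_diff[OF \<Omega>(1) \<psi> \<zeta>]] in auto)
  also have "\<dots> = \<B> v \<psi> - \<B> v \<zeta>"
    using diffusion_form_estimates(1)[OF v \<psi>] diffusion_form_estimates(1)[OF v \<zeta>]
    by (simp add: diffusion_form_def)
  finally show ?thesis .
qed

lemma diffusion_form_coercive:
  assumes v: "v \<in> H10 \<Omega>"
  shows "\<alpha>0 * b0 * (nrm (\<D> v))^2 \<le> \<B> v v"
proof -
  have i: "integrable \<M> (\<lambda>x. \<alpha>0 * b0 * (norm (\<D> v x))^2)"
    using H10_L2(2)[OF v] by (simp add: L2_def)
  have "(LINT x|\<M>. \<alpha>0 * b0 * (norm (\<D> v x))^2) \<le> \<B> v v"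
    unfolding diffusion_form_def
  proof (rule integral_mono_AE[OF i diffusion_form_estimates(1)[OF v v]])
    show "AE x in \<M>. \<alpha>0 * b0 * (norm (\<D> v x))^2
      \<le> \<alpha> x * b (u x) * (\<D> v x \<bullet> \<D> v x)"
      using \<alpha>(2)
    proof eventually_elim
      case (elim x)
      then have "\<alpha>0 * b0 \<le> \<alpha> x * b (u x)" using \<alpha>(3) b0 by (intro mult_mono) auto
      then show ?case unfolding power2_norm_eq_inner by (intro mult_right_mono) auto
    qed
  qed
  then show ?thesis by (simp add: L2_norm_power2)
qed

text \<open>The energy argument of Cea's lemma: the form tested with the error itself may be tested
  with \<zeta> instead, because the difference lies in \<open>V\<close>; coercivity and boundedness
  then give their ratio as constant, the same for every \<open>V\<close>.\<close>

lemma galerkin_stability: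
  assumes V: "V \<subseteq> H10 \<Omega>" and P: "galerkin_projection V \<Omega> \<alpha> b u P"
    and \<zeta>: "\<zeta> \<in> H10 \<Omega>"
  shows "nrm (\<D> (\<lambda>x. \<zeta> x - P \<zeta> x)) \<le> \<alpha>1 * b1 / (\<alpha>0 * b0) * nrm (\<D> \<zeta>)"
proof -
  have P\<zeta>: "P \<zeta> \<in> V" "P \<zeta> \<in> H10 \<Omega>"
    and orth: "\<And>v. v \<in> V \<Longrightarrow> \<B> (\<lambda>x. \<zeta> x - P \<zeta> x) v = 0"
    using P V \<zeta> by (auto simp: galerkin_projection_def)
  define \<psi> where "\<psi> = (\<lambda>x. \<zeta> x - P \<zeta> x)"
  have \<psi>: "\<psi> \<in> H10 \<Omega>" unfolding \<psi>_def by (rule H10_diff[OF \<Omega>(1) \<zeta> P\<zeta>(2)])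
  let ?n = "nrm (\<D> \<psi>)"
  have "\<alpha>0 * b0 * ?n^2 \<le> \<B> \<psi> \<psi>" by (rule diffusion_form_coercive[OF \<psi>])
  also have "\<dots> = \<B> \<psi> \<zeta>"
    using diffusion_form_diff_right[OF \<psi> \<zeta> P\<zeta>(2)] orth[OF P\<zeta>(1)] by (simp add: \<psi>_def)
  also have "\<dots> \<le> \<alpha>1 * b1 * (?n * nrm (\<D> \<zeta>))"
    using diffusion_form_estimates(2)[OF \<psi> \<zeta>] by linarith
  finally have le: "(\<alpha>0 * b0 * ?n) * ?n \<le> (\<alpha>1 * b1 * nrm (\<D> \<zeta>)) * ?n"
    by (simp add: power2_eq_square ac_simps)
  have "\<alpha>0 * b0 * ?n \<le> \<alpha>1 * b1 * nrm (\<D> \<zeta>)"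
  proof (cases "?n = 0")
    case True
    then show ?thesis using \<alpha>(4) b1(2) by (simp add: L2_norm_nonneg)
  next
    case False
    then have "0 < ?n" using L2_norm_nonneg[of \<Omega> "\<D> \<psi>"] by simp
    then show ?thesis using le by (rule mult_right_le_imp_le[rotated])
  qed
  then show ?thesis using \<alpha>(3) b0(1) by (simp add: \<psi>_def field_simps)
qed

lemma linearized_form_eq:
  assumes v: "v \<in> H10 \<Omega>" and \<psi>: "\<psi> \<in> H10 \<Omega>"
  shows "integrable \<M> (\<lambda>x. v x * (G x \<bullet> \<D> \<psi> x))" (is ?P)
    and "\<A> v \<psi> = \<B> v \<psi>
      + (LINT x|\<M>. v x * (G x \<bullet> \<D> \<psi> x))" (is ?Q)
proof -
  show i: ?P
    by (rule L2_product_field(1)[OF G_bound H10_L2(1)[OF v] H10_L2(2)[OF \<psi>]])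
  have "\<A> v \<psi> = (LINT x|\<M>. \<alpha> x * b (u x) * (\<D> v x \<bullet> \<D> \<psi> x)
      + v x * (G x \<bullet> \<D> \<psi> x))"
    unfolding linearized_form_def
    by (intro Bochner_Integration.integral_cong refl) (simp add: G_def algebra_simps)
  then show ?Q
    using i diffusion_form_estimates(1)[OF v \<psi>] by (simp add: diffusion_form_def)
qed

lemma linearized_form_split:
  assumes v: "v \<in> H10 \<Omega>" and \<psi>: "\<psi> \<in> H10 \<Omega>" and \<zeta>: "\<zeta> \<in> H10 \<Omega>"
  shows "\<A> v \<zeta> = \<A> v \<psi> + \<A> v (\<lambda>x. \<zeta> x - \<psi> x)"
proof -
  note d = H10_diff[OF \<Omega>(1) \<zeta> \<psi>]
  have "(LINT x|\<M>. v x * (G x \<bullet> \<D> (\<lambda>x. \<zeta> x - \<psi> x) x))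
    = (LINT x|\<M>. v x * (G x \<bullet> \<D> \<zeta> x) - v x * (G x \<bullet> \<D> \<psi> x))"
  proof (rule integral_cong_AE)
    show "AE x in \<M>. v x * (G x \<bullet> \<D> (\<lambda>x. \<zeta> x - \<psi> x) x)
        = v x * (G x \<bullet> \<D> \<zeta> x) - v x * (G x \<bullet> \<D> \<psi> x)"
      using wgrad_diff[OF \<zeta> \<psi>] by eventually_elim (simp add: inner_diff_right right_diff_distrib)
  qed (use linearized_form_eq(1)[OF v d] linearized_form_eq(1)[OF v \<zeta>] linearized_form_eq(1)[OF v \<psi>] in auto)
  then show ?thesis
    using linearized_form_eq(1)[OF v \<zeta>] linearized_form_eq(1)[OF v \<psi>]
    by (simp add: linearized_form_eq(2)[OF v] \<zeta> \<psi> d diffusion_form_diff_right[OF v \<zeta> \<psi>])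
qed

end

section \<open>Uniqueness of the discrete solution\<close>

context coefficients
begin

text \<open>The two discrete equations have the same right-hand side, so the nonlinear forms of
  \<open>w\<close> and \<open>w'\<close> may be subtracted from the linearized form without changing
  its value. What remains is the linearization error, which is of order \<eta> pointwise.\<close>

lemma consistency_estimate:
  assumes V: "V \<subseteq> H10 \<Omega>" and w: "solves_in V \<Omega> \<alpha> b f w"
    and w': "solves_in V \<Omega> \<alpha> b f w'" and v: "v \<in> V"
    and \<eta>: "\<eta> \<le> 1" "0 \<le> \<eta>"
    and cl: "AE x in \<M>. norm (u x - w x) \<le> \<eta>" "AE x in \<M>. norm (u x - w' x) \<le> \<eta>"
    and cl': "AE x in \<M>. norm (\<D> (\<lambda>x. u x - w' x) x) \<le> \<eta>"
  shows "\<bar>\<A> (\<lambda>x. w x - w' x) v\<bar>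
    \<le> \<alpha>1 * (2 * L + M * U) * \<eta> * ((nrm (\<lambda>x. w x - w' x)
        + nrm (\<D> (\<lambda>x. w x - w' x))) * nrm (\<D> v))"
proof -
  define e where "e = (\<lambda>x. w x - w' x)"
  have H: "w \<in> H10 \<Omega>" "w' \<in> H10 \<Omega>" "v \<in> H10 \<Omega>"
    using w w' v V by (auto simp: solves_in_def)
  have e: "e \<in> H10 \<Omega>" unfolding e_def by (rule H10_diff[OF \<Omega>(1) H(1,2)])
  have bd: "AE x in \<M>. \<bar>w x\<bar> \<le> R + 1" "AE x in \<M>. \<bar>w' x\<bar> \<le> R + 1"
  proof -
    show "AE x in \<M>. \<bar>w x\<bar> \<le> R + 1"
      using u(2) cl(1) by eventually_elim (use \<eta> in \<open>auto simp: abs_le_iff\<close>)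
    show "AE x in \<M>. \<bar>w' x\<bar> \<le> R + 1"
      using u(2) cl(2) by eventually_elim (use \<eta> in \<open>auto simp: abs_le_iff\<close>)
  qed
  let ?wv = "\<D> v" and ?we = "\<D> e" and ?ww = "\<D> w" and ?ww' = "\<D> w'" and ?wu = "\<D> u"
  note c = coefficient_bound[OF L2_measurable[OF H10_L2(1)[OF H(1)]] bd(1)]
    and c' = coefficient_bound[OF L2_measurable[OF H10_L2(1)[OF H(2)]] bd(2)]
  note i = weighted_product(1)[OF c H10_L2(2)[OF H(1)] H10_L2(2)[OF H(3)]]
    and i' = weighted_product(1)[OF c' H10_L2(2)[OF H(2)] H10_L2(2)[OF H(3)]]
  note l = linearized_form_eq[OF e H(3)] and d = diffusion_form_estimates(1)[OF e H(3)]
  \<comment> \<open>Collecting everything under one integral allows cancellation before absolute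
    values are taken.\<close>
  define Z where "Z x = \<alpha> x * b (u x) * (?we x \<bullet> ?wv x) + e x * (G x \<bullet> ?wv x)
    - \<alpha> x * b (w x) * (?ww x \<bullet> ?wv x) + \<alpha> x * b (w' x) * (?ww' x \<bullet> ?wv x)" for x
  have "diffusion_form \<Omega> \<alpha> b w w v = diffusion_form \<Omega> \<alpha> b w' w' v"
    using w w' v by (simp add: solves_in_def)
  then have "(LINT x|\<M>. \<alpha> x * b (w x) * (?ww x \<bullet> ?wv x))
    = (LINT x|\<M>. \<alpha> x * b (w' x) * (?ww' x \<bullet> ?wv x))"
    by (simp add: diffusion_form_def)
  moreover have "(LINT x|\<M>. Z x) = \<A> e v
    - (LINT x|\<M>. \<alpha> x * b (w x) * (?ww x \<bullet> ?wv x))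
    + (LINT x|\<M>. \<alpha> x * b (w' x) * (?ww' x \<bullet> ?wv x))"
    unfolding Z_def using i i' l(1) d by (simp add: l(2) diffusion_form_def)
  ultimately have Z: "\<A> e v = (LINT x|\<M>. Z x)" by simp
  have Zm: "Z \<in> borel_measurable \<M>"
    unfolding Z_def[abs_def] using i i' l(1) d by (intro borel_measurable_add borel_measurable_diff) auto
  \<comment> \<open>A single majorant for the terms with \<open>e\<close> and those with its
    gradient.\<close>
  define n where "n x = norm (e x) + norm (?we x)" for x
  have nL: "n \<in> L2 \<Omega>" "nrm n \<le> nrm e + nrm ?we"
    using L2_add[OF L2_norm_fun(1)[OF H10_L2(1)[OF e]] L2_norm_fun(1)[OF H10_L2(2)[OF e]]]
    unfolding n_def[abs_def] L2_norm_fun(2)[OF H10_L2(1)[OF e]] L2_norm_fun(2)[OF H10_L2(2)[OF e]] by auto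
  define K where "K = \<alpha>1 * (2 * L + M * U) * \<eta>"
  have K: "0 \<le> K" unfolding K_def using \<alpha>(4) L(2) b'(3) u(4) \<eta>(2) by simp
  have le: "AE x in \<M>. \<bar>Z x\<bar> \<le> K * (norm (n x) * norm (?wv x))"
    using cl cl' bd u_bound(2) u(3) \<alpha>(2) wgrad_diff[OF H(1,2)] wgrad_diff[OF u(1) H(2)]
  proof eventually_elim
    case (elim x)
    have we: "?we x = ?ww x - ?ww' x" using elim(9) by (simp add: e_def)
    \<comment> \<open>Each summand has one factor of size \<eta> and one that is linear in
      \<open>e\<close> or its gradient: the Lipschitz bound times the gradient of \<open>e\<close>,
      the Taylor remainder times \<open>grad u\<close>, and a Lipschitz difference times the
      gradient of \<open>u - w'\<close>. They contribute \<open>L\<close>, \<open>M * U\<close> and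
      \<open>L\<close> to the constant.\<close>
    have X: "Z x = \<alpha> x * (((b (u x) - b (w x)) *\<^sub>R ?we x
      + (deriv b (u x) * e x - (b (w x) - b (w' x))) *\<^sub>R ?wu x
      + (b (w x) - b (w' x)) *\<^sub>R (?wu x - ?ww' x)) \<bullet> ?wv x)" (is "_ = _ * (?X \<bullet> _)")
      by (simp add: Z_def G_def we inner_add_left inner_diff_left algebra_simps)
    have "\<bar>b (u x) - b (w x)\<bar> \<le> L * \<eta>"
    proof -
      have "\<bar>b (u x) - b (w x)\<bar> \<le> L * \<bar>u x - w x\<bar>" using elim by (intro b_lipschitz)
      also have "\<dots> \<le> L * \<eta>" using elim(1) L(2) by (intro mult_left_mono) auto
      finally show ?thesis .
    qed
    then have 1: "\<bar>b (u x) - b (w x)\<bar> * norm (?we x) \<le> L * \<eta> * norm (?we x)" by (intro mult_right_mono) auto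
    have "\<bar>deriv b (u x) * e x - (b (w x) - b (w' x))\<bar> \<le> M * \<eta> * \<bar>e x\<bar>"
      unfolding e_def using elim(1,2) by (intro b_taylor) auto
    then have 2: "\<bar>deriv b (u x) * e x - (b (w x) - b (w' x))\<bar> * norm (?wu x) \<le> M * \<eta> * \<bar>e x\<bar> * U"
      using elim(7) b'(3) \<eta>(2) by (intro mult_mono) auto
    have "\<bar>b (w x) - b (w' x)\<bar> \<le> L * \<bar>e x\<bar>" unfolding e_def using elim by (intro b_lipschitz)
    moreover have "norm (?wu x - ?ww' x) \<le> \<eta>" using elim(3,10) by simp
    ultimately have 3: "\<bar>b (w x) - b (w' x)\<bar> * norm (?wu x - ?ww' x) \<le> L * \<bar>e x\<bar> * \<eta>"
      using L(2) by (intro mult_mono) auto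
    have "norm ?X \<le> \<bar>b (u x) - b (w x)\<bar> * norm (?we x)
        + \<bar>deriv b (u x) * e x - (b (w x) - b (w' x))\<bar> * norm (?wu x)
        + \<bar>b (w x) - b (w' x)\<bar> * norm (?wu x - ?ww' x)"
      unfolding norm_scaleR[symmetric] by (intro norm_triangle_le add_mono order_refl)
    also have "\<dots> \<le> L * \<eta> * norm (?we x) + M * \<eta> * \<bar>e x\<bar> * U + L * \<bar>e x\<bar> * \<eta>"
      using 1 2 3 by (intro add_mono)
    also have "\<dots> \<le> (2 * L + M * U) * \<eta> * n x"
    proof -
      have "0 \<le> L * \<eta> * norm (?we x)" "0 \<le> L * \<eta> * \<bar>e x\<bar>" "0 \<le> M * U * \<eta> * norm (?we x)"
        using L(2) b'(3) u(4) \<eta>(2) by simp_all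
      then show ?thesis by (simp add: n_def algebra_simps)
    qed
    finally have X': "norm ?X \<le> (2 * L + M * U) * \<eta> * n x" .
    have "\<bar>Z x\<bar> \<le> \<bar>\<alpha> x\<bar> * (norm ?X * norm (?wv x))"
      unfolding X abs_mult by (intro mult_left_mono Cauchy_Schwarz_ineq2) auto
    also have "\<dots> \<le> \<alpha>1 * ((2 * L + M * U) * \<eta> * n x * norm (?wv x))"
      using X' elim(8) \<alpha>(3,4) by (intro mult_mono mult_right_mono) auto
    also have "\<dots> = K * (norm (n x) * norm (?wv x))"
      by (simp add: K_def n_def)
    finally show ?case .
  qed
  have "\<bar>LINT x|\<M>. Z x\<bar> \<le> \<bar>K\<bar> * (nrm n * nrm ?wv)"
    by (rule L2_product(2)[OF nL(1) H10_L2(2)[OF H(3)] Zm le])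
  also have "\<dots> \<le> K * ((nrm e + nrm ?we) * nrm ?wv)"
    using K nL(2) by (simp add: mult_left_mono mult_right_mono L2_norm_nonneg)
  finally show ?thesis unfolding Z[symmetric] K_def e_def by simp
qed

text \<open>Quantifying over all spaces \<open>V\<close> inside the property makes \<delta> and
  \<eta> independent of the mesh. The mesh size is represented by the approximation constant
  \<open>k\<close> alone.\<close>

definition discretely_unique :: "(real^2 \<Rightarrow> real) \<Rightarrow> real \<Rightarrow> real \<Rightarrow> bool" where
  "discretely_unique f \<delta> \<eta> \<longleftrightarrow> (\<forall>V P k w w'. V \<subseteq> H10 \<Omega>
    \<longrightarrow> (\<forall>v\<in>V. \<forall>w\<in>V. (\<lambda>x. v x - w x) \<in> V) \<longrightarrow>
    galerkin_projection V \<Omega> \<alpha> b u P \<longrightarrow>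
    (\<forall>\<psi>\<in>H10 \<Omega>. nrm (\<lambda>x. \<psi> x - P \<psi> x)
      \<le> k * H1_norm \<Omega> \<psi>) \<longrightarrow> \<bar>k\<bar> \<le> \<delta> \<longrightarrow>
    solves_in V \<Omega> \<alpha> b f w \<longrightarrow> solves_in V \<Omega> \<alpha> b f w' \<longrightarrow>
    W1inf_norm \<Omega> (\<lambda>x. u x - w x) + W1inf_norm \<Omega> (\<lambda>x. u x - w' x)
      \<le> ereal \<eta> \<longrightarrow>
    (AE x in \<M>. w x = w' x))"

text \<open>The upper bound \<open>3 * c / 4\<close> for the linearized form contradicts the inf-sup
  constant \<open>c\<close> unless the difference vanishes. It consists of three shares of
  \<open>c / 4\<close>, secured by \<epsilon>, \<delta> and \<eta>.\<close>

lemma discrete_uniqueness: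
  assumes c: "0 < c"
    and infsup: "\<forall>v\<in>H10 \<Omega>. (SUP \<psi> \<in> {\<psi> \<in> H10 \<Omega>. \<not> (AE x in \<M>. \<psi> x = 0)}.
              ereal (\<A> v \<psi> / H1_norm \<Omega> \<psi>)) \<ge> ereal (c * H1_norm \<Omega> v)"
  shows "\<exists>\<delta>>0. \<exists>\<eta>>0. discretely_unique f \<delta> \<eta>"
proof -
  define K where "K = \<alpha>1 * (2 * L + M * U)"
  have K: "0 \<le> K" unfolding K_def using \<alpha>(4) L(2) b'(3) u(4) by simp
  define S where "S = \<alpha>1 * b1 / (\<alpha>0 * b0)"
  have S: "0 \<le> S" unfolding S_def using \<alpha>(3,4) b1(2) b0(1) by simp
  \<comment> \<open>The 8 is 4 for the share \<open>c / 4\<close>, times 2 because the norms of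
    \<open>e\<close> and its gradient add up to at most twice the H1 norm. Adding 1 to
    \<open>S\<close> keeps the denominator positive; the same pattern recurs for \<delta> and
    \<eta>.\<close>
  define \<epsilon> where "\<epsilon> = c / (8 * (S + 1))"
  have \<epsilon>: "0 < \<epsilon>" "2 * \<epsilon> * S \<le> c / 4" using c S by (auto simp: \<epsilon>_def field_simps)
  have GM: "0 \<le> \<alpha>1 * L * U" using \<alpha>(4) L(2) u(4) by simp
  obtain C where C: "0 \<le> C" "\<forall>v\<in>H10 \<Omega>. \<forall>\<psi>\<in>H10 \<Omega>.
    \<bar>LINT x|\<M>. v x * (G x \<bullet> \<D> \<psi> x)\<bar>
    \<le> (nrm v + nrm (\<D> v)) * (\<epsilon> * nrm (\<D> \<psi>) + C * nrm \<psi>)"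
    using bounded_coefficient_estimate[OF \<Omega>(1,2) G_bound GM \<epsilon>(1)] by (elim exE conjE)
  \<comment> \<open>Must come after \<open>C\<close>, which depends on \<epsilon>: it makes the L2
    norm of \<open>\<psi>\<close> small enough to absorb \<open>C\<close>.\<close>
  define \<delta> where "\<delta> = c / (8 * (C + 1))"
  have \<delta>: "0 < \<delta>" "2 * C * \<delta> \<le> c / 4" using c C(1) by (auto simp: \<delta>_def field_simps)
  \<comment> \<open>The bound 1 keeps discrete solutions in the range where \<open>b1\<close> and
    \<open>L\<close> apply. The factor \<open>1 + S\<close> bounds the gradient norm of the
    projection, as that of \<zeta> plus that of the projection error.\<close>
  define \<eta> where "\<eta> = min 1 (c / (8 * ((K + 1) * (1 + S))))"
  have \<eta>: "0 < \<eta>" "\<eta> \<le> 1" using c K S by (auto simp: \<eta>_def)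
  have K\<eta>: "2 * (K * \<eta> * (1 + S)) \<le> c / 4"
  proof -
    have pos: "0 < (K + 1) * (1 + S)" using K S by simp
    have "K * \<eta> * (1 + S) \<le> (K + 1) * (1 + S) * \<eta>"
      using \<eta>(1) S by (simp add: algebra_simps)
    also have "\<dots> \<le> (K + 1) * (1 + S) * (c / (8 * ((K + 1) * (1 + S))))"
      using pos by (intro mult_left_mono) (auto simp: \<eta>_def)
    also have "\<dots> = c / 8"
    proof -
      have "q * (c / (8 * q)) = c / 8" if "0 < q" for q using that by simp
      from this[OF pos] show ?thesis .
    qed
    finally show ?thesis by simp
  qed
  show ?thesis
    unfolding discretely_unique_def
  proof (rule exI[of _ \<delta>], rule conjI[OF \<delta>(1)], rule exI[of _ \<eta>], rule conjI[OF \<eta>(1)], intro allI impI)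
    fix V P k w w'
    assume V: "V \<subseteq> H10 \<Omega>" and Vd: "\<forall>v\<in>V. \<forall>w\<in>V. (\<lambda>x. v x - w x) \<in> V"
      and P: "galerkin_projection V \<Omega> \<alpha> b u P"
      and k: "\<forall>\<psi>\<in>H10 \<Omega>. nrm (\<lambda>x. \<psi> x - P \<psi> x)
        \<le> k * H1_norm \<Omega> \<psi>" "\<bar>k\<bar> \<le> \<delta>"
      and w: "solves_in V \<Omega> \<alpha> b f w" and w': "solves_in V \<Omega> \<alpha> b f w'"
      and close: "W1inf_norm \<Omega> (\<lambda>x. u x - w x) + W1inf_norm \<Omega> (\<lambda>x. u x - w' x) \<le> ereal \<eta>"
    note cl = W1inf_norm_sum_le[OF \<Omega>(1,3) close]
      and cl' = W1inf_norm_sum_le[OF \<Omega>(1,3) close[unfolded add.commute[of "W1inf_norm \<Omega> (\<lambda>x. u x - w x)"]]]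
    define e where "e = (\<lambda>x. w x - w' x)"
    have eV: "e \<in> V" using w w' Vd by (simp add: e_def solves_in_def)
    then have e: "e \<in> H10 \<Omega>" using V by blast
    have le: "\<A> e \<zeta> \<le> 3 * c / 4 * H1_norm \<Omega> e * H1_norm \<Omega> \<zeta>" if \<zeta>: "\<zeta>
      \<in> H10 \<Omega>" for \<zeta>
    proof -
      define \<psi> where "\<psi> = (\<lambda>x. \<zeta> x - P \<zeta> x)"
      define N where "N = H1_norm \<Omega> e"
      define X where "X = H1_norm \<Omega> \<zeta>"
      have N: "0 \<le> N" "nrm e + nrm (\<D> e) \<le> 2 * N" "0 \<le> nrm e + nrm (\<D> e)"
        using H1_norm_ge[of \<Omega> e] L2_norm_nonneg[of \<Omega> e] L2_norm_nonneg[of \<Omega> "\<D> e"] by (auto simp: N_def)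
      have X: "0 \<le> X" "nrm (\<D> \<zeta>) \<le> X" using H1_norm_ge[of \<Omega> \<zeta>] by (auto simp: X_def)
      have P\<zeta>: "P \<zeta> \<in> V" "P \<zeta> \<in> H10 \<Omega>" and orth: "\<B> \<psi> e = 0"
        using P V \<zeta> eV by (auto simp: galerkin_projection_def \<psi>_def)
      have \<psi>: "\<psi> \<in> H10 \<Omega>" unfolding \<psi>_def by (rule H10_diff[OF \<Omega>(1) \<zeta> P\<zeta>(2)])
      have w\<psi>: "nrm (\<D> \<psi>) \<le> S * X"
      proof -
        have "nrm (\<D> \<psi>) \<le> S * nrm (\<D> \<zeta>)"
          unfolding \<psi>_def S_def by (rule galerkin_stability[OF V P \<zeta>])
        also have "\<dots> \<le> S * X" using X S by (intro mult_left_mono)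
        finally show ?thesis .
      qed
      have \<psi>2: "nrm \<psi> \<le> \<delta> * X"
      proof -
        have "nrm \<psi> \<le> k * X" using k(1) \<zeta> by (simp add: \<psi>_def X_def)
        also have "\<dots> \<le> \<delta> * X" using k(2) X(1) by (intro mult_right_mono) auto
        finally show ?thesis .
      qed
      have wP: "nrm (\<D> (P \<zeta>)) \<le> (1 + S) * X"
      proof -
        have eq: "AE x in \<M>. \<D> \<zeta> x + (-1) *\<^sub>R \<D> \<psi> x = \<D> (P \<zeta>) x"
          using wgrad_diff[OF \<zeta> P\<zeta>(2)] unfolding \<psi>_def by eventually_elim simp
        note m = L2_scaleR[OF H10_L2(2)[OF \<psi>], of "-1"]
        note a = L2_add[OF H10_L2(2)[OF \<zeta>] m(1)]
        have "nrm (\<D> (P \<zeta>)) = nrm (\<lambda>x. \<D> \<zeta> x + (-1) *\<^sub>R \<D> \<psi> x)"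
          by (rule L2_cong_AE(2)[OF \<Omega>_lebesgue a(1) eq])
        also have "\<dots> \<le> nrm (\<D> \<zeta>) + nrm (\<D> \<psi>)"
          using a(2) unfolding m(2) by simp
        finally have "nrm (\<D> (P \<zeta>)) \<le> nrm (\<D> \<zeta>) + nrm (\<D> \<psi>)" .
        then show ?thesis using X w\<psi> by (simp add: algebra_simps)
      qed
      have 1: "\<A> e (P \<zeta>) \<le> c / 4 * N * X"
      proof -
        have "\<A> e (P \<zeta>)
            \<le> K * \<eta> * ((nrm e + nrm (\<D> e)) * nrm (\<D> (P \<zeta>)))"
          using consistency_estimate[OF V w w' P\<zeta>(1) \<eta>(2) less_imp_le[OF \<eta>(1)] cl(1) cl'(1) cl'(2)]
          unfolding e_def K_def by linarith
        also have "\<dots> \<le> K * \<eta> * ((2 * N) * ((1 + S) * X))"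
          by (rule mult_left_mono[OF mult_mono[OF N(2) wP _ L2_norm_nonneg]]) (use N(1) K \<eta>(1) in simp_all)
        also have "\<dots> = 2 * (K * \<eta> * (1 + S)) * (N * X)" by simp
        also have "\<dots> \<le> c / 4 * (N * X)" using K\<eta> N(1) X(1) by (intro mult_right_mono) auto
        finally show ?thesis by simp
      qed
      have 2: "\<A> e \<psi> \<le> c / 2 * N * X"
      proof -
        have "\<A> e \<psi> = (LINT x|\<M>. e x * (G x \<bullet> \<D> \<psi> x))"
          using linearized_form_eq(2)[OF e \<psi>] orth diffusion_form_commute[of e \<psi>] by simp
        also have "\<dots> \<le> (nrm e + nrm (\<D> e)) * (\<epsilon> * nrm (\<D> \<psi>) + C * nrm \<psi>)"
          using C(2)[rule_format, OF e \<psi>] by linarith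
        also have "\<dots> \<le> (2 * N) * (\<epsilon> * (S * X) + C * (\<delta> * X))"
        proof (rule mult_mono[OF N(2)])
          show "\<epsilon> * nrm (\<D> \<psi>) + C * nrm \<psi> \<le> \<epsilon> * (S * X) + C * (\<delta> * X)"
            using \<epsilon>(1) C(1) by (intro add_mono mult_left_mono w\<psi> \<psi>2) auto
          show "0 \<le> \<epsilon> * nrm (\<D> \<psi>) + C * nrm \<psi>"
            using \<epsilon>(1) C(1) by (simp add: L2_norm_nonneg)
        qed (use N(1) in simp)
        also have "\<dots> = (2 * \<epsilon> * S + 2 * C * \<delta>) * (N * X)" by (simp add: algebra_simps)
        also have "\<dots> \<le> c / 2 * (N * X)" using \<epsilon>(2) \<delta>(2) N(1) X(1) by (intro mult_right_mono) auto
        finally show ?thesis by simp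
      qed
      have "\<A> e \<zeta> = \<A> e (P \<zeta>) + \<A> e \<psi>"
        unfolding \<psi>_def by (rule linearized_form_split[OF e P\<zeta>(2) \<zeta>])
      also have "\<dots> \<le> c / 4 * N * X + c / 2 * N * X" using 1 2 by (intro add_mono)
      also have "\<dots> = 3 * c / 4 * N * X" by (simp add: algebra_simps)
      finally show ?thesis by (simp add: N_def X_def)
    qed
    have "ereal (c * H1_norm \<Omega> e) \<le> (SUP \<psi> \<in> {\<psi> \<in> H10 \<Omega>. \<not> (AE x in \<M>. \<psi> x = 0)}.
              ereal (\<A> e \<psi> / H1_norm \<Omega> \<psi>))"
      by (rule infsup[rule_format, OF e])
    also have "\<dots> \<le> ereal (3 * c / 4 * H1_norm \<Omega> e)"
    proof (rule SUP_least)
      fix \<psi> assume "\<psi> \<in> {\<psi> \<in> H10 \<Omega>. \<not> (AE x in \<M>. \<psi> x = 0)}"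
      then have "\<psi> \<in> H10 \<Omega>" by simp
      \<comment> \<open>When the norm in the denominator is 0 the quotient is 0 by convention, and
        the bound holds because its right-hand side is nonnegative.\<close>
      from le[OF this] have "\<A> e \<psi> / H1_norm \<Omega> \<psi> \<le> 3 * c / 4 * H1_norm \<Omega> e"
        using H1_norm_ge(3)[of \<Omega> \<psi>] H1_norm_ge(3)[of \<Omega> e] c
        by (cases "H1_norm \<Omega> \<psi> = 0") (simp_all add: pos_divide_le_eq)
      then show "ereal (\<A> e \<psi> / H1_norm \<Omega> \<psi>) \<le> ereal (3 * c / 4 * H1_norm \<Omega> e)"
        by simp
    qed
    finally have "c * H1_norm \<Omega> e \<le> 3 * c / 4 * H1_norm \<Omega> e" by simp
    then have "c * H1_norm \<Omega> e \<le> 0" by (simp add: algebra_simps)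
    then have "H1_norm \<Omega> e \<le> 0" using c by (simp add: mult_le_0_iff)
    then have "nrm e = 0" using H1_norm_ge(1)[of \<Omega> e] L2_norm_nonneg[of \<Omega> e] by linarith
    from L2_norm_eq_0[OF H10_L2(1)[OF e] this]
    show "AE x in \<M>. w x = w' x" by eventually_elim (simp add: e_def)
  qed
qed

end

section \<open>Enriched spaces, the mesh size and the theorem itself\<close>

lemma enriched_space_subset:
  assumes \<Omega>: "open \<Omega>" and V: "finite_element_space \<Omega> \<T> V"
  shows "enriched_space \<Omega> \<T> V \<subseteq> H10 \<Omega>"
proof
  fix v assume "v \<in> enriched_space \<Omega> \<T> V"
  then obtain p q where "v = (\<lambda>x. p x + q x)" "p \<in> V" "q \<in> bubble_space \<Omega> \<T>"
    unfolding enriched_space_def by blast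
  moreover have "V \<subseteq> H10 \<Omega>" using V by (simp add: finite_element_space_def)
  ultimately show "v \<in> H10 \<Omega>" using H10_add[OF \<Omega>, of p q] by (auto simp: bubble_space_def)
qed

text \<open>The bubble condition is preserved element by element; it uses that the elements,
  represented by their interiors, are open.\<close>

lemma enriched_space_diff:
  assumes \<Omega>: "open \<Omega>" and \<T>: "partition_into_elements \<Omega> \<T>"
    and V: "finite_element_space \<Omega> \<T> V"
    and v: "v \<in> enriched_space \<Omega> \<T> V" and w: "w \<in> enriched_space \<Omega> \<T> V"
  shows "(\<lambda>x. v x - w x) \<in> enriched_space \<Omega> \<T> V"
proof -
  obtain p q where pq: "v = (\<lambda>x. p x + q x)" "p \<in> V" "q \<in> bubble_space \<Omega> \<T>"
    using v unfolding enriched_space_def by blast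
  obtain p' q' where pq': "w = (\<lambda>x. p' x + q' x)" "p' \<in> V" "q' \<in> bubble_space \<Omega> \<T>"
    using w unfolding enriched_space_def by blast
  have op: "open K" if "K \<in> \<T>" for K
    using \<T> that by (simp add: partition_into_elements_def polygonal_domain_def)
  have add: "\<And>v w. v \<in> V \<Longrightarrow> w \<in> V \<Longrightarrow> (\<lambda>x. v x + w x) \<in> V"
    and mul: "\<And>a v. v \<in> V \<Longrightarrow> (\<lambda>x. a * v x) \<in> V"
    using V by (simp_all add: finite_element_space_def)
  have "(\<lambda>x. p x - p' x) \<in> V" using add[OF pq(2) mul[OF pq'(2), of "-1"]] by simp
  moreover have "(\<lambda>x. q x - q' x) \<in> bubble_space \<Omega> \<T>"
    using pq(3) pq'(3) op \<Omega> by (auto simp: bubble_space_def intro!: H10_diff)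
  moreover have "(\<lambda>x. v x - w x) = (\<lambda>x. (p x - p' x) + (q x - q' x))"
    by (auto simp: pq(1) pq'(1))
  ultimately show ?thesis
    unfolding enriched_space_def by (intro CollectI exI[of _ "\<lambda>x. p x - p' x"] exI[of _ "\<lambda>x. q x - q' x"] conjI)
qed

text \<open>The limit of \<open>chat\<close> at 0 says nothing about its value at 0 itself, so mesh
  sizes must be known to be positive. Some element exists and contains a ball.\<close>

lemma mesh_size_pos:
  assumes \<Omega>: "\<Omega> \<noteq> {}" and \<T>: "partition_into_elements \<Omega> \<T>"
  shows "0 < mesh_size \<T>"
proof -
  have fin: "finite \<T>" and cov: "(\<Union>K\<in>\<T>. closure K)
    = closure \<Omega>" and pd: "\<And>K. K \<in> \<T> \<Longrightarrow> polygonal_domain K"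
    using \<T> by (auto simp: partition_into_elements_def)
  have "\<T> \<noteq> {}"
  proof
    assume "\<T> = {}"
    with cov have "closure \<Omega> = {}" by simp
    with \<Omega> show False by simp
  qed
  then obtain K where K: "K \<in> \<T>" by blast
  have oK: "open K" "bounded K" "K \<noteq> {}" using pd[OF K] by (auto simp: polygonal_domain_def)
  then obtain x r where x: "0 < r" "ball x r \<subseteq> K" by (meson all_not_in_conv open_contains_ball)
  have "0 < diameter K"
    using diameter_subset[OF x(2) oK(2)] x(1) diameter_ball[of x r] by simp
  also have "\<dots> \<le> mesh_size \<T>" unfolding mesh_size_def using fin K by simp
  finally show ?thesis .
qed

theorem theorem3p8:
  fixes \<Omega> :: "(real^2) set"
    and \<alpha> f u :: "real^2 \<Rightarrow> real"
    and b :: "real \<Rightarrow> real"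
    and \<alpha>0 \<alpha>1 b0 c :: real
    and H :: "real set"
    and \<T> :: "real \<Rightarrow> (real^2) set set"
    and V :: "real \<Rightarrow> (real^2 \<Rightarrow> real) set"
    and P :: "real \<Rightarrow> (real^2 \<Rightarrow> real) \<Rightarrow> (real^2 \<Rightarrow> real)"
    and chat :: "real \<Rightarrow> real"
  assumes "polygonal_domain \<Omega>"
    and "\<alpha> \<in> borel_measurable (lebesgue_on \<Omega>)"
    and "0 < \<alpha>0" and "AE x in lebesgue_on \<Omega>. \<alpha>0 \<le> \<alpha> x \<and> \<alpha> x \<le> \<alpha>1"
    and "continuous_on UNIV b" and "b \<in> W2inf_real"
    and "0 < b0" and "\<And>t. b0 \<le> b t"
    and "f \<in> L2 \<Omega>"
    and "u \<in> W1inf \<Omega>" and "solves_in (H10 \<Omega>) \<Omega> \<alpha> b f u"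
    and "\<And>h. h \<in> H \<Longrightarrow> partition_into_elements \<Omega> (\<T> h)"
    and "\<And>h. h \<in> H \<Longrightarrow> mesh_size (\<T> h) = h"
    and "\<And>h. h \<in> H \<Longrightarrow> finite_element_space \<Omega> (\<T> h) (V h)"
    and "\<And>h. h \<in> H \<Longrightarrow> direct_sum_with_bubbles \<Omega> (\<T> h) (V h)"
    and "0 < c"
    and "\<And>v. v \<in> H10 \<Omega> \<Longrightarrow>
           (SUP \<psi> \<in> {\<psi> \<in> H10 \<Omega>. \<not> (AE x in lebesgue_on \<Omega>. \<psi> x = 0)}.
              ereal (linearized_form \<Omega> \<alpha> b u v \<psi> / H1_norm \<Omega> \<psi>)) \<ge> ereal (c * H1_norm \<Omega> v)"
    and "\<And>h. h \<in> H \<Longrightarrow> galerkin_projection (enriched_space \<Omega> (\<T> h) (V h)) \<Omega> \<alpha> b u (P h)"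
    and "\<And>h \<psi>. h \<in> H \<Longrightarrow> \<psi> \<in> H10 \<Omega> \<Longrightarrow>
           L2_norm \<Omega> (\<lambda>x. \<psi> x - P h \<psi> x) \<le> chat h * H1_norm \<Omega> \<psi>"
    and "(chat \<longlongrightarrow> 0) (at 0 within H)"
  shows "\<exists>h0 > 0. \<exists>\<eta> > 0. \<forall>h \<in> H. h \<le> h0 \<longrightarrow>
           (\<forall>u\<^sub>h u\<^sub>h'.
              solves_in (enriched_space \<Omega> (\<T> h) (V h)) \<Omega> \<alpha> b f u\<^sub>h \<longrightarrow>
              solves_in (enriched_space \<Omega> (\<T> h) (V h)) \<Omega> \<alpha> b f u\<^sub>h' \<longrightarrow>
              W1inf_norm \<Omega> (\<lambda>x. u x - u\<^sub>h x) + W1inf_norm \<Omega> (\<lambda>x. u x - u\<^sub>h' x) \<le> ereal \<eta> \<longrightarrow>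
              (AE x in lebesgue_on \<Omega>. u\<^sub>h x = u\<^sub>h' x))"
proof -
  note A = assms
  have \<Omega>: "open \<Omega>" "bounded \<Omega>" "\<Omega> \<noteq> {}" using A(1) by (auto simp: polygonal_domain_def)
  obtain M where M: "0 \<le> M" "\<And>t. (b has_real_derivative deriv b t) (at t)"
    "\<And>s t. \<bar>deriv b s - deriv b t\<bar> \<le> M * \<bar>s - t\<bar>"
    using W2inf_real_regular[OF A(5,6)] by metis
  from A(10) obtain g where uL: "u \<in> Linf \<Omega>" and g: "g \<in> Linf \<Omega>" "has_weak_grad \<Omega> u g"
    by (auto simp: W1inf_def)
  obtain R where R: "0 \<le> R" "AE x in lebesgue_on \<Omega>. norm (u x) \<le> R" by (rule Linf_AE_bound[OF uL])
  obtain U where U: "0 \<le> U" "AE x in lebesgue_on \<Omega>. norm (g x) \<le> U" by (rule Linf_AE_bound[OF g(1)])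
  have wu: "AE x in lebesgue_on \<Omega>. norm (wgrad \<Omega> u x) \<le> U"
    using wgrad_AE_eq[OF \<Omega>(1) g(2)] U(2) by eventually_elim simp
  \<comment> \<open>On a bounded interval the Lipschitz derivative is bounded by its value at 0 plus
    its variation.\<close>
  have deriv_b: "\<bar>deriv b t\<bar> \<le> \<bar>deriv b 0\<bar> + M * (R + 1)" if "\<bar>t\<bar> \<le> R + 1" for t
  proof -
    have "M * \<bar>t - 0\<bar> \<le> M * (R + 1)" using that M(1) by (intro mult_left_mono) auto
    then show ?thesis using M(3)[of t 0] by linarith
  qed
  obtain B where B: "0 \<le> B" "\<And>t. t \<in> {- (R + 1)..R + 1} \<Longrightarrow> norm (b t) \<le> B"
    using compact_continuous_bound[OF A(5) compact_Icc] by metis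
  \<comment> \<open>The maximum with 0 supplies the sign condition on the upper bound directly,
    without deriving it from the almost everywhere inequality.\<close>
  interpret coefficients \<Omega> \<alpha> u b \<alpha>0 "max 0 \<alpha>1" b0 B "\<bar>deriv b 0\<bar> + M * (R + 1)" M R U
  proof
    show "AE x in lebesgue_on \<Omega>. \<alpha>0 \<le> \<alpha> x \<and> \<alpha> x \<le> max 0 \<alpha>1"
      using A(4) by eventually_elim auto
    show "\<bar>t\<bar> \<le> R + 1 \<Longrightarrow> \<bar>b t\<bar> \<le> B" for t using B(2)[of t] by (auto simp: abs_le_iff)
    show "u \<in> H10 \<Omega>" using A(11) by (simp add: solves_in_def)
    show "AE x in lebesgue_on \<Omega>. \<bar>u x\<bar> \<le> R" using R(2) by simp
  qed (use \<Omega> A(2,3,7,8) M R(1) B(1) U(1) wu deriv_b in auto)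
  have infsup: "\<forall>v\<in>H10 \<Omega>. (SUP \<psi> \<in> {\<psi> \<in> H10 \<Omega>. \<not> (AE x in lebesgue_on \<Omega>. \<psi> x = 0)}.
              ereal (linearized_form \<Omega> \<alpha> b u v \<psi> / H1_norm \<Omega> \<psi>)) \<ge> ereal (c * H1_norm \<Omega> v)"
    by (rule ballI) (rule A(17))
  obtain \<delta> \<eta> where \<delta>: "0 < \<delta>" and \<eta>: "0 < \<eta>"
    and uniq: "discretely_unique f \<delta> \<eta>"
    using discrete_uniqueness[OF A(16) infsup, of f] by (elim exE conjE)
  have "\<forall>\<^sub>F h in at 0 within H. \<bar>chat h\<bar> < \<delta>"
    using A(20) \<delta> by (auto simp: tendsto_iff dist_real_def)
  then obtain d where d: "0 < d" "\<And>h. h \<in> H \<Longrightarrow> h \<noteq> 0 \<Longrightarrow> \<bar>h\<bar> < d \<Longrightarrow> \<bar>chat h\<bar> < \<delta>"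
    by (auto simp: eventually_at dist_real_def)
  show ?thesis
  \<comment> \<open>Halving \<open>d\<close> turns the non-strict condition on \<open>h\<close> into
    the strict one that the limit provides.\<close>
  proof (rule exI[of _ "d / 2"], rule conjI[OF half_gt_zero[OF d(1)]], rule exI[of _ \<eta>], rule conjI[OF \<eta>],
      intro ballI allI impI)
    fix h w w' assume h: "h \<in> H" "h \<le> d / 2"
      and w: "solves_in (enriched_space \<Omega> (\<T> h) (V h)) \<Omega> \<alpha> b f w"
      and w': "solves_in (enriched_space \<Omega> (\<T> h) (V h)) \<Omega> \<alpha> b f w'"
      and close: "W1inf_norm \<Omega> (\<lambda>x. u x - w x) + W1inf_norm \<Omega> (\<lambda>x. u x - w' x) \<le> ereal \<eta>"
    let ?V = "enriched_space \<Omega> (\<T> h) (V h)"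
    have "0 < h" using mesh_size_pos[OF \<Omega>(3) A(12)[OF h(1)]] A(13)[OF h(1)] by simp
    then have "\<bar>chat h\<bar> \<le> \<delta>" using d(2)[OF h(1)] h(2) d(1) by simp
    moreover have "?V \<subseteq> H10 \<Omega>" by (rule enriched_space_subset[OF \<Omega>(1) A(14)[OF h(1)]])
    moreover have "\<forall>v\<in>?V. \<forall>w\<in>?V. (\<lambda>x. v x - w x) \<in> ?V"
      using enriched_space_diff[OF \<Omega>(1) A(12)[OF h(1)] A(14)[OF h(1)]] by blast
    moreover have "\<forall>\<psi>\<in>H10 \<Omega>. L2_norm \<Omega> (\<lambda>x. \<psi> x - P h \<psi> x) \<le> chat h * H1_norm \<Omega> \<psi>"
      using A(19)[OF h(1)] by blast
    ultimately show "AE x in lebesgue_on \<Omega>. w x = w' x"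
      using uniq[unfolded discretely_unique_def, THEN spec[of _ ?V], THEN spec[of _ "P h"], THEN spec[of _ "chat h"], THEN spec[of _ w], THEN spec[of _ w']]
        A(18)[OF h(1)] w w' close by simp
  qed
qed

end
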